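(* There is a Monte-Carlo algorithm that, given a connected undirected graph $G=(V,E)$, an integer $k$, and an elimination forest of depth $d$ for $G$, solves Connected Dominating Set on $(G,k)$ in time $\mathcal{O}^*(4^d)$ and polynomial space. The algorithm cannot give false positives and may give false negatives with probability at most $1/2$.
   Context: Connected Dominating Set: the input is an undirected graph $G=(V,E)$ and an integer $k$; the question is whether there is a set $X\subseteq V$ with $|X|=k$ such that the induced subgraph $G[X]$ is connected and $X$ is a dominating set of $G$, i.e., $N[X]=V$, where $N[X]$ is the set of vertices that are in $X$ or adjacent to a vertex of $X$. An elimination forest of an undirected graph $G=(V,E)$ is a rooted forest $\mathcal{T}=(V,E_{\mathcal{T}})$ on the same vertex set such that for every edge $\{u,v\}\in E$ either $u$ is an ancestor of $v$ in $\mathcal{T}$ or $v$ is an ancestor of $u$ in $\mathcal{T}$. The depth of a rooted forest is the largest number of nodes on a path from a root to a leaf. The $\mathcal{O}^*$-notation hides factors polynomial in the input size. Polynomial space means space polynomial in the input size. "No false positives" means that on a no-instance the algorithm always answers no; "false negatives with probability at most $1/2$" means that on a yes-instance it answers yes with probability at least $1/2$ over its internal randomness. *)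

theory Defs
  imports
    "HOL-Probability.Probability_Mass_Function"
    "HOL-Library.Log_Nat"
    "HOL-Computational_Algebra.Polynomial"
    "Graph_Theory.Graph_Theory"
begin

section \<open>Connected dominating sets\<close>

definition closed_nbhd :: "('a, 'b) pre_digraph \<Rightarrow> 'a set \<Rightarrow> 'a set" where
  "closed_nbhd G X = X \<union> {v \<in> verts G. \<exists>u\<in>X. u \<rightarrow>\<^bsub>G\<^esub> v}"

definition dominating_set :: "('a, 'b) pre_digraph \<Rightarrow> 'a set \<Rightarrow> bool" where
  "dominating_set G X \<longleftrightarrow> X \<subseteq> verts G \<and> closed_nbhd G X = verts G"

definition connected_dominating_set :: "('a, 'b) pre_digraph \<Rightarrow> int \<Rightarrow> bool" where
  "connected_dominating_set G k \<longleftrightarrow>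
    (\<exists>X \<subseteq> verts G. int (card X) = k \<and> Digraph_Component.connected (G \<restriction> X) \<and> dominating_set G X)"


section \<open>Elimination forests\<close>

text \<open>Arcs of a rooted forest point from parents to children, so roots have in-degree 0,
  leaves have out-degree 0, and reachability is the (reflexive) ancestor relation.
  \<^const>\<open>Digraph_Component.forest\<close> only excludes directed cycles; the bound on the
  in-degrees excludes a second parent.\<close>

definition rooted_forest :: "('a, 'b) pre_digraph \<Rightarrow> bool" where
  "rooted_forest T \<longleftrightarrow> fin_digraph T \<and> forest T \<and> (\<forall>v\<in>verts T. in_degree T v \<le> 1)"

definition forest_depth :: "('a, 'b) pre_digraph \<Rightarrow> nat" where
  "forest_depth T =
    Max {length p | p. vpath p T \<and> in_degree T (hd p) = 0 \<and> out_degree T (last p) = 0}"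

definition elimination_forest :: "('a, 'b) pre_digraph \<Rightarrow> ('a, 'c) pre_digraph \<Rightarrow> bool" where
  "elimination_forest G T \<longleftrightarrow> rooted_forest T \<and> verts T = verts G \<and>
    (\<forall>u v. u \<rightarrow>\<^bsub>G\<^esub> v \<longrightarrow> u \<rightarrow>\<^sup>*\<^bsub>T\<^esub> v \<or> v \<rightarrow>\<^sup>*\<^bsub>T\<^esub> u)"


section \<open>Randomised random access machines with logarithmic cost\<close>

text \<open>A program is a structured command over a memory of cells that are addressed by, and contain,
  natural numbers. Memory accesses may be indirect. As usual for the logarithmic cost measure, every
  evaluation of an operation is charged the bit length of its result (hence also of every address
  and operand).\<close>

type_synonym memory = "nat \<Rightarrow> nat"

datatype expr =
    Const nat
  | Cell expr
  | Add expr expr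
  | Sub expr expr
  | Mul expr expr
  | Quot expr expr
  | Rem expr expr

datatype com =
    Skip
  | Assign expr expr
  | Flip expr
  | Seq com com
  | Cond expr com com
  | Loop expr com

primrec val :: "expr \<Rightarrow> memory \<Rightarrow> nat" where
  "val (Const n) m = n"
| "val (Cell a) m = m (val a m)"
| "val (Add a b) m = val a m + val b m"
| "val (Sub a b) m = val a m - val b m"
| "val (Mul a b) m = val a m * val b m"
| "val (Quot a b) m = val a m div val b m"
| "val (Rem a b) m = val a m mod val b m"

abbreviation bits :: "nat \<Rightarrow> nat" where
  "bits n \<equiv> floorlog 2 n"

primrec cost :: "expr \<Rightarrow> memory \<Rightarrow> nat" where
  "cost (Const n) m = 1 + bits n"
| "cost (Cell a) m = cost a m + 1 + bits (m (val a m))"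
| "cost (Add a b) m = cost a m + cost b m + 1 + bits (val (Add a b) m)"
| "cost (Sub a b) m = cost a m + cost b m + 1 + bits (val (Sub a b) m)"
| "cost (Mul a b) m = cost a m + cost b m + 1 + bits (val (Mul a b) m)"
| "cost (Quot a b) m = cost a m + cost b m + 1 + bits (val (Quot a b) m)"
| "cost (Rem a b) m = cost a m + cost b m + 1 + bits (val (Rem a b) m)"

text \<open>A single step yields the remaining command, the new memory and the cost of the step.
  Conditions count as true iff they are nonzero; \<open>Flip\<close> stores a fresh fair coin.
  The commands reachable from a fixed program are finitely many, so they act as a finite control.\<close>

primrec step :: "com \<Rightarrow> memory \<Rightarrow> (com \<times> memory \<times> nat) pmf" where
  "step Skip m = return_pmf (Skip, m, 0)"
| "step (Assign a e) m =
    return_pmf (Skip, m(val a m := val e m), cost a m + cost e m)"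
| "step (Flip a) m =
    map_pmf (\<lambda>b. (Skip, m(val a m := of_bool b), cost a m + 1)) (bernoulli_pmf (1 / 2))"
| "step (Seq c d) m =
    (if c = Skip then return_pmf (d, m, 1)
     else map_pmf (\<lambda>(c', m', t). (Seq c' d, m', t)) (step c m))"
| "step (Cond e c d) m = return_pmf (if val e m \<noteq> 0 then c else d, m, cost e m)"
| "step (Loop e c) m = return_pmf (Cond e (Seq c (Loop e c)) Skip, m, 1)"

text \<open>Cells containing 0 are unused; a used cell occupies the bits of its address and its content.
  The set of used cells is finite in every configuration reachable from an initial one.\<close>

definition memory_bits :: "memory \<Rightarrow> nat" where
  "memory_bits m = (\<Sum>a | m a \<noteq> 0. bits a + bits (m a))"

record config =
  control :: com
  memory :: memory
  elapsed :: nat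
  peak :: nat

text \<open>\<open>elapsed\<close> and \<open>peak\<close> record the time and space consumption and are invisible to the program.
  The cost of a step bounds the bit length of all intermediate results of that step, and is added
  to the memory to account for them.\<close>

definition advance :: "config \<Rightarrow> config pmf" where
  "advance c = map_pmf
    (\<lambda>(p, m, t). \<lparr>control = p, memory = m, elapsed = elapsed c + t,
                   peak = max (peak c) (memory_bits m + t)\<rparr>)
    (step (control c) (memory c))"

primrec run :: "nat \<Rightarrow> config \<Rightarrow> config pmf" where
  "run 0 c = return_pmf c"
| "run (Suc n) c = bind_pmf (advance c) (run n)"

definition initial :: "com \<Rightarrow> nat list \<Rightarrow> config" where
  "initial P xs =
    (let m = (\<lambda>i. if i < length xs then xs ! i else 0)
     in \<lparr>control = P, memory = m, elapsed = 0, peak = memory_bits m\<rparr>)"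

definition halted :: "config \<Rightarrow> bool" where
  "halted c \<longleftrightarrow> control c = Skip"

definition answers_yes :: "config \<Rightarrow> bool" where
  "answers_yes c \<longleftrightarrow> halted c \<and> memory c 0 = 1"

definition input_size :: "nat list \<Rightarrow> nat" where
  "input_size xs = (\<Sum>x\<leftarrow>xs. 1 + bits x)"


section \<open>Encoding of instances\<close>

definition adjacency_matrix :: "nat \<Rightarrow> nat pair_pre_digraph \<Rightarrow> nat list" where
  "adjacency_matrix n G = [of_bool ((u, v) \<in> parcs G). u \<leftarrow> [0..<n], v \<leftarrow> [0..<n]]"

text \<open>The graph \<open>G\<close> and the forest \<open>T\<close> have vertices \<open>0, \<dots>, n - 1\<close>. The integer \<open>k\<close> is given by
  sign and absolute value.\<close>

definition encode :: "nat \<Rightarrow> nat pair_pre_digraph \<Rightarrow> int \<Rightarrow> nat pair_pre_digraph \<Rightarrow> nat list" where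
  "encode n G k T =
    [n, of_bool (k < 0), nat \<bar>k\<bar>] @ adjacency_matrix n G @ adjacency_matrix n T"

end

theory Submission
  imports Defs
begin

text \<open>Colour every vertex 0, 1, 2 or 3 such that adjacent vertices with different colours include one
  of colour 0, and let the solution \<open>X\<close> consist of the vertices coloured 1 or 2. Every component of \<open>G[X]\<close> is
  monochromatic, and a vertex outside \<open>X\<close> may have colour 3 iff it has no neighbour in \<open>X\<close>. So \<open>X\<close>
  arises from \<open>2 ^ (c + u)\<close> colourings, where \<open>c\<close> counts the components of \<open>G[X]\<close> and \<open>u\<close> the
  vertices that \<open>X\<close> does not dominate; for \<open>X \<noteq> {}\<close> this is 2 if \<open>X\<close> is a connected dominating set and a
  multiple of 4 otherwise. Counting modulo 4 hence replaces both the fixed vertex of Cut and Count and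
  inclusion-exclusion for domination. Random weights isolate a solution with
  probability at least 1/2. The generating function of the colourings by size and weight of \<open>X\<close> is
  evaluated as one big integer, whose digits in a base exceeding the number of colourings are the
  coefficients. A counter \<open>t < 4 ^ depth\<close> enumerates the colourings of all root-to-leaf paths at once: the
  base 4 digit of \<open>t\<close> that belongs to a level is the colour of every vertex on that level, and each vertex
  accumulates the contribution of its subtree over the values of its own digit.\<close>

section \<open>Execution in bounded memory\<close>

text \<open>The machine has no recursion and no stack, while the sum over colourings is by nature a
  branching along root-to-leaf paths; this is why it becomes a single loop with one accumulator per
  vertex. Vertices of one level may share a digit because disjoint subtrees contribute independent
  factors once the colours of their ancestors are fixed. A table indexed by the colours of the
  ancestors would cost exponential space. All summands are natural numbers, so a count is reduced
  modulo 4 only at the end. There are at most 4^n colourings, hence digits of 2n+1 bits. A solution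
  X contributes to the digit at position |X| M + w(X); as M exceeds the total weight, this position
  determines size and weight. Weights have b bits with 2n <= 2^b < 4n: the lower bound yields
  isolation with probability 1/2, a power of two is what fair coins produce exactly, and the upper
  bound keeps all exponents polynomial. Since the machine charges for bit lengths, every
  intermediate value must also be shown to fit into K bits.\<close>

text \<open>\<open>\<mu>\<close> is the distribution of the memory after halting, \<open>N\<close> bounds the number of steps of every
  execution, and \<open>B\<close> holds throughout. Counting steps suffices because a memory with short cells bounds
  the cost of all steps of a fixed program.\<close>

inductive exec :: "(memory \<Rightarrow> bool) \<Rightarrow> nat \<Rightarrow> com \<Rightarrow> memory \<Rightarrow> memory pmf \<Rightarrow> bool" for B where
  exec_Skip: "B m \<Longrightarrow> exec B N Skip m (return_pmf m)"
| exec_step: "c \<noteq> Skip \<Longrightarrow> B m \<Longrightarrow>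
    (\<And>c' m' t. (c', m', t) \<in> set_pmf (step c m) \<Longrightarrow> exec B N c' m' (F c' m')) \<Longrightarrow>
    \<mu> = bind_pmf (step c m) (\<lambda>(c', m', t). F c' m') \<Longrightarrow> exec B (Suc N) c m \<mu>"

lemma exec_invariant: "exec B N c m \<mu> \<Longrightarrow> B m \<and> (\<forall>m'\<in>set_pmf \<mu>. B m')"
  by (induction rule: exec.induct) (fastforce simp: split_beta)+

lemma exec_mono: "exec B N c m \<mu> \<Longrightarrow> N \<le> N' \<Longrightarrow> exec B N' c m \<mu>"
proof (induction arbitrary: N' rule: exec.induct)
  case (exec_Skip m N)
  then show ?case by (intro exec.exec_Skip)
next
  case (exec_step c m N F \<mu>)
  then obtain N'' where "N' = Suc N''" "N \<le> N''" by (cases N') auto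
  then show ?case using exec_step by (auto intro!: exec.exec_step[where F = F])
qed

lemma exec_return_step:
  assumes "step c m = return_pmf (c', m', t)" "c \<noteq> Skip" "B m" "exec B N c' m' \<mu>"
  shows "exec B (Suc N) c m \<mu>"
  using assms by (intro exec_step[where F = "\<lambda>_ _. \<mu>"]) (auto simp: bind_return_pmf)

text \<open>The additional step discards the finished first command. The continuation
  \<open>G\<close> depends on the memory only, as that is all that \<open>d\<close> gets to
  see.\<close>

lemma exec_Seq:
  "exec B N c m \<mu> \<Longrightarrow> (\<And>m'. m' \<in> set_pmf \<mu> \<Longrightarrow> exec B N' d m' (G m')) \<Longrightarrow>
    exec B (N + N' + 1) (Seq c d) m (bind_pmf \<mu> G)"
proof (induction rule: exec.induct)
  case (exec_Skip m N)
  then show ?case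
    by (auto simp: bind_return_pmf
      intro!: exec_return_step[where c' = d and m' = m and t = 1] exec_mono[where N = N' and N' = "N + N'"])
next
  case (exec_step c m N F \<mu>)
  \<comment> \<open>Until the first command is discarded, every command reached has the form
    \<open>Seq c'' d\<close>, so \<open>c''\<close> can be read off; the \<open>undefined\<close>
    branch is never taken.\<close>
  let ?F = "\<lambda>c' m'. case c' of Seq c'' _ \<Rightarrow> bind_pmf (F c'' m') G | _ \<Rightarrow> undefined"
  have "exec B (Suc (N + N' + 1)) (Seq c d) m (bind_pmf \<mu> G)"
  proof (rule exec.exec_step[where F = ?F])
    fix c' m' t
    assume "(c', m', t) \<in> set_pmf (step (Seq c d) m)"
    then obtain c'' where c'': "c' = Seq c'' d" "(c'', m', t) \<in> set_pmf (step c m)"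
      using exec_step.hyps(1) by auto
    have "set_pmf (F c'' m') \<subseteq> set_pmf \<mu>"
      using c''(2) unfolding exec_step.hyps(4) by force
    then have "exec B (N + N' + 1) (Seq c'' d) m' (bind_pmf (F c'' m') G)"
      using c''(2) exec_step.prems by (intro exec_step.IH) auto
    then show "exec B (N + N' + 1) c' m' (?F c' m')"
      by (simp add: c'')
  next
    show "bind_pmf \<mu> G = bind_pmf (step (Seq c d) m) (\<lambda>(c', m', t). ?F c' m')"
      using exec_step.hyps(1) unfolding exec_step.hyps(4)
      by (auto simp: bind_assoc_pmf bind_map_pmf split_beta intro!: bind_pmf_cong)
  qed (use exec_step in auto)
  then show ?case by simp
qed

lemma exec_Assign:
  "B m \<Longrightarrow> B (m(val a m := val e m)) \<Longrightarrow> exec B 1 (Assign a e) m (return_pmf (m(val a m := val e m)))"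
  unfolding One_nat_def by (rule exec_return_step) (auto intro: exec_Skip)

lemma exec_Flip:
  assumes "B m" "\<And>b. B (m(val a m := of_bool b))"
  shows "exec B 1 (Flip a) m (map_pmf (\<lambda>b. m(val a m := of_bool b)) (bernoulli_pmf (1 / 2)))"
  unfolding One_nat_def using assms
  by (intro exec_step[where F = "\<lambda>_ m. return_pmf m"])
    (auto simp: map_pmf_def bind_assoc_pmf bind_return_pmf intro: exec_Skip)

lemma exec_Cond:
  "B m \<Longrightarrow> exec B N (if val e m \<noteq> 0 then c else d) m \<mu> \<Longrightarrow> exec B (Suc N) (Cond e c d) m \<mu>"
  by (rule exec_return_step) auto

text \<open>The two additional steps are the unfolding into a conditional and its test.\<close>

lemma exec_Loop:
  assumes "B m" "exec B N (if val e m \<noteq> 0 then Seq c (Loop e c) else Skip) m \<mu>"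
  shows "exec B (N + 2) (Loop e c) m \<mu>"
proof -
  have "exec B (Suc (Suc N)) (Loop e c) m \<mu>"
    by (rule exec_return_step[OF _ _ assms(1) exec_Cond[OF assms]]) auto
  then show ?thesis by simp
qed

section \<open>From step counts to time and space\<close>

primrec exprs :: "com \<Rightarrow> expr set" where
  "exprs Skip = {}"
| "exprs (Assign a e) = {a, e}"
| "exprs (Flip a) = {a}"
| "exprs (Seq c d) = exprs c \<union> exprs d"
| "exprs (Cond e c d) = {e} \<union> exprs c \<union> exprs d"
| "exprs (Loop e c) = {e} \<union> exprs c"

lemma finite_exprs: "finite (exprs c)"
  by (induction c) auto

text \<open>Steps only recombine parts of the program. Hence all expressions ever evaluated belong
  to one finite set that is known in advance, and a cost bound on its members bounds every
  step.\<close>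

lemma exprs_step: "(c', m', t) \<in> set_pmf (step c m) \<Longrightarrow> exprs c' \<subseteq> exprs c"
proof (induction c arbitrary: c' m' t)
  case (Seq c d)
  then show ?case by (auto split: if_splits; blast)
qed (auto split: if_splits)

text \<open>The factor 2 stems from assignments, which evaluate an address and a value; the summand
  1 covers the coin of \<open>Flip\<close> and the steps of pure control.\<close>

lemma step_cost_le:
  assumes "(c', m', t) \<in> set_pmf (step c m)" "\<And>e. e \<in> exprs c \<Longrightarrow> cost e m \<le> C"
  shows "t \<le> 2 * C + 1"
  using assms
proof (induction c arbitrary: c' m' t)
  case (Assign a e)
  then have "cost a m \<le> C" "cost e m \<le> C" "t = cost a m + cost e m" by simp_all
  then show ?case by linarith
next
  case (Flip a)
  then have "cost a m \<le> C" "t = cost a m + 1" by auto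
  then show ?case by linarith
next
  case (Cond e c d)
  then have "cost e m \<le> C" "t = cost e m" by simp_all
  then show ?case by linarith
next
  case (Seq c d)
  then show ?case by (fastforce split: if_splits)
qed auto

text \<open>A halted machine pays nothing for further steps, but \<open>advance\<close> still
  compares the peak with its current memory. So one number of steps can be fixed for all random
  outcomes.\<close>

lemma run_halted:
  "control x = Skip \<Longrightarrow> control y = Skip \<and> memory y = memory x \<and> elapsed y = elapsed x \<and>
    peak y \<le> max (peak x) (memory_bits (memory x))" if "y \<in> set_pmf (run N x)"
  using that
proof (induction N arbitrary: x)
  case (Suc N)
  define x' where "x' = \<lparr>control = Skip, memory = memory x, elapsed = elapsed x,
     peak = max (peak x) (memory_bits (memory x))\<rparr>"
  have "advance x = return_pmf x'"
    using Suc.prems unfolding advance_def x'_def by simp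
  with Suc.prems have "y \<in> set_pmf (run N x')" by (auto simp: bind_return_pmf)
  with Suc.IH[of x'] show ?case by (auto simp: x'_def)
qed simp

lemma map_pmf_eq_return: "(\<And>x. x \<in> set_pmf p \<Longrightarrow> f x = y) \<Longrightarrow> map_pmf f p = return_pmf y"
  by (metis map_pmf_cong map_pmf_const)

text \<open>The bound \<open>2 * C + 1\<close> on the cost of a step occurs twice: as a factor of
  the time, and as a summand of the space because the peak charges a step for its intermediate
  results.\<close>

lemma exec_run:
  assumes "exec B N c m \<mu>" "exprs c \<subseteq> E"
    and C: "\<And>e m. e \<in> E \<Longrightarrow> B m \<Longrightarrow> cost e m \<le> C"
    and S: "\<And>m. B m \<Longrightarrow> memory_bits m \<le> S"
    and "x = \<lparr>control = c, memory = m, elapsed = e, peak = p\<rparr>"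
  shows "map_pmf memory (run N x) = \<mu> \<and>
    (\<forall>y\<in>set_pmf (run N x). halted y \<and> elapsed y \<le> e + N * (2 * C + 1) \<and>
      peak y \<le> max p (S + (2 * C + 1)))"
  using assms(1,2,5)
proof (induction arbitrary: e p x rule: exec.induct)
  case (exec_Skip m N)
  have "y \<in> set_pmf (run N x) \<Longrightarrow> control y = Skip \<and> memory y = m \<and> elapsed y = e \<and>
     peak y \<le> max p (memory_bits m)" for y
    using run_halted[of y N x] exec_Skip by auto
  moreover from this have "map_pmf memory (run N x) = return_pmf m"
    by (intro map_pmf_eq_return) auto
  ultimately show ?case using S[OF exec_Skip(1)]
    by (fastforce simp: halted_def)
next
  case (exec_step c m N F \<mu>)
  define nx where "nx = (\<lambda>(c', m', t). \<lparr>control = c', memory = m', elapsed = e + t,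
     peak = max p (memory_bits m' + t)\<rparr>)"
  have adv: "advance x = map_pmf nx (step c m)"
    unfolding advance_def nx_def exec_step.prems(2) by simp
  have *: "map_pmf memory (run N (nx (c', m', t))) = F c' m' \<and>
      (\<forall>y\<in>set_pmf (run N (nx (c', m', t))). halted y \<and>
        elapsed y \<le> e + Suc N * (2 * C + 1) \<and> peak y \<le> max p (S + (2 * C + 1)))"
    if st: "(c', m', t) \<in> set_pmf (step c m)" for c' m' t
  proof -
    have ex: "exec B N c' m' (F c' m')" using exec_step.hyps(3) st .
    have t: "t \<le> 2 * C + 1"
      using step_cost_le[OF st] C exec_step.hyps(2) exec_step.prems(1) by blast
    have "exprs c' \<subseteq> E" using exprs_step[OF st] exec_step.prems(1) by auto
    from exec_step.IH[OF st this, of "nx (c', m', t)" "e + t" "max p (memory_bits m' + t)"]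
    have 1: "map_pmf memory (run N (nx (c', m', t))) = F c' m'"
      and 2: "\<forall>y\<in>set_pmf (run N (nx (c', m', t))). halted y \<and> elapsed y \<le> e + t + N * (2 * C + 1) \<and>
         peak y \<le> max (max p (memory_bits m' + t)) (S + (2 * C + 1))"
      by (auto simp: nx_def)
    have "B m'" using exec_invariant[OF ex] by simp
    then have "memory_bits m' + t \<le> S + (2 * C + 1)" using S t by (meson add_mono)
    moreover have "e + t + N * (2 * C + 1) \<le> e + Suc N * (2 * C + 1)" using t by simp
    ultimately show ?thesis using 1 2 by (meson max.absorb_iff2 max.boundedI max.cobounded1 max.cobounded2 order_trans)
  qed
  have "map_pmf memory (run (Suc N) x) = \<mu>"
    unfolding exec_step.hyps(4) run.simps adv bind_map_pmf map_bind_pmf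
    using * by (intro bind_pmf_cong) auto
  moreover have "\<forall>y\<in>set_pmf (run (Suc N) x). halted y \<and>
        elapsed y \<le> e + Suc N * (2 * C + 1) \<and> peak y \<le> max p (S + (2 * C + 1))"
    unfolding run.simps adv bind_map_pmf using * by fastforce
  ultimately show ?case by blast
qed

text \<open>Bit lengths in units of the cell length \<open>K\<close>: a value has at most
  \<open>K * val_weight e\<close> bits. A cell access has weight 1 whatever its address is, which
  makes the bound independent of the memory.\<close>

primrec val_weight :: "expr \<Rightarrow> nat" where
  "val_weight (Const n) = 1 + bits n"
| "val_weight (Cell a) = 1"
| "val_weight (Add a b) = val_weight a + val_weight b"
| "val_weight (Sub a b) = val_weight a + val_weight b"
| "val_weight (Mul a b) = val_weight a + val_weight b"
| "val_weight (Quot a b) = val_weight a + val_weight b"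
| "val_weight (Rem a b) = val_weight a + val_weight b"

primrec cost_weight :: "expr \<Rightarrow> nat" where
  "cost_weight (Const n) = 2 + bits n"
| "cost_weight (Cell a) = cost_weight a + 2"
| "cost_weight (Add a b) = cost_weight a + cost_weight b + 1 + val_weight (Add a b)"
| "cost_weight (Sub a b) = cost_weight a + cost_weight b + 1 + val_weight (Sub a b)"
| "cost_weight (Mul a b) = cost_weight a + cost_weight b + 1 + val_weight (Mul a b)"
| "cost_weight (Quot a b) = cost_weight a + cost_weight b + 1 + val_weight (Quot a b)"
| "cost_weight (Rem a b) = cost_weight a + cost_weight b + 1 + val_weight (Rem a b)"

lemma less_two_power_bits: "n < 2 ^ bits n"
  using floorlog_bounds[of n 2] by (cases "n = 0") auto

lemma bits_le: "n < 2 ^ k \<Longrightarrow> bits n \<le> k"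
  by (simp add: floorlog_leI)

lemma val_weight_pos: "val_weight e > 0"
  by (induction e) auto

lemma add_less_power_add:
  assumes "x < 2 ^ i" "y < 2 ^ j" "i > 0" "j > 0"
  shows "(x :: nat) + y < 2 ^ (i + j)"
proof -
  obtain i' j' where "i = Suc i'" "j = Suc j'" using assms by (meson gr0_implies_Suc)
  moreover have "1 \<le> (2::nat) ^ i'" "1 \<le> (2::nat) ^ j'" by simp_all
  then have "(2::nat) * 2 ^ i' + 2 * 2 ^ j' \<le> 4 * (2 ^ i' * 2 ^ j')"
    by (smt (verit, best) mult_le_mono1 mult_le_mono2 nat_mult_1 nat_mult_1_right add_le_mono mult.assoc mult.commute numeral_Bit0 distrib_right distrib_left)
  ultimately show ?thesis using assms by (simp add: power_add)
qed

lemma val_less: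
  assumes m: "\<And>a. m a < 2 ^ K" and K: "K > 0"
  shows "val e m < 2 ^ (K * val_weight e)"
proof (induction e)
  case (Const n)
  have "n < 2 ^ bits n" by (rule less_two_power_bits)
  also have "\<dots> \<le> 2 ^ (K * (1 + bits n))" using K by (intro power_increasing) (auto simp: trans_le_add2)
  finally show ?case by simp
next
  case (Cell a) then show ?case using m by simp
next
  case (Add a b)
  then show ?case using add_less_power_add[OF Add] K val_weight_pos by (simp add: distrib_left)
next
  case (Sub a b)
  have "val (Sub a b) m \<le> val a m" by simp
  also have "\<dots> < 2 ^ (K * val_weight a)" using Sub by simp
  also have "\<dots> \<le> 2 ^ (K * val_weight (Sub a b))" by (intro power_increasing) auto
  finally show ?case .
next
  case (Mul a b)
  then show ?case by (simp add: distrib_left power_add mult_strict_mono)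
next
  case (Quot a b)
  have "val (Quot a b) m \<le> val a m" by simp
  also have "\<dots> < 2 ^ (K * val_weight a)" using Quot by simp
  also have "\<dots> \<le> 2 ^ (K * val_weight (Quot a b))" by (intro power_increasing) auto
  finally show ?case .
next
  case (Rem a b)
  have "val (Rem a b) m \<le> val a m" by simp
  also have "\<dots> < 2 ^ (K * val_weight a)" using Rem by simp
  also have "\<dots> \<le> 2 ^ (K * val_weight (Rem a b))" by (intro power_increasing) auto
  finally show ?case .
qed

lemma cost_le:
  assumes m: "\<And>a. m a < 2 ^ K" and K: "K > 0"
  shows "cost e m \<le> K * cost_weight e"
proof -
  have v: "bits (val e m) \<le> K * val_weight e" for e
    by (intro bits_le val_less[OF m K])
  have *: "c + d + 1 + x \<le> K * (c' + d' + 1 + y)" if "c \<le> K * c'" "d \<le> K * d'" "x \<le> K * y"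
    for c d x c' d' y
    using that K by (simp add: distrib_left)
  show ?thesis
  proof (induction e)
    case (Const n)
    have "1 * (2 + bits n) \<le> K * (2 + bits n)" using K by (intro mult_le_mono1) simp
    then show ?case by simp
  next
    case (Cell a)
    then show ?case using v[of "Cell a"] K by (simp add: distrib_left)
  next
    case (Add a b)
    show ?case unfolding cost.simps cost_weight.simps by (rule *[OF Add v])
  next
    case (Sub a b)
    show ?case unfolding cost.simps cost_weight.simps by (rule *[OF Sub v])
  next
    case (Mul a b)
    show ?case unfolding cost.simps cost_weight.simps by (rule *[OF Mul v])
  next
    case (Quot a b)
    show ?case unfolding cost.simps cost_weight.simps by (rule *[OF Quot v])
  next
    case (Rem a b)
    show ?case unfolding cost.simps cost_weight.simps by (rule *[OF Rem v])
  qed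
qed

definition bounded_memory :: "nat \<Rightarrow> nat \<Rightarrow> memory \<Rightarrow> bool" where
  "bounded_memory A K m \<longleftrightarrow> (\<forall>a. m a < 2 ^ K) \<and> (\<forall>a\<ge>A. m a = 0)"

text \<open>Charging \<open>A\<close> bits for each address below \<open>A\<close> is generous, but
  the space only has to be polynomial.\<close>

lemma memory_bits_le:
  assumes "bounded_memory A K m"
  shows "memory_bits m \<le> A * (A + K)"
proof -
  have sub: "{a. m a \<noteq> 0} \<subseteq> {..<A}" using assms unfolding bounded_memory_def by (metis (mono_tags) lessThan_iff mem_Collect_eq not_le subsetI)
  have "memory_bits m \<le> (\<Sum>a | m a \<noteq> 0. A + K)"
    unfolding memory_bits_def
  proof (intro sum_mono add_mono)
    fix a assume a: "a \<in> {a. m a \<noteq> 0}"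
    have "a < 2 ^ A" using a sub less_exp[of a] by (meson lessThan_iff less_exp less_trans subsetD)
    then show "bits a \<le> A" by (rule bits_le)
    show "bits (m a) \<le> K" using assms by (intro bits_le) (auto simp: bounded_memory_def)
  qed
  also have "\<dots> = card {a. m a \<noteq> 0} * (A + K)" by simp
  also have "\<dots> \<le> A * (A + K)" using card_mono[OF _ sub] by (intro mult_le_mono1) auto
  finally show ?thesis .
qed

section \<open>Programs on a machine loaded with a graph and a forest\<close>

abbreviation "cN \<equiv> Cell (Const 0)"

text \<open>The first cell behind the input. It is computed anew from cell 0 at each use, so cell 0
  has to keep the number of vertices until the answer replaces it.\<close>

definition scratch :: expr where
  "scratch = Add (Const 3) (Mul (Const 2) (Mul cN cN))"

definition vaddr :: "nat \<Rightarrow> expr" where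
  "vaddr j = Add scratch (Const j)"

text \<open>Behind 30 scalar cells the arrays of levels and accumulators alternate. Thus both are
  total functions in the model, and no index bound is needed to keep them apart.\<close>

definition laddr :: "expr \<Rightarrow> expr" where
  "laddr e = Add (Add scratch (Const 30)) (Mul (Const 2) e)"

definition faddr :: "expr \<Rightarrow> expr" where
  "faddr e = Add (Add scratch (Const 31)) (Mul (Const 2) e)"

definition cV :: "nat \<Rightarrow> expr" where
  "cV j = Cell (vaddr j)"

definition cL :: "expr \<Rightarrow> expr" where
  "cL e = Cell (laddr e)"

definition cF :: "expr \<Rightarrow> expr" where
  "cF e = Cell (faddr e)"

definition cG :: "expr \<Rightarrow> expr \<Rightarrow> expr" where
  "cG u v = Cell (Add (Const 3) (Add (Mul u cN) v))"

definition cT :: "expr \<Rightarrow> expr \<Rightarrow> expr" where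
  "cT u v = Cell (Add (Const 3) (Add (Mul cN cN) (Add (Mul u cN) v)))"

text \<open>Truncated subtraction turns the loop condition into the test that counter
  \<open>i\<close> is below \<open>e\<close>. The bound is evaluated in every round, so the body
  must preserve its value.\<close>

definition For :: "nat \<Rightarrow> expr \<Rightarrow> com \<Rightarrow> com" where
  "For i e c = Seq (Loop (Sub e (cV i)) (Seq c (Assign (vaddr i) (Add (cV i) (Const 1)))))
    (Assign (vaddr i) (Const 0))"

definition Two_pow :: "nat \<Rightarrow> expr \<Rightarrow> com" where
  "Two_pow d e = Seq (Assign (vaddr d) (Const 1))
    (For 20 e (Assign (vaddr d) (Mul (Const 2) (cV d))))"

text \<open>Scalar variables, levels and accumulators, in this order.\<close>

type_synonym state = "(nat \<Rightarrow> nat) \<times> (nat \<Rightarrow> nat) \<times> (nat \<Rightarrow> nat)"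

lemma even_offset: "a = b + 2 * v \<longleftrightarrow> a \<ge> b \<and> even (a - b) \<and> (a - b) div 2 = v" for a b v :: nat
  by presburger

lemma odd_offset: "a = Suc b + 2 * v \<longleftrightarrow> a \<ge> b \<and> odd (a - b) \<and> (a - b) div 2 = v" for a b v :: nat
  by presburger

section \<open>Symbolic states and the memories that they denote\<close>

locale machine =
  fixes n K k :: nat and sg :: bool and GG TT :: "(nat \<times> nat) set" and inp :: "nat \<Rightarrow> nat"
  assumes n_pos: "n > 0"
    and inp_0: "inp 0 = n" and inp_1: "inp 1 = of_bool sg" and inp_2: "inp 2 = k"
    and inp_G: "\<And>u v. u < n \<Longrightarrow> v < n \<Longrightarrow> inp (3 + (u * n + v)) = of_bool ((u, v) \<in> GG)"
    and inp_T: "\<And>u v. u < n \<Longrightarrow> v < n \<Longrightarrow> inp (3 + (n * n + (u * n + v))) = of_bool ((u, v) \<in> TT)"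
    and K_pos: "K > 0"
begin

definition sbase :: nat where
  "sbase = 3 + 2 * (n * n)"

definition mem :: "state \<Rightarrow> memory" where
  "mem = (\<lambda>(s, l, f) a. if a < sbase then inp a
     else if a < sbase + 30 then s (a - sbase)
     else if even (a - (sbase + 30)) then l ((a - (sbase + 30)) div 2)
     else f ((a - (sbase + 30)) div 2))"

lemma mem_inp: "a < sbase \<Longrightarrow> mem S a = inp a"
  by (simp add: mem_def split: prod.splits)

lemma val_cN [simp]: "val cN (mem S) = n"
  by (simp add: mem_def sbase_def inp_0 split: prod.splits)

lemma val_sg [simp]: "val (Cell (Const 1)) (mem S) = of_bool sg"
  by (simp add: mem_def sbase_def inp_1 del: One_nat_def split: prod.splits)

lemma val_k [simp]: "val (Cell (Const 2)) (mem S) = k"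
  by (simp add: mem_def sbase_def inp_2 split: prod.splits)

lemma mem_0: "mem S 0 = n"
  by (simp add: mem_def sbase_def inp_0 split: prod.splits)

lemma val_scratch: "m 0 = n \<Longrightarrow> val scratch m = sbase"
  by (simp add: scratch_def sbase_def)

lemma val_vaddr [simp]: "val (vaddr j) (mem S) = sbase + j"
  by (simp add: vaddr_def val_scratch mem_0)

lemma val_laddr [simp]: "val (laddr e) (mem S) = sbase + 30 + 2 * val e (mem S)"
  by (simp add: laddr_def val_scratch mem_0)

lemma val_faddr [simp]: "val (faddr e) (mem S) = sbase + 31 + 2 * val e (mem S)"
  by (simp add: faddr_def val_scratch mem_0)

lemma val_cV [simp]: "j < 30 \<Longrightarrow> val (cV j) (mem (s, l, f)) = s j"
  unfolding cV_def val.simps val_vaddr by (simp add: mem_def)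

lemma val_cL [simp]: "val (cL e) (mem (s, l, f)) = l (val e (mem (s, l, f)))"
  unfolding cL_def val.simps val_laddr by (simp add: mem_def)

lemma val_cF [simp]: "val (cF e) (mem (s, l, f)) = f (val e (mem (s, l, f)))"
proof -
  have "sbase + 31 + 2 * x = sbase + 30 + Suc (2 * x)" for x by simp
  then show ?thesis
    unfolding cF_def val.simps val_faddr by (simp add: mem_def)
qed

lemma index_less: "u < n \<Longrightarrow> v < n \<Longrightarrow> u * n + v < n * n" for u v
proof -
  assume "u < n" "v < n"
  then have "u * n + v < Suc u * n" by simp
  also have "\<dots> \<le> n * n" using \<open>u < n\<close> by (intro mult_le_mono1) simp
  finally show ?thesis .
qed

lemma val_cG [simp]:
  assumes "val u (mem S) < n" "val v (mem S) < n"
  shows "val (cG u v) (mem S) = of_bool ((val u (mem S), val v (mem S)) \<in> GG)"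
proof -
  have "3 + (val u (mem S) * n + val v (mem S)) < sbase"
    using index_less[OF assms] by (simp add: sbase_def)
  from mem_inp[OF this] show ?thesis by (simp add: cG_def mem_0 inp_G[OF assms])
qed

lemma val_cT [simp]:
  assumes "val u (mem S) < n" "val v (mem S) < n"
  shows "val (cT u v) (mem S) = of_bool ((val u (mem S), val v (mem S)) \<in> TT)"
proof -
  have "3 + (n * n + (val u (mem S) * n + val v (mem S))) < sbase"
    using index_less[OF assms] by (simp add: sbase_def)
  from mem_inp[OF this] show ?thesis by (simp add: cT_def mem_0 inp_T[OF assms])
qed

lemma mem_upd_s [simp]: "j < 30 \<Longrightarrow> (mem (s, l, f))(sbase + j := x) = mem (s(j := x), l, f)"
  by (auto simp: mem_def fun_eq_iff)

lemma mem_upd_l: "(mem (s, l, f))(sbase + 30 + 2 * v := x) = mem (s, l(v := x), f)"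
proof -
  have *: "a = sbase + 30 + 2 * v \<longleftrightarrow> a \<ge> sbase + 30 \<and> even (a - (sbase + 30)) \<and> (a - (sbase + 30)) div 2 = v" for a
    by (rule even_offset)
  show ?thesis unfolding fun_upd_def * by (auto simp: mem_def fun_eq_iff)
qed

lemma mem_upd_f: "(mem (s, l, f))(sbase + 31 + 2 * v := x) = mem (s, l, f(v := x))"
proof -
  have *: "a = sbase + 31 + 2 * v \<longleftrightarrow> a \<ge> sbase + 30 \<and> odd (a - (sbase + 30)) \<and> (a - (sbase + 30)) div 2 = v" for a
  proof -
    have "sbase + 31 + 2 * v = Suc (sbase + 30) + 2 * v" by simp
    then show ?thesis using odd_offset[of a "sbase + 30" v] by (simp only:)
  qed
  show ?thesis unfolding fun_upd_def * by (auto simp: mem_def fun_eq_iff)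
qed

section \<open>Step counts of deterministic commands\<close>

definition mlen :: nat where
  "mlen = sbase + 30 + 2 * n"

abbreviation ok :: "memory \<Rightarrow> bool" where
  "ok \<equiv> bounded_memory mlen K"

lemma ok_upd: "ok m \<Longrightarrow> a < mlen \<Longrightarrow> x < 2 ^ K \<Longrightarrow> ok (m(a := x))"
  by (auto simp: bounded_memory_def)

text \<open>The implication lets boundedness pass silently through a chain of commands: a bound is
  proved only for the value that an assignment writes.\<close>

definition det :: "nat \<Rightarrow> com \<Rightarrow> state \<Rightarrow> state \<Rightarrow> bool" where
  "det N c S S' \<longleftrightarrow> (ok (mem S) \<longrightarrow> exec ok N c (mem S) (return_pmf (mem S')))"

lemma det_mono: "det N c S S' \<Longrightarrow> N \<le> N' \<Longrightarrow> det N' c S S'"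
  unfolding det_def using exec_mono by blast

lemma det_Skip: "S = S' \<Longrightarrow> det 0 Skip S S'"
  unfolding det_def using exec_Skip by auto

lemma det_Seq:
  assumes "det N1 c S S'" "det N2 d S' S''"
  shows "det (N1 + N2 + 1) (Seq c d) S S''"
  unfolding det_def
proof
  assume "ok (mem S)"
  then have 1: "exec ok N1 c (mem S) (return_pmf (mem S'))" using assms(1) by (simp add: det_def)
  then have "ok (mem S')" using exec_invariant by fastforce
  then have "exec ok N2 d (mem S') (return_pmf (mem S''))" using assms(2) by (simp add: det_def)
  from exec_Seq[OF 1, of N2 d "\<lambda>_. return_pmf (mem S'')"] this
  show "exec ok (N1 + N2 + 1) (Seq c d) (mem S) (return_pmf (mem S''))"
    by (simp add: bind_return_pmf)
qed

lemma det_Cond: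
  assumes "val e (mem S) \<noteq> 0 \<Longrightarrow> det N1 c S S'" "val e (mem S) = 0 \<Longrightarrow> det N2 d S S'"
  shows "det (Suc (max N1 N2)) (Cond e c d) S S'"
  unfolding det_def
proof
  assume *: "ok (mem S)"
  then have "exec ok (max N1 N2) (if val e (mem S) \<noteq> 0 then c else d) (mem S) (return_pmf (mem S'))"
    using assms exec_mono[of ok _ c _ _ "max N1 N2"] exec_mono[of ok _ d _ _ "max N1 N2"]
    unfolding det_def by (cases "val e (mem S) = 0") auto
  with * show "exec ok (Suc (max N1 N2)) (Cond e c d) (mem S) (return_pmf (mem S'))"
    by (rule exec_Cond)
qed

lemma det_s:
  assumes "j < 30" "val e (mem (s, l, f)) = x" "x < 2 ^ K" "s' = s(j := x)"
  shows "det (Suc 0) (Assign (vaddr j) e) (s, l, f) (s', l, f)"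
  unfolding det_def
proof
  assume *: "ok (mem (s, l, f))"
  have "sbase + j < mlen" using assms(1) by (simp add: mlen_def)
  from ok_upd[OF * this assms(3)] exec_Assign[of ok, OF *, of "vaddr j" e]
  show "exec ok (Suc 0) (Assign (vaddr j) e) (mem (s, l, f)) (return_pmf (mem (s', l, f)))"
    using assms by (simp del: fun_upd_apply)
qed

lemma det_l:
  assumes "val ie (mem (s, l, f)) = v" "v < n" "val e (mem (s, l, f)) = x" "x < 2 ^ K" "l' = l(v := x)"
  shows "det (Suc 0) (Assign (laddr ie) e) (s, l, f) (s, l', f)"
  unfolding det_def
proof
  assume *: "ok (mem (s, l, f))"
  have "sbase + 30 + 2 * v < mlen" using assms(2) by (simp add: mlen_def)
  from ok_upd[OF * this assms(4)] exec_Assign[of ok, OF *, of "laddr ie" e]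
  show "exec ok (Suc 0) (Assign (laddr ie) e) (mem (s, l, f)) (return_pmf (mem (s, l', f)))"
    using assms by (simp only: val_laddr mem_upd_l One_nat_def)
qed

lemma det_f:
  assumes "val ie (mem (s, l, f)) = v" "v < n" "val e (mem (s, l, f)) = x" "x < 2 ^ K" "f' = f(v := x)"
  shows "det (Suc 0) (Assign (faddr ie) e) (s, l, f) (s, l, f')"
  unfolding det_def
proof
  assume *: "ok (mem (s, l, f))"
  have "sbase + 31 + 2 * v < mlen" using assms(2) by (simp add: mlen_def)
  from ok_upd[OF * this assms(4)] exec_Assign[of ok, OF *, of "faddr ie" e]
  show "exec ok (Suc 0) (Assign (faddr ie) e) (mem (s, l, f)) (return_pmf (mem (s, l, f')))"
    using assms by (simp only: val_faddr mem_upd_f One_nat_def)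
qed

fun upd :: "nat \<Rightarrow> nat \<Rightarrow> state \<Rightarrow> state" where
  "upd i x (s, l, f) = (s(i := x), l, f)"

lemma val_cV_upd: "i < 30 \<Longrightarrow> val (cV i) (mem (upd i x S)) = x"
  by (cases S) simp

lemma upd_upd: "upd i x (upd i y S) = upd i x S"
  by (cases S) simp

lemma det_upd:
  "i < 30 \<Longrightarrow> val e (mem S) = x \<Longrightarrow> x < 2 ^ K \<Longrightarrow> det (Suc 0) (Assign (vaddr i) e) S (upd i x S)"
  by (cases S) (auto intro: det_s)

text \<open>\<open>S j\<close> is the state before round \<open>j\<close>, up to the counter, which
  \<open>upd\<close> sets. Besides the body, a round takes 5 steps: unfolding, test, increment and
  two finished sequence heads. The last 4 are a final unfolding and test, the reset and its sequence
  head. The estimate \<open>L\<close> of the number of rounds gives uniform step counts.\<close>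

lemma det_For:
  assumes i: "i < 30"
    and body: "\<And>j. j < m \<Longrightarrow> det N c (upd i j (S j)) (upd i j (S (Suc j)))"
    and bound: "\<And>j. j \<le> m \<Longrightarrow> val e (mem (upd i j (S j))) = m"
    and m: "m < 2 ^ K"
    and init: "upd i 0 (S 0) = S0" and final: "upd i 0 (S m) = S1"
    and L: "m \<le> L"
  shows "det (L * (N + 5) + 4) (For i e c) S0 S1"
proof -
  let ?b = "Seq c (Assign (vaddr i) (Add (cV i) (Const 1)))"
  have loop: "det ((m - j) * (N + 5) + 2) (Loop (Sub e (cV i)) ?b) (upd i j (S j)) (upd i m (S m))"
    if "j \<le> m" for j
    using that
  proof (induction "m - j" arbitrary: j)
    case 0
    then have j: "j = m" by simp
    have "ok (mem (upd i m (S m))) \<Longrightarrow>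
       exec ok (0 + 2) (Loop (Sub e (cV i)) ?b) (mem (upd i m (S m))) (return_pmf (mem (upd i m (S m))))"
      using bound[of m] i by (intro exec_Loop) (auto simp: val_cV_upd intro: exec_Skip)
    then show ?case by (simp add: j det_def)
  next
    case (Suc d)
    then have j: "j < m" "d = m - Suc j" by auto
    have 1: "det (Suc 0) (Assign (vaddr i) (Add (cV i) (Const 1))) (upd i j (S (Suc j))) (upd i (Suc j) (S (Suc j)))"
      using det_upd[of i "Add (cV i) (Const 1)" "upd i j (S (Suc j))" "Suc j"] i j m
      by (simp add: val_cV_upd upd_upd)
    have 2: "det (N + Suc 0 + 1 + ((m - Suc j) * (N + 5) + 2) + 1) (Seq ?b (Loop (Sub e (cV i)) ?b)) (upd i j (S j)) (upd i m (S m))"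
      using j Suc.hyps(1)[of "Suc j"] by (intro det_Seq[OF det_Seq[OF body 1]]) auto
    have "ok (mem (upd i j (S j))) \<Longrightarrow>
       exec ok ((N + 1 + 1 + ((m - Suc j) * (N + 5) + 2) + 1) + 2) (Loop (Sub e (cV i)) ?b) (mem (upd i j (S j))) (return_pmf (mem (upd i m (S m))))"
      using bound[of j] i j 2 unfolding det_def by (intro exec_Loop) (auto simp: val_cV_upd)
    moreover have "(N + 1 + 1 + ((m - Suc j) * (N + 5) + 2) + 1) + 2 = (m - j) * (N + 5) + 2"
    proof -
      have "m - j = Suc (m - Suc j)" using j by simp
      then show ?thesis by simp
    qed
    ultimately show ?case by (simp add: det_def)
  qed
  have "det (Suc 0) (Assign (vaddr i) (Const 0)) (upd i m (S m)) S1"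
    using det_upd[of i "Const 0" "upd i m (S m)" 0] i final by (simp add: upd_upd)
  from det_Seq[OF loop[of 0, unfolded init] this]
  have "det ((m - 0) * (N + 5) + 2 + Suc 0 + 1) (For i e c) S0 S1"
    unfolding For_def by simp
  moreover have "(m - 0) * (N + 5) + 2 + Suc 0 + 1 = m * (N + 5) + 4"
    by simp
  ultimately have "det (m * (N + 5) + 4) (For i e c) S0 S1"
    by metis
  then show ?thesis by (rule det_mono) (use L in simp)
qed

text \<open>The exponent is evaluated again while the result and counter 20 change, hence the
  assumption for all \<open>x\<close> and \<open>j\<close>.\<close>

lemma det_Two_pow:
  assumes d: "d < 30" "d \<noteq> 20" and s: "s 20 = 0"
    and e: "\<And>x j. val e (mem (s(d := x, 20 := j), l, f)) = m"
    and m: "m < K" "m \<le> L" and s': "s' = s(d := 2 ^ m)"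
  shows "det (L * 6 + 6) (Two_pow d e) (s, l, f) (s', l, f)"
proof -
  have m_less: "m < 2 ^ K" using less_exp[of K] m(1) by (rule less_trans[rotated])
  have "det (L * (1 + 5) + 4) (For 20 e (Assign (vaddr d) (Mul (Const 2) (cV d)))) (s(d := 1), l, f) (s', l, f)"
  proof (rule det_For[where m = m and S = "\<lambda>j. (s(d := 2 ^ j), l, f)"])
    fix j assume j: "j < m"
    have "(2::nat) ^ Suc j < 2 ^ K" using j m by (intro power_strict_increasing) auto
    then show "det 1 (Assign (vaddr d) (Mul (Const 2) (cV d))) (upd 20 j (s(d := 2 ^ j), l, f))
          (upd 20 j (s(d := 2 ^ Suc j), l, f))"
      using d by (auto intro!: det_s simp: fun_eq_iff)
  qed (use d s e m s' m_less in \<open>auto simp: fun_eq_iff\<close>)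
  moreover have "det (Suc 0) (Assign (vaddr d) (Const 1)) (s, l, f) (s(d := 1), l, f)"
    using d one_less_power[of "2::nat" K] K_pos by (auto intro!: det_s)
  ultimately have "det (Suc 0 + (L * (1 + 5) + 4) + 1) (Two_pow d e) (s, l, f) (s', l, f)"
    unfolding Two_pow_def by (rule det_Seq[rotated])
  then show ?thesis by (simp add: ac_simps)
qed

end

section \<open>Colouring sums along an elimination forest\<close>

text \<open>Colours 1 and 2 are the two sides of a consistent cut of the solution; 3 must keep away
  from both, and 0 is compatible with everything.\<close>

definition conflict :: "nat \<Rightarrow> nat \<Rightarrow> bool" where
  "conflict a b \<longleftrightarrow> a \<noteq> b \<and> a \<noteq> 0 \<and> b \<noteq> 0"

text \<open>By \<open>T_lev\<close> the forest is acyclic and \<open>D - lev v\<close> decreases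
  towards the leaves, so it serves as measure for all recursions. As \<open>G_T\<close> speaks of
  proper ancestors, adjacent vertices have different levels.\<close>

locale elim =
  fixes n D :: nat and GG TT :: "(nat \<times> nat) set" and lev :: "nat \<Rightarrow> nat"
  assumes T_dom: "(u, v) \<in> TT \<Longrightarrow> u < n \<and> v < n"
    and T_lev: "(u, v) \<in> TT \<Longrightarrow> lev v = Suc (lev u)"
    and T_unique: "(u, w) \<in> TT \<Longrightarrow> (v, w) \<in> TT \<Longrightarrow> u = v"
    and lev_D: "v < n \<Longrightarrow> lev v \<le> D"
    and T_root: "v < n \<Longrightarrow> lev v \<noteq> 0 \<Longrightarrow> \<exists>u. (u, v) \<in> TT"
    and G_dom: "(u, v) \<in> GG \<Longrightarrow> u < n \<and> v < n"
    and G_sym: "(u, v) \<in> GG \<Longrightarrow> (v, u) \<in> GG"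
    and G_T: "(u, v) \<in> GG \<Longrightarrow> (u, v) \<in> TT\<^sup>+ \<or> (v, u) \<in> TT\<^sup>+"
begin

definition children :: "nat \<Rightarrow> nat set" where
  "children v = {c. (v, c) \<in> TT}"

lemma children_subset: "children v \<subseteq> {..<n}"
  using T_dom by (auto simp: children_def)

lemma finite_children [simp, intro]: "finite (children v)"
  using children_subset finite_subset by blast

lemma lev_trancl: "(u, v) \<in> TT\<^sup>+ \<Longrightarrow> lev u < lev v"
  by (induction rule: trancl_induct) (auto dest: T_lev)

lemma child_descent: "c \<in> children v \<Longrightarrow> D - lev c < D - lev v"
  using T_lev[of v c] T_dom[of v c] lev_D[of c] by (auto simp: children_def)

definition weight :: "(nat \<Rightarrow> nat) \<Rightarrow> nat \<Rightarrow> nat \<Rightarrow> nat" where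
  "weight x v s = (if s = 1 \<or> s = 2 then x v else 1)"

text \<open>Each edge is charged to its endpoint of larger level. The other endpoint is an ancestor,
  so the value depends only on colours along the path to the root.\<close>

definition vertex_weight :: "(nat \<Rightarrow> nat) \<Rightarrow> nat \<Rightarrow> (nat \<Rightarrow> nat) \<Rightarrow> nat" where
  "vertex_weight x v g = (if \<exists>u. (u, v) \<in> GG \<and> lev u < lev v \<and> conflict (g u) (g v) then 0
     else weight x v (g v))"

text \<open>The sum over all colourings of the subtree below \<open>v\<close> that extend the colours which \<open>g\<close> assigns to \<open>v\<close>
  and its ancestors; \<open>vertex_sum\<close> also sums over the colour of \<open>v\<close>.\<close>

function term_sum :: "(nat \<Rightarrow> nat) \<Rightarrow> nat \<Rightarrow> (nat \<Rightarrow> nat) \<Rightarrow> nat" where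
  "term_sum x v g = vertex_weight x v g *
     (\<Prod>c\<in>children v. \<Sum>s<4. term_sum x c (g(c := s)))"
  by pat_completeness auto
termination
  by (relation "Wellfounded.measure (\<lambda>(x, v, g). D - lev v)") (use child_descent in auto)

declare term_sum.simps [simp del]

definition vertex_sum :: "(nat \<Rightarrow> nat) \<Rightarrow> nat \<Rightarrow> (nat \<Rightarrow> nat) \<Rightarrow> nat" where
  "vertex_sum x v g = (\<Sum>s<4. term_sum x v (g(v := s)))"

lemma term_sum_eq:
  "term_sum x v g = vertex_weight x v g * (\<Prod>c\<in>children v. vertex_sum x c g)"
  by (subst term_sum.simps) (simp add: vertex_sum_def)

lemma vertex_weight_cong:
  assumes "\<And>u. (u, v) \<in> TT\<^sup>* \<Longrightarrow> g u = g' u"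
  shows "vertex_weight x v g = vertex_weight x v g'"
proof -
  have "g u = g' u" if "(u, v) \<in> GG" "lev u < lev v" for u
    using that assms[of u] G_T[of u v] lev_trancl[of v u] by (auto dest: trancl_into_rtrancl)
  then show ?thesis using assms[of v] unfolding vertex_weight_def by auto
qed

text \<open>Because parents are unique, an ancestor of a child of \<open>v\<close> is that child
  itself or an ancestor of \<open>v\<close>. This is what allows the single function read off from
  the counter to serve all branches at once.\<close>

lemma term_sum_cong:
  "(\<And>u. (u, v) \<in> TT\<^sup>* \<Longrightarrow> g u = g' u) \<Longrightarrow> term_sum x v g = term_sum x v g'"
proof (induction "D - lev v" arbitrary: v g g' rule: less_induct)
  case less
  have "term_sum x c (g(c := s)) = term_sum x c (g'(c := s))" if c: "c \<in> children v" for c s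
  proof (rule less.hyps[OF child_descent[OF c]])
    fix u assume u: "(u, c) \<in> TT\<^sup>*"
    show "(g(c := s)) u = (g'(c := s)) u"
    proof (cases "u = c")
      case False
      then obtain p where "(u, p) \<in> TT\<^sup>*" "(p, c) \<in> TT" using u by (metis rtranclE)
      with c have "(u, v) \<in> TT\<^sup>*" using T_unique by (auto simp: children_def)
      then show ?thesis using less.prems by simp
    qed simp
  qed
  then have "vertex_sum x c g = vertex_sum x c g'" if "c \<in> children v" for c
    using that by (simp add: vertex_sum_def)
  then show ?case
    using vertex_weight_cong[of v g g' x] less.prems
    by (simp add: term_sum_eq[of x v])
qed

lemma vertex_sum_cong:
  assumes "\<And>u. (u, v) \<in> TT\<^sup>+ \<Longrightarrow> g u = g' u"
  shows "vertex_sum x v g = vertex_sum x v g'"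
  unfolding vertex_sum_def
  using assms by (intro sum.cong term_sum_cong refl) (auto simp: rtrancl_eq_or_trancl)

text \<open>For a set \<open>U\<close> closed under ancestors, these are the roots of the subtrees
  that remain when \<open>U\<close> is removed.\<close>

definition boundary :: "nat set \<Rightarrow> nat set" where
  "boundary U = {c. c < n \<and> c \<notin> U \<and> (\<forall>u. (u, c) \<in> TT \<longrightarrow> u \<in> U)}"

lemma sum_PiE_insert:
  fixes \<phi> :: "('a \<Rightarrow> 'b) \<Rightarrow> 'c :: comm_monoid_add"
  assumes "v \<notin> U"
  shows "(\<Sum>g\<in>PiE (insert v U) (\<lambda>_. A). \<phi> g) = (\<Sum>g\<in>PiE U (\<lambda>_. A). \<Sum>s\<in>A. \<phi> (g(v := s)))"
proof -
  have "(\<Sum>g\<in>PiE (insert v U) (\<lambda>_. A). \<phi> g) = (\<Sum>(s, g)\<in>A \<times> PiE U (\<lambda>_. A). \<phi> (g(v := s)))"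
    unfolding PiE_insert_eq
    by (subst sum.reindex) (use inj_combinator[OF assms, of "\<lambda>_. A"] in \<open>auto simp: case_prod_unfold\<close>)
  also have "\<dots> = (\<Sum>s\<in>A. \<Sum>g\<in>PiE U (\<lambda>_. A). \<phi> (g(v := s)))"
    by (simp add: sum.cartesian_product)
  also have "\<dots> = (\<Sum>g\<in>PiE U (\<lambda>_. A). \<Sum>s\<in>A. \<phi> (g(v := s)))"
    by (rule sum.swap)
  finally show ?thesis .
qed

text \<open>Interpolation between two extremes: for empty \<open>U\<close> the left side is the
  product over the roots, for \<open>U\<close> the set of all vertices it is the plain sum over
  colourings. Removing a deepest vertex from \<open>U\<close> moves the sum over its colour into its
  \<open>vertex_sum\<close>.\<close>

theorem forest_sum:
  assumes "U \<subseteq> {..<n}" "\<And>u v. (u, v) \<in> TT \<Longrightarrow> v \<in> U \<Longrightarrow> u \<in> U"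
  shows "(\<Sum>g\<in>PiE U (\<lambda>_. {..<4}). (\<Prod>v\<in>U. vertex_weight x v g) * (\<Prod>c\<in>boundary U. vertex_sum x c g))
    = (\<Prod>r | r < n \<and> lev r = 0. vertex_sum x r g0)"
  using assms
proof (induction "card U" arbitrary: U)
  case 0
  then have U: "U = {}" using finite_subset by fastforce
  have b: "boundary {} = {r. r < n \<and> lev r = 0}"
    using T_root T_lev by (fastforce simp: boundary_def)
  have root: "vertex_sum x r g = vertex_sum x r g0" if "lev r = 0" for r g
    using that by (intro vertex_sum_cong) (auto dest: lev_trancl)
  have "(\<Prod>r | r < n \<and> lev r = 0. vertex_sum x r g) = (\<Prod>r | r < n \<and> lev r = 0. vertex_sum x r g0)" for g
    by (rule prod.cong[OF refl], rule root) simp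
  then show ?case by (simp only: U b PiE_empty_domain sum.insert) simp
next
  case (Suc m)
  have finU: "finite U" using Suc.prems finite_subset by blast
  have "U \<noteq> {}" using Suc.hyps(2) by auto
  then have "Max (lev ` U) \<in> lev ` U" using finU by (intro Max_in) auto
  then obtain v where v: "v \<in> U" "lev v = Max (lev ` U)" by auto
  \<comment> \<open>By maximality of the level, no child of \<open>v\<close> lies in
    \<open>U\<close>, so all of them lie in the boundary.\<close>
  have max: "lev u \<le> lev v" if "u \<in> U" for u
    unfolding v(2) using that finU by (intro Max_ge) auto
  note v = v(1)
  define U' where "U' = U - {v}"
  have U: "U = insert v U'" "v \<notin> U'" using v by (auto simp: U'_def)
  have finU': "finite U'" using finU by (simp add: U'_def)
  have closed': "u \<in> U'" if "(u, w) \<in> TT" "w \<in> U'" for u w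
    using that Suc.prems(2)[of u w] max[of w] T_lev[of u w] by (auto simp: U'_def)
  define R where "R = boundary U - children v"
  have ch: "children v \<subseteq> boundary U"
  proof
    fix c assume "c \<in> children v"
    then have c: "(v, c) \<in> TT" by (simp add: children_def)
    then have "c \<notin> U" using max[of c] T_lev[of v c] by auto
    then show "c \<in> boundary U" using c T_unique T_dom v by (auto simp: boundary_def)
  qed
  have vR: "v \<notin> R" using v by (auto simp: R_def boundary_def)
  have bd': "boundary U' = insert v R"
  proof -
    have "v \<in> boundary U'"
      using v Suc.prems T_lev by (fastforce simp: boundary_def U'_def)
    moreover have "c \<in> boundary U'" if "c \<in> R" for c
      using that by (auto simp: boundary_def U'_def R_def children_def)
    moreover have "c \<in> R" if "c \<in> boundary U'" "c \<noteq> v" for c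
      using that by (auto simp: boundary_def U'_def R_def children_def)
    ultimately show ?thesis by blast
  qed
  have finR: "finite R" unfolding R_def boundary_def by simp
  \<comment> \<open>The remaining boundary vertices are not below \<open>v\<close>: their parents
    are other vertices of \<open>U\<close>, and none of these is deeper than
    \<open>v\<close>.\<close>
  have R_cong: "vertex_sum x c (g(v := s)) = vertex_sum x c g" if "c \<in> R" for c g s
  proof (rule vertex_sum_cong)
    fix u assume "(u, c) \<in> TT\<^sup>+"
    then obtain p where p: "(u, p) \<in> TT\<^sup>*" "(p, c) \<in> TT" by (meson tranclD2)
    have "p \<in> U" "p \<noteq> v" using that p by (auto simp: R_def boundary_def children_def)
    moreover have "u \<noteq> v"
    proof
      assume "u = v"
      with p \<open>p \<noteq> v\<close> have "(v, p) \<in> TT\<^sup>+" by (simp add: rtrancl_eq_or_trancl)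
      then show False using lev_trancl[of v p] max[OF \<open>p \<in> U\<close>] by simp
    qed
    ultimately show "(g(v := s)) u = g u" by simp
  qed
  have U_cong: "vertex_weight x u (g(v := s)) = vertex_weight x u g" if u: "u \<in> U'" for u g s
  proof (rule vertex_weight_cong)
    fix w assume "(w, u) \<in> TT\<^sup>*"
    then have "w \<in> U'" using u
      by (induction rule: converse_rtrancl_induct) (auto intro: closed')
    then show "(g(v := s)) w = g w" using U(2) by auto
  qed
  have "(\<Sum>g\<in>PiE U (\<lambda>_. {..<4}). (\<Prod>v\<in>U. vertex_weight x v g) * (\<Prod>c\<in>boundary U. vertex_sum x c g))
     = (\<Sum>g\<in>PiE U' (\<lambda>_. {..<4}). \<Sum>s<4. (\<Prod>u\<in>U. vertex_weight x u (g(v := s))) *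
          (\<Prod>c\<in>boundary U. vertex_sum x c (g(v := s))))"
    unfolding U(1) by (rule sum_PiE_insert[OF U(2)])
  also have "\<dots> = (\<Sum>g\<in>PiE U' (\<lambda>_. {..<4}). (\<Prod>u\<in>U'. vertex_weight x u g) * (\<Prod>c\<in>boundary U'. vertex_sum x c g))"
  proof (rule sum.cong[OF refl])
    fix g
    have "(\<Prod>u\<in>U. vertex_weight x u (g(v := s))) * (\<Prod>c\<in>boundary U. vertex_sum x c (g(v := s)))
      = (\<Prod>u\<in>U'. vertex_weight x u g) * ((\<Prod>c\<in>R. vertex_sum x c g) * term_sum x v (g(v := s)))" for s
    proof -
      have "(\<Prod>u\<in>U. vertex_weight x u (g(v := s))) = vertex_weight x v (g(v := s)) * (\<Prod>u\<in>U'. vertex_weight x u g)"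
        unfolding U(1) using U(2) finU' U_cong by simp
      moreover have "(\<Prod>c\<in>boundary U. vertex_sum x c (g(v := s))) =
          (\<Prod>c\<in>R. vertex_sum x c g) * (\<Prod>c\<in>children v. vertex_sum x c (g(v := s)))"
        unfolding R_def using ch R_cong
        by (subst prod.subset_diff[OF ch]) (auto simp: boundary_def R_def)
      ultimately show ?thesis by (simp add: term_sum_eq mult_ac)
    qed
    then have "(\<Sum>s<4. (\<Prod>u\<in>U. vertex_weight x u (g(v := s))) * (\<Prod>c\<in>boundary U. vertex_sum x c (g(v := s))))
      = (\<Prod>u\<in>U'. vertex_weight x u g) * ((\<Prod>c\<in>R. vertex_sum x c g) * vertex_sum x v g)"
      by (simp add: sum_distrib_left vertex_sum_def)
    also have "\<dots> = (\<Prod>u\<in>U'. vertex_weight x u g) * (\<Prod>c\<in>boundary U'. vertex_sum x c g)"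
      unfolding bd' using vR finR by (simp add: mult_ac)
    finally show "(\<Sum>s<4. (\<Prod>u\<in>U. vertex_weight x u (g(v := s))) * (\<Prod>c\<in>boundary U. vertex_sum x c (g(v := s))))
      = (\<Prod>u\<in>U'. vertex_weight x u g) * (\<Prod>c\<in>boundary U'. vertex_sum x c g)" .
  qed
  also have "\<dots> = (\<Prod>r | r < n \<and> lev r = 0. vertex_sum x r g0)"
    using Suc.hyps(2) Suc.prems(1) closed' finU v
    by (intro Suc.hyps(1)) (auto simp: U'_def)
  finally show ?case .
qed

definition proper :: "(nat \<Rightarrow> nat) \<Rightarrow> bool" where
  "proper g \<longleftrightarrow> (\<forall>(u, v)\<in>GG. \<not> conflict (g u) (g v))"

definition colourings :: "(nat \<Rightarrow> nat) set" where
  "colourings = {g \<in> PiE {..<n} (\<lambda>_. {..<4}). proper g}"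

definition solution :: "(nat \<Rightarrow> nat) \<Rightarrow> nat set" where
  "solution g = {v. v < n \<and> (g v = 1 \<or> g v = 2)}"

text \<open>For \<open>U\<close> the set of all vertices the boundary is empty. An improper
  colouring vanishes at the lower endpoint of a violated edge; a proper one contributes the weights
  of its solution.\<close>

corollary roots_product:
  "(\<Prod>r | r < n \<and> lev r = 0. vertex_sum x r g0) = (\<Sum>g\<in>colourings. \<Prod>v\<in>solution g. x v)"
proof -
  have b: "boundary {..<n} = {}" by (auto simp: boundary_def)
  have "(\<Prod>r | r < n \<and> lev r = 0. vertex_sum x r g0) =
      (\<Sum>g\<in>PiE {..<n} (\<lambda>_. {..<4}). \<Prod>v<n. vertex_weight x v g)"
    using forest_sum[of "{..<n}" x g0] T_dom unfolding b by simp
  also have "\<dots> = (\<Sum>g\<in>PiE {..<n} (\<lambda>_. {..<4}). if proper g then \<Prod>v\<in>solution g. x v else 0)"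
  proof (rule sum.cong[OF refl])
    fix g
    show "(\<Prod>v<n. vertex_weight x v g) = (if proper g then \<Prod>v\<in>solution g. x v else 0)"
    proof (cases "proper g")
      case True
      then have "(\<Prod>v<n. vertex_weight x v g) = (\<Prod>v<n. if g v = 1 \<or> g v = 2 then x v else 1)"
        by (intro prod.cong refl) (auto simp: vertex_weight_def weight_def proper_def)
      also have "\<dots> = (\<Prod>v\<in>solution g. x v)"
        using prod.inter_filter[of "{..<n}" x "\<lambda>v. g v = 1 \<or> g v = 2"] by (simp add: solution_def)
      finally show ?thesis using True by simp
    next
      case False
      then obtain u v where uv: "(u, v) \<in> GG" "conflict (g u) (g v)" by (auto simp: proper_def)
      have "\<exists>w<n. vertex_weight x w g = 0"
      proof (cases "lev u < lev v")
        case True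
        then show ?thesis using uv G_dom by (auto simp: vertex_weight_def)
      next
        case False
        then have "lev v < lev u" using G_T[OF uv(1)] lev_trancl by auto
        moreover have "conflict (g v) (g u)" using uv(2) by (auto simp: conflict_def)
        ultimately show ?thesis using G_sym[OF uv(1)] G_dom by (auto simp: vertex_weight_def)
      qed
      then have "(\<Prod>v<n. vertex_weight x v g) = 0" by (intro prod_zero) auto
      then show ?thesis using False by simp
    qed
  qed
  also have "\<dots> = (\<Sum>g\<in>colourings. \<Prod>v\<in>solution g. x v)"
    unfolding colourings_def
    by (rule sum.inter_filter[symmetric]) (simp add: finite_PiE)
  finally show ?thesis .
qed

section \<open>Subtree sizes and the magnitude of the sums\<close>

function subtree :: "nat \<Rightarrow> nat" where
  "subtree v = 1 + (\<Sum>c\<in>children v. subtree c)"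
  by pat_completeness auto
termination
  by (relation "Wellfounded.measure (\<lambda>v. D - lev v)") (use child_descent in auto)

declare subtree.simps [simp del]

text \<open>Subtrees rooted on one level are disjoint and stay on that level or below it. This keeps
  products over several subtrees below \<open>Y ^ n\<close>.\<close>

lemma sum_subtree_level: "(\<Sum>c | c < n \<and> lev c = j. subtree c) \<le> card {v. v < n \<and> lev v \<ge> j}"
proof (induction "Suc D - j" arbitrary: j)
  case 0
  then have "{c. c < n \<and> lev c = j} = {}" using lev_D by fastforce
  then show ?case by (simp only: sum.empty)
next
  case (Suc d)
  let ?L = "\<lambda>j. {c. c < n \<and> lev c = j}"
  have "(\<Sum>c\<in>?L j. subtree c) = card (?L j) + (\<Sum>c\<in>?L j. \<Sum>c'\<in>children c. subtree c')"
    by (subst subtree.simps) (simp only: sum.distrib card_eq_sum)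
  also have "(\<Sum>c\<in>?L j. \<Sum>c'\<in>children c. subtree c') = (\<Sum>c'\<in>(\<Union>c\<in>?L j. children c). subtree c')"
    using T_unique by (subst sum.UNION_disjoint) (simp_all, auto simp: children_def)
  also have "\<dots> \<le> (\<Sum>c\<in>?L (Suc j). subtree c)"
    using T_dom T_lev by (intro sum_mono2) (auto simp: children_def)
  also have "\<dots> \<le> card {v. v < n \<and> lev v \<ge> Suc j}"
    using Suc.hyps by (intro Suc.hyps(1)) auto
  also have "card (?L j) + card {v. v < n \<and> lev v \<ge> Suc j} = card (?L j \<union> {v. v < n \<and> lev v \<ge> Suc j})"
    by (rule card_Un_disjoint[symmetric]) auto
  also have "?L j \<union> {v. v < n \<and> lev v \<ge> Suc j} = {v. v < n \<and> lev v \<ge> j}" by auto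
  finally show ?case by simp
qed

lemma sum_subtree_le:
  assumes "A \<subseteq> {c. c < n \<and> lev c = j}"
  shows "sum subtree A \<le> n"
proof -
  have "sum subtree A \<le> (\<Sum>c | c < n \<and> lev c = j. subtree c)"
    using assms by (intro sum_mono2) auto
  also have "\<dots> \<le> card {v. v < n \<and> lev v \<ge> j}" by (rule sum_subtree_level)
  also have "\<dots> \<le> card {..<n}" by (intro card_mono) auto
  finally show ?thesis by simp
qed

lemma subtree_le: "v < n \<Longrightarrow> subtree v \<le> n"
  using sum_subtree_le[of "{v}" "lev v"] by simp

text \<open>A vertex of the subtree contributes four colours, each with a factor \<open>x v\<close>
  or 1, hence at most \<open>Y\<close> altogether.\<close>

lemma vertex_sum_le:
  assumes "\<And>v. 4 * x v \<le> Y" "4 \<le> Y"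
  shows "vertex_sum x v g \<le> Y ^ subtree v"
proof (induction "D - lev v" arbitrary: v g rule: less_induct)
  case less
  have "term_sum x v g' * 4 \<le> Y ^ subtree v" for g'
  proof -
    have w: "4 * vertex_weight x v g' \<le> Y"
      using assms(1)[of v] assms(2) by (auto simp: vertex_weight_def weight_def)
    have "(\<Prod>c\<in>children v. vertex_sum x c g') \<le> (\<Prod>c\<in>children v. Y ^ subtree c)"
      using less child_descent by (intro prod_mono) auto
    also have "\<dots> = Y ^ (\<Sum>c\<in>children v. subtree c)" by (simp add: power_sum)
    finally have "(4 * vertex_weight x v g') * (\<Prod>c\<in>children v. vertex_sum x c g')
       \<le> Y * Y ^ (\<Sum>c\<in>children v. subtree c)" using w by (intro mult_mono) auto
    also have "\<dots> = Y ^ subtree v" by (subst (2) subtree.simps) simp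
    finally show ?thesis by (simp add: term_sum_eq mult_ac)
  qed
  then have "(\<Sum>s<4. term_sum x v (g(v := s)) * 4) \<le> (\<Sum>s<(4::nat). Y ^ subtree v)"
    by (intro sum_mono) auto
  then show ?case unfolding vertex_sum_def by (simp add: sum_distrib_right[symmetric])
qed

end

section \<open>Digits and isolation\<close>

text \<open>No carries arise: fewer than \<open>2 ^ \<beta>\<close> summands have exponents below
  \<open>i\<close>, so they do not reach position \<open>i\<close>. The larger ones contribute
  multiples of the base, which vanish modulo 4 because \<open>\<beta> \<ge> 2\<close>.\<close>

lemma digit_mod_4:
  fixes e :: "'a \<Rightarrow> nat"
  assumes C: "finite C" "card C < 2 ^ \<beta>" and \<beta>: "\<beta> \<ge> 2"
  shows "(\<Sum>g\<in>C. (2 ^ \<beta>) ^ e g) div (2 ^ \<beta>) ^ i mod 4 = card {g \<in> C. e g = i} mod (4 :: nat)"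
proof -
  let ?B = "2 ^ \<beta> :: nat"
  let ?lo = "{g \<in> C. e g < i}" and ?eq = "{g \<in> C. e g = i}" and ?hi = "{g \<in> C. e g > i}"
  define lo where "lo = (\<Sum>g\<in>?lo. ?B ^ e g)"
  define hi where "hi = (\<Sum>g\<in>?hi. ?B ^ (e g - i - 1))"
  have "?B ^ e g = ?B ^ i * (?B * ?B ^ (e g - i - 1))" if "g \<in> ?hi" for g
  proof -
    have "e g = i + Suc (e g - i - 1)" using that by simp
    then show ?thesis by (metis power_Suc power_add)
  qed
  then have hi: "(\<Sum>g\<in>?hi. ?B ^ e g) = ?B ^ i * (?B * hi)"
    unfolding hi_def sum_distrib_left by (intro sum.cong) auto
  have "lo < ?B ^ i"
  proof (cases i)
    case (Suc i')
    have "lo \<le> (\<Sum>g\<in>?lo. ?B ^ i')"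
      unfolding lo_def using Suc by (intro sum_mono power_increasing) auto
    also have "\<dots> = card ?lo * ?B ^ i'" by simp
    also have "\<dots> \<le> card C * ?B ^ i'" using C by (intro mult_le_mono1 card_mono) auto
    also have "\<dots> < ?B * ?B ^ i'" using C by simp
    finally show ?thesis by (simp add: Suc)
  qed (simp add: lo_def)
  have "C = ?lo \<union> (?eq \<union> ?hi)" by auto
  then have "(\<Sum>g\<in>C. ?B ^ e g) = (\<Sum>g\<in>?lo \<union> (?eq \<union> ?hi). ?B ^ e g)" by simp
  also have "\<dots> = lo + ((\<Sum>g\<in>?eq. ?B ^ e g) + (\<Sum>g\<in>?hi. ?B ^ e g))"
    unfolding lo_def using C
    by (subst sum.union_disjoint, simp, simp, force, subst sum.union_disjoint) auto
  also have "\<dots> = lo + ?B ^ i * (card ?eq + ?B * hi)"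
    unfolding hi by (simp add: algebra_simps)
  finally have "(\<Sum>g\<in>C. ?B ^ e g) div ?B ^ i = card ?eq + ?B * hi"
    using \<open>lo < ?B ^ i\<close> by simp
  moreover obtain \<gamma> where "\<beta> = 2 + \<gamma>" using \<beta> le_Suc_ex by blast
  then have "?B = 4 * 2 ^ \<gamma>" by (simp add: power_add)
  ultimately show ?thesis by (simp add: mult.assoc)
qed

section \<open>Consistent cuts counted modulo 4\<close>

lemma even_card_complement:
  assumes "finite X" "X \<noteq> {}" "\<And>L. L \<in> \<C> \<Longrightarrow> L \<subseteq> X" "\<And>L. L \<in> \<C> \<Longrightarrow> X - L \<in> \<C>"
  shows "even (card \<C>)"
proof -
  obtain x where x: "x \<in> X" using assms(2) by blast
  \<comment> \<open>Complementation in \<open>X\<close> exchanges the members that contain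
    \<open>x\<close> with those that do not.\<close>
  let ?A = "{L \<in> \<C>. x \<in> L}" and ?B = "{L \<in> \<C>. x \<notin> L}"
  have fin: "finite \<C>" using assms(1,3) by (meson Pow_iff finite_Pow_iff finite_subset subsetI)
  have "bij_betw (\<lambda>L. X - L) ?A ?B"
    by (rule bij_betw_byWitness[where f' = "\<lambda>L. X - L"])
      (use x assms(3,4) in \<open>auto simp: double_diff\<close>)
  then have "card ?A = card ?B" by (rule bij_betw_same_card)
  moreover have "card \<C> = card (?A \<union> ?B)" by (rule arg_cong[of _ _ card]) auto
  moreover have "card (?A \<union> ?B) = card ?A + card ?B" using fin by (intro card_Un_disjoint) auto
  ultimately show ?thesis by simp
qed

text \<open>For symmetric \<open>E\<close> these are the unions of connected components of the graph
  induced on \<open>X\<close>, one for each consistent cut. They replace components, since only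
  their number modulo 4 matters.\<close>

definition closed_subsets :: "('a \<times> 'a) set \<Rightarrow> 'a set \<Rightarrow> 'a set set" where
  "closed_subsets E X = {L. L \<subseteq> X \<and> (\<forall>u\<in>L. \<forall>v\<in>X. (u, v) \<in> E \<longrightarrow> v \<in> L)}"

lemma even_card_closed_subsets:
  assumes "finite X" "X \<noteq> {}" "sym E"
  shows "even (card (closed_subsets E X))"
  by (rule even_card_complement[OF assms(1,2)])
    (use symD[OF assms(3)] in \<open>unfold closed_subsets_def, blast+\<close>)

text \<open>By symmetry no edge leads from \<open>C\<close> to \<open>X - C\<close>, so a closed
  subset is an independent choice on the two sides.\<close>

lemma card_closed_subsets_split:
  assumes "sym E" "C \<in> closed_subsets E X"
  shows "card (closed_subsets E X) = card (closed_subsets E C) * card (closed_subsets E (X - C))"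
proof -
  have "bij_betw (\<lambda>L. (L \<inter> C, L - C)) (closed_subsets E X) (closed_subsets E C \<times> closed_subsets E (X - C))"
  proof (rule bij_betw_byWitness[where f' = "\<lambda>(A, B). A \<union> B"])
    show "(\<lambda>L. (L \<inter> C, L - C)) ` closed_subsets E X \<subseteq> closed_subsets E C \<times> closed_subsets E (X - C)"
      using assms(2) symD[OF assms(1)] unfolding closed_subsets_def by blast
    show "(\<lambda>(A, B). A \<union> B) ` (closed_subsets E C \<times> closed_subsets E (X - C)) \<subseteq> closed_subsets E X"
      using assms(2) symD[OF assms(1)] by (auto simp: closed_subsets_def) blast+
  qed (use assms in \<open>auto simp: closed_subsets_def\<close>)
  from bij_betw_same_card[OF this] show ?thesis by (simp add: card_cartesian_product)
qed

text \<open>A closed subset other than \<open>{}\<close> and \<open>X\<close> splits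
  \<open>X\<close> into two nonempty parts, and each contributes an even factor.\<close>

lemma closed_subsets_dichotomy:
  assumes "finite X" "X \<noteq> {}" "sym E"
  shows "closed_subsets E X = {{}, X} \<or> 4 dvd card (closed_subsets E X)"
proof (cases "closed_subsets E X = {{}, X}")
  case False
  have "{} \<in> closed_subsets E X" "X \<in> closed_subsets E X" by (auto simp: closed_subsets_def)
  with False obtain C where C: "C \<in> closed_subsets E X" "C \<noteq> {}" "C \<noteq> X" by blast
  then have "X - C \<noteq> {}" "C \<subseteq> X" by (auto simp: closed_subsets_def)
  then have "2 dvd card (closed_subsets E C)" "2 dvd card (closed_subsets E (X - C))"
    using assms C by (auto intro!: even_card_closed_subsets intro: finite_subset)
  from mult_dvd_mono[OF this] show ?thesis
    by (simp add: card_closed_subsets_split[OF assms(3) C(1)])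
qed simp

section \<open>Colourings with a given solution and the digit test\<close>

context elim
begin

definition undominated :: "nat set \<Rightarrow> nat set" where
  "undominated X = {v. v < n \<and> v \<notin> X \<and> (\<forall>u\<in>X. (u, v) \<notin> GG)}"

text \<open>Connectedness is the absence of a nontrivial closed subset. The empty set passes this
  test, but dominates nothing when there are vertices.\<close>

definition cds :: "nat set \<Rightarrow> bool" where
  "cds X \<longleftrightarrow> X \<subseteq> {..<n} \<and> closed_subsets GG X = {{}, X} \<and> undominated X = {}"

lemma sym_GG: "sym GG"
  using G_sym by (auto simp: sym_def)

lemma finite_colourings: "finite colourings"
  unfolding colourings_def by (simp add: finite_PiE)

text \<open>Source of the digit length \<open>2 * n + 1\<close>; the extra bit makes the bound
  strict.\<close>

lemma card_colourings_less: "card colourings < 2 ^ (2 * n + 1)"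
proof -
  have "card colourings \<le> card (PiE {..<n} (\<lambda>_. {..<(4::nat)}))"
    unfolding colourings_def by (intro card_mono) (auto simp: finite_PiE)
  also have "\<dots> = 2 ^ (2 * n)" by (simp add: card_PiE power_mult)
  also have "\<dots> < 2 ^ (2 * n + 1)" by (intro power_strict_increasing) auto
  finally show ?thesis .
qed

text \<open>Once \<open>X\<close> is fixed, a colouring amounts to its vertices of colour 1 and of
  colour 3. Properness says exactly that the former are closed in \<open>X\<close> and that the
  latter have no neighbour in \<open>X\<close>.\<close>

lemma card_colourings_solution:
  assumes X: "X \<subseteq> {..<n}"
  shows "card {g \<in> colourings. solution g = X} = card (closed_subsets GG X) * 2 ^ card (undominated X)"
proof -
  let ?f = "\<lambda>g. ({v. v < n \<and> g v = 1}, {v. v < n \<and> g v = 3})"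
  let ?h = "\<lambda>(L, F). \<lambda>v\<in>{..<n}. if v \<in> L then 1 else if v \<in> X then 2 else if v \<in> F then 3 else (0::nat)"
  have "bij_betw ?f {g \<in> colourings. solution g = X} (closed_subsets GG X \<times> Pow (undominated X))"
  proof (rule bij_betw_byWitness[where f' = ?h])
    show "\<forall>g\<in>{g \<in> colourings. solution g = X}. ?h (?f g) = g"
    proof
      fix g assume g: "g \<in> {g \<in> colourings. solution g = X}"
      have "?h (?f g) v = g v" for v
      proof (cases "v < n")
        case True
        with g have "g v < 4" by (auto simp: colourings_def PiE_def Pi_def)
        then have "g v = 0 \<or> g v = 1 \<or> g v = 2 \<or> g v = 3" by linarith
        moreover have "v \<in> X \<longleftrightarrow> g v = 1 \<or> g v = 2" using g True by (auto simp: solution_def)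
        ultimately show ?thesis using True by auto
      next
        case False
        with g show ?thesis by (auto simp: colourings_def PiE_def extensional_def)
      qed
      then show "?h (?f g) = g" by blast
    qed
    show "\<forall>p\<in>closed_subsets GG X \<times> Pow (undominated X). ?f (?h p) = p"
      using X by (auto simp: closed_subsets_def undominated_def)
    show "?f ` {g \<in> colourings. solution g = X} \<subseteq> closed_subsets GG X \<times> Pow (undominated X)"
    proof
      fix p assume "p \<in> ?f ` {g \<in> colourings. solution g = X}"
      then obtain g where p: "p = ?f g" and g: "g \<in> colourings" "solution g = X" by blast
      have pr: "\<not> conflict (g u) (g v)" if "(u, v) \<in> GG" for u v
        using g(1) that by (auto simp: colourings_def proper_def)
      show "p \<in> closed_subsets GG X \<times> Pow (undominated X)"
      proof -
        have "g v = 1" if "v \<in> X" "(u, v) \<in> GG" "g u = 1" for u v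
          using pr[OF that(2)] that g(2) by (auto simp: solution_def conflict_def)
        moreover have "u \<notin> X" if "g v = 3" "(u, v) \<in> GG" for u v
          using pr[OF that(2)] that g(2) by (auto simp: solution_def conflict_def)
        moreover have "v \<in> X" if "v < n" "g v = 1" for v
          using that g(2) by (auto simp: solution_def)
        moreover have "v \<notin> X" if "g v = 3" for v
          using that g(2) by (auto simp: solution_def)
        ultimately show ?thesis
          unfolding p closed_subsets_def undominated_def using X by blast
      qed
    qed
    show "?h ` (closed_subsets GG X \<times> Pow (undominated X)) \<subseteq> {g \<in> colourings. solution g = X}"
    proof
      fix g assume "g \<in> ?h ` (closed_subsets GG X \<times> Pow (undominated X))"
      then obtain L F where g: "g = ?h (L, F)" and L: "L \<in> closed_subsets GG X" and F: "F \<subseteq> undominated X"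
        by (elim imageE SigmaE) simp
      have "\<not> conflict (g u) (g v)" if "(u, v) \<in> GG" for u v
      proof -
        have "u < n" "v < n" using G_dom[OF that] by auto
        moreover have "u \<in> L \<Longrightarrow> v \<in> X \<Longrightarrow> v \<in> L" "v \<in> L \<Longrightarrow> u \<in> X \<Longrightarrow> u \<in> L" "L \<subseteq> X"
          using that G_sym[OF that] L unfolding closed_subsets_def by blast+
        moreover have "u \<in> F \<Longrightarrow> v \<notin> X" "v \<in> F \<Longrightarrow> u \<notin> X"
          using that G_sym[OF that] F unfolding undominated_def by blast+
        ultimately show ?thesis by (auto simp: g conflict_def)
      qed
      then have "proper g" by (auto simp: proper_def)
      moreover have "g \<in> PiE {..<n} (\<lambda>_. {..<4})" by (auto simp: g)
      moreover have "solution g = X" using X L F by (auto simp: g solution_def closed_subsets_def undominated_def)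
      ultimately show "g \<in> {g \<in> colourings. solution g = X}" by (simp add: colourings_def)
    qed
  qed
  then show ?thesis
    by (simp add: bij_betw_same_card card_cartesian_product card_Pow undominated_def)
qed

text \<open>The number of closed subsets is even as \<open>X\<close> is nonempty. An undominated
  vertex supplies a second factor 2, and a disconnected \<open>X\<close> makes the first factor
  divisible by 4; otherwise the count is exactly 2.\<close>

lemma card_colourings_mod_4:
  assumes X: "X \<subseteq> {..<n}" "X \<noteq> {}"
  shows "card {g \<in> colourings. solution g = X} mod 4 = (if cds X then 2 else 0)"
proof -
  have finX: "finite X" using X finite_subset by blast
  have "4 dvd card (closed_subsets GG X) * 2 ^ card (undominated X)" if "undominated X \<noteq> {}"
  proof -
    have "finite (undominated X)" by (simp add: undominated_def)
    with that have "even (2 ^ card (undominated X) :: nat)" by (auto simp: card_eq_0_iff)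
    with even_card_closed_subsets[OF finX X(2) sym_GG]
    have "2 * 2 dvd card (closed_subsets GG X) * 2 ^ card (undominated X)" by (rule mult_dvd_mono)
    then show ?thesis by simp
  qed
  moreover have "4 dvd card (closed_subsets GG X) * 2 ^ card (undominated X)"
    if "closed_subsets GG X \<noteq> {{}, X}"
    using closed_subsets_dichotomy[OF finX X(2) sym_GG] that by (blast intro: dvd_mult2)
  ultimately have "4 dvd card (closed_subsets GG X) * 2 ^ card (undominated X)" if "\<not> cds X"
    using that X(1) unfolding cds_def by blast
  moreover have "card (closed_subsets GG X) * 2 ^ card (undominated X) = 2" if "cds X"
    using that X(2) unfolding cds_def by simp
  ultimately show ?thesis
    unfolding card_colourings_solution[OF X(1)] by (cases "cds X") simp_all
qed

text \<open>A colouring has exponent \<open>card X * M + sum \<omega> X\<close> for its solution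
  \<open>X\<close>. Division by \<open>M\<close> recovers both summands, so one digit collects
  exactly the solutions of size \<open>k\<close> and weight \<open>w\<close>.\<close>

lemma digit_test:
  fixes \<omega> :: "nat \<Rightarrow> nat" and Z :: nat
  assumes M: "sum \<omega> {..<n} < M" and k: "k > 0"
    and Z: "Z = (\<Sum>g\<in>colourings. \<Prod>v\<in>solution g. 2 ^ ((2 * n + 1) * (M + \<omega> v)))"
    and w: "w < M" and n: "n > 0"
  shows "Z div 2 ^ ((2 * n + 1) * (k * M + w)) mod 4 =
    (\<Sum>X | X \<subseteq> {..<n} \<and> card X = k \<and> sum \<omega> X = w. if cds X then 2 else 0) mod 4"
proof -
  let ?b = "2 * n + 1"
  define e where "e = (\<lambda>g. card (solution g) * M + sum \<omega> (solution g))"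
  let ?XX = "{X. X \<subseteq> {..<n} \<and> card X = k \<and> sum \<omega> X = w}"
  have finX: "finite ?XX" by (rule finite_subset[of _ "Pow {..<n}"]) auto
  have "(\<Prod>v\<in>solution g. (2::nat) ^ (?b * (M + \<omega> v))) = (2 ^ ?b) ^ e g" for g
    by (simp only: power_mult[symmetric] power_sum[symmetric] sum_distrib_left[symmetric])
      (simp add: e_def sum.distrib)
  then have Z': "Z = (\<Sum>g\<in>colourings. (2 ^ ?b) ^ e g)" unfolding Z by (intro sum.cong refl)
  have "Z div 2 ^ (?b * (k * M + w)) mod 4 = card {g \<in> colourings. e g = k * M + w} mod 4"
    unfolding Z' power_mult using n by (intro digit_mod_4 finite_colourings card_colourings_less) auto
  also have "{g \<in> colourings. e g = k * M + w} = (\<Union>X\<in>?XX. {g \<in> colourings. solution g = X})"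
  proof -
    have *: "card (solution g) = k \<and> sum \<omega> (solution g) = w" if "e g = k * M + w" for g
    proof -
      have "sum \<omega> (solution g) \<le> sum \<omega> {..<n}" by (intro sum_mono2) (auto simp: solution_def)
      then have s: "sum \<omega> (solution g) < M" using M by simp
      have "e g div M = card (solution g)" "e g mod M = sum \<omega> (solution g)"
        using s by (simp_all add: e_def)
      moreover have "e g div M = k" "e g mod M = w" using w that by simp_all
      ultimately show ?thesis by simp
    qed
    have "e g = k * M + w \<longleftrightarrow> card (solution g) = k \<and> sum \<omega> (solution g) = w" for g
      using *[of g] by (auto simp only: e_def)
    moreover have "solution g \<subseteq> {..<n}" for g by (auto simp: solution_def)
    ultimately show ?thesis by auto
  qed
  also have "card \<dots> = (\<Sum>X\<in>?XX. card {g \<in> colourings. solution g = X})"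
    using finX finite_colourings by (intro card_UN_disjoint) auto
  also have "\<dots> mod 4 = (\<Sum>X\<in>?XX. card {g \<in> colourings. solution g = X} mod 4) mod 4"
    by (simp add: mod_sum_eq)
  also have "(\<Sum>X\<in>?XX. card {g \<in> colourings. solution g = X} mod 4) = (\<Sum>X\<in>?XX. if cds X then 2 else 0)"
    using k by (intro sum.cong refl card_colourings_mod_4) auto
  finally show ?thesis .
qed

lemma digit_test_sound:
  fixes \<omega> :: "nat \<Rightarrow> nat" and Z :: nat
  assumes M: "sum \<omega> {..<n} < M" and k: "k > 0"
    and Z: "Z = (\<Sum>g\<in>colourings. \<Prod>v\<in>solution g. 2 ^ ((2 * n + 1) * (M + \<omega> v)))"
    and w: "w < M" and n: "n > 0" and "Z div 2 ^ ((2 * n + 1) * (k * M + w)) mod 4 \<noteq> 0"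
  shows "\<exists>X. cds X \<and> card X = k"
proof (rule ccontr)
  assume "\<not> ?thesis"
  then have "(\<Sum>X | X \<subseteq> {..<n} \<and> card X = k \<and> sum \<omega> X = w. if cds X then 2 else 0) = (0::nat)"
    by (intro sum.neutral) auto
  then show False using digit_test[OF assms(1-5)] assms(6) by simp
qed

text \<open>At the minimum weight the isolated solution is the only contributor, so its 2 cannot be
  cancelled modulo 4 by another solution.\<close>

lemma digit_test_complete:
  fixes \<omega> :: "nat \<Rightarrow> nat" and Z :: nat
  assumes M: "sum \<omega> {..<n} < M" and k: "k > 0"
    and Z: "Z = (\<Sum>g\<in>colourings. \<Prod>v\<in>solution g. 2 ^ ((2 * n + 1) * (M + \<omega> v)))"
    and n: "n > 0"
    and uniq: "\<exists>!A. (cds A \<and> card A = k) \<and> (\<forall>B. cds B \<and> card B = k \<longrightarrow> sum \<omega> A \<le> sum \<omega> B)"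
  shows "\<exists>w<M. Z div 2 ^ ((2 * n + 1) * (k * M + w)) mod 4 \<noteq> 0"
proof -
  obtain A where A: "cds A" "card A = k" "\<And>B. cds B \<Longrightarrow> card B = k \<Longrightarrow> sum \<omega> A \<le> sum \<omega> B"
    using uniq by blast
  have An: "A \<subseteq> {..<n}" using A(1) by (simp add: cds_def)
  then have "sum \<omega> A \<le> sum \<omega> {..<n}" by (intro sum_mono2) auto
  then have w: "sum \<omega> A < M" using M by simp
  have fin: "finite {X. X \<subseteq> {..<n} \<and> card X = k \<and> sum \<omega> X = sum \<omega> A}"
    by (rule finite_subset[of _ "Pow {..<n}"]) auto
  have "B = A" if "cds B" "card B = k" "sum \<omega> B = sum \<omega> A" for B
    using uniq A that by metis
  then have "(\<Sum>X | X \<subseteq> {..<n} \<and> card X = k \<and> sum \<omega> X = sum \<omega> A. if cds X then 2 else 0)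
     = (\<Sum>X | X \<subseteq> {..<n} \<and> card X = k \<and> sum \<omega> X = sum \<omega> A. if X = A then 2 else (0::nat))"
    using A by (intro sum.cong) auto
  also have "\<dots> = 2" using fin An A(2) by (subst sum.delta) auto
  finally have "Z div 2 ^ ((2 * n + 1) * (k * M + sum \<omega> A)) mod 4 = 2"
    using digit_test[OF M k Z w n] by simp
  then show ?thesis using w by (intro exI[of _ "sum \<omega> A"]) auto
qed

end

section \<open>Isolation by random digits\<close>

definition digit_weight :: "nat \<Rightarrow> nat \<Rightarrow> nat \<Rightarrow> nat" where
  "digit_weight b r v = r div 2 ^ (b * v) mod 2 ^ b"

definition minimiser :: "('a \<Rightarrow> nat) \<Rightarrow> 'a set set \<Rightarrow> 'a set \<Rightarrow> bool" where
  "minimiser \<omega> F A \<longleftrightarrow> A \<in> F \<and> (\<forall>B\<in>F. sum \<omega> A \<le> sum \<omega> B)"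

lemma minimiser_eq: "minimiser \<omega> F A \<Longrightarrow> minimiser \<omega> F B \<Longrightarrow> sum \<omega> A = sum \<omega> B"
  by (simp add: minimiser_def order_antisym)

text \<open>Removes digit \<open>v\<close> and closes the gap. Its fibres fix all weights but that
  of \<open>v\<close>, so the conditioning step of the isolation argument becomes an injectivity
  claim.\<close>

definition drop_digit :: "nat \<Rightarrow> nat \<Rightarrow> nat \<Rightarrow> nat" where
  "drop_digit b v r = r div 2 ^ (b * Suc v) * 2 ^ (b * v) + r mod 2 ^ (b * v)"

lemma drop_digit_less:
  assumes "r < 2 ^ (b * n)" "v < n"
  shows "drop_digit b v r < 2 ^ (b * (n - 1))"
proof -
  have "b * n = b * (n - Suc v) + b * Suc v"
    unfolding distrib_left[symmetric] using assms(2) by simp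
  then have "r div 2 ^ (b * Suc v) < 2 ^ (b * (n - Suc v))"
    using assms(1) by (intro less_mult_imp_div_less) (simp only: power_add)
  then have "Suc (r div 2 ^ (b * Suc v)) * 2 ^ (b * v) \<le> 2 ^ (b * (n - Suc v)) * 2 ^ (b * v)"
    by (intro mult_le_mono1) simp
  moreover have "drop_digit b v r < Suc (r div 2 ^ (b * Suc v)) * 2 ^ (b * v)"
    unfolding drop_digit_def by (simp only: mult_Suc) (simp only: add.commute add_less_cancel_right, simp)
  moreover have "n - 1 = (n - Suc v) + v" using assms(2) by simp
  then have "(2::nat) ^ (b * (n - Suc v)) * 2 ^ (b * v) = 2 ^ (b * (n - 1))"
    by (simp only: distrib_left power_add)
  ultimately show ?thesis by linarith
qed

lemma drop_digit_eqD:
  assumes "drop_digit b v r = drop_digit b v r'"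
  shows "u \<noteq> v \<Longrightarrow> digit_weight b r u = digit_weight b r' u"
    and "digit_weight b r v = digit_weight b r' v \<Longrightarrow> r = r'"
proof -
  have pos: "(2::nat) ^ (b * v) > 0" by simp
  have "drop_digit b v x div 2 ^ (b * v) = x div 2 ^ (b * Suc v)"
    "drop_digit b v x mod 2 ^ (b * v) = x mod 2 ^ (b * v)" for x
    unfolding drop_digit_def by simp_all
  with assms have hi: "r div 2 ^ (b * Suc v) = r' div 2 ^ (b * Suc v)"
    and lo: "r mod 2 ^ (b * v) = r' mod 2 ^ (b * v)" by metis+
  {
    assume "u \<noteq> v"
    then consider "u < v" | "v < u" by linarith
    then show "digit_weight b r u = digit_weight b r' u"
    proof cases
      case 1
      then obtain d where d: "v = Suc (u + d)" using less_imp_Suc_add by blast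
      have "digit_weight b x u = digit_weight b (x mod 2 ^ (b * v)) u" for x
      proof -
        have e: "(2::nat) ^ (b * v) = 2 ^ (b * u) * (2 ^ b * 2 ^ (b * d))"
          by (simp add: d power_add[symmetric] algebra_simps)
        have "x mod 2 ^ (b * v) div 2 ^ (b * u) = x div 2 ^ (b * u) mod (2 ^ b * 2 ^ (b * d))"
          unfolding e mod_mult2_eq by simp
        then show ?thesis by (simp add: digit_weight_def mod_mult2_eq)
      qed
      then show ?thesis using lo by metis
    next
      case 2
      then obtain d where d: "u = Suc v + d" using less_imp_Suc_add by fastforce
      have "x div 2 ^ (b * u) = x div 2 ^ (b * Suc v) div 2 ^ (b * d)" for x :: nat
        unfolding d distrib_left power_add by (rule div_mult2_eq)
      then show ?thesis using hi by (simp add: digit_weight_def)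
    qed
  }
  assume w: "digit_weight b r v = digit_weight b r' v"
  have e: "x div 2 ^ (b * v) = x div 2 ^ (b * Suc v) * 2 ^ b + digit_weight b x v" for x
  proof -
    have "x div 2 ^ (b * Suc v) = x div 2 ^ (b * v) div 2 ^ b"
      by (metis div_mult2_eq mult_Suc_right power_add add.commute)
    then show ?thesis by (simp only: digit_weight_def div_mult_mod_eq)
  qed
  have "r div 2 ^ (b * v) = r' div 2 ^ (b * v)" using e[of r] e[of r'] hi w by simp
  with lo show "r = r'" by (metis div_mult_mod_eq)
qed

text \<open>When the other weights are fixed, minimisers with and without \<open>v\<close> coexist
  for at most one weight of \<open>v\<close>, so \<open>drop_digit\<close> is injective on these
  numbers.\<close>

lemma ambiguous_digit_card:
  assumes F: "F \<subseteq> Pow {..<n}" and v: "v < n"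
  shows "card {r. r < 2 ^ (b * n) \<and> (\<exists>A B. minimiser (digit_weight b r) F A \<and>
     minimiser (digit_weight b r) F B \<and> v \<in> A \<and> v \<notin> B)} \<le> 2 ^ (b * (n - 1))"
    (is "card ?bad \<le> _")
proof -
  have "inj_on (drop_digit b v) ?bad"
  proof (rule inj_onI)
    fix r r' assume "r \<in> ?bad" "r' \<in> ?bad" and eq: "drop_digit b v r = drop_digit b v r'"
    then obtain A B A' B' where A: "minimiser (digit_weight b r) F A" "v \<in> A"
      and B: "minimiser (digit_weight b r) F B" "v \<notin> B"
      and A': "minimiser (digit_weight b r') F A'" "v \<in> A'"
      and B': "minimiser (digit_weight b r') F B'" "v \<notin> B'" by blast
    have fin: "X \<in> F \<Longrightarrow> finite X" for X using F finite_subset by blast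
    define \<rho> where "\<rho> X = sum (digit_weight b r) (X - {v})" for X
    have \<rho>': "\<rho> X = sum (digit_weight b r') (X - {v})" for X
      unfolding \<rho>_def using drop_digit_eqD(1)[OF eq] by (intro sum.cong) auto
    have in_v: "sum (digit_weight b r) X = digit_weight b r v + \<rho> X"
      "sum (digit_weight b r') X = digit_weight b r' v + \<rho> X" if "v \<in> X" "X \<in> F" for X
      using sum.remove[OF fin[OF that(2)] that(1), of "digit_weight b r"]
        sum.remove[OF fin[OF that(2)] that(1), of "digit_weight b r'"]
      unfolding \<rho>'[of X, symmetric] by (simp_all add: \<rho>_def)
    have out_v: "sum (digit_weight b r) X = \<rho> X" "sum (digit_weight b r') X = \<rho> X" if "v \<notin> X" for X
    proof -
      show "sum (digit_weight b r) X = \<rho> X" using that by (simp add: \<rho>_def)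
      show "sum (digit_weight b r') X = \<rho> X" unfolding \<rho>' using that by simp
    qed
    have "A \<in> F" "B \<in> F" "A' \<in> F" "B' \<in> F" using A B A' B' by (auto simp: minimiser_def)
    \<comment> \<open>The weight of \<open>v\<close> is the best value without \<open>v\<close>
      minus the best remainder with \<open>v\<close>. Both are determined by the other digits, hence
      equal for \<open>r\<close> and \<open>r'\<close>.\<close>
    moreover from this have "digit_weight b r v + \<rho> A = \<rho> B" "digit_weight b r' v + \<rho> A' = \<rho> B'"
      using minimiser_eq[OF A(1) B(1)] minimiser_eq[OF A'(1) B'(1)] A B A' B' in_v out_v by simp_all
    moreover have "\<rho> B \<le> \<rho> B'" "\<rho> B' \<le> \<rho> B"
      using B B' out_v calculation(1-4) unfolding minimiser_def by metis+
    moreover have "digit_weight b r v + \<rho> A \<le> digit_weight b r v + \<rho> A'"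
      "digit_weight b r' v + \<rho> A' \<le> digit_weight b r' v + \<rho> A"
      using A A' in_v calculation(1-4) unfolding minimiser_def by metis+
    ultimately have "digit_weight b r v = digit_weight b r' v" by simp
    then show "r = r'" by (rule drop_digit_eqD(2)[OF eq])
  qed
  moreover have "drop_digit b v ` ?bad \<subseteq> {..<2 ^ (b * (n - 1))}"
    using v drop_digit_less by auto
  ultimately have "card ?bad \<le> card {..<(2::nat) ^ (b * (n - 1))}"
    by (intro card_inj_on_le) auto
  then show ?thesis by simp
qed

text \<open>The isolation lemma of Mulmuley, Vazirani and Vazirani, stated by counting numbers whose
  digits are the weights. Two distinct minimisers differ in some vertex; the union bound over
  \<open>n\<close> vertices costs a factor \<open>n\<close>, and \<open>2 * n \<le> 2 ^ b\<close>
  leaves at most half of the numbers.\<close>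

theorem isolation:
  assumes F: "F \<subseteq> Pow {..<n}" "F \<noteq> {}" and b: "2 * n \<le> 2 ^ b"
  shows "2 * card {r. r < 2 ^ (b * n) \<and> \<not> (\<exists>!A. minimiser (digit_weight b r) F A)} \<le> 2 ^ (b * n)"
proof (cases "n = 0")
  case True
  then have "F = {{}}" using F by auto
  then have "\<exists>!A. minimiser (digit_weight b r) F A" for r by (auto simp: minimiser_def)
  then show ?thesis by simp
next
  case False
  let ?bad = "\<lambda>v. {r. r < 2 ^ (b * n) \<and> (\<exists>A B. minimiser (digit_weight b r) F A \<and>
     minimiser (digit_weight b r) F B \<and> v \<in> A \<and> v \<notin> B)}"
  have cover: "r \<in> (\<Union>v<n. ?bad v)" if r: "r < 2 ^ (b * n)" "\<not> (\<exists>!A. minimiser (digit_weight b r) F A)" for r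
  proof -
    have "Min (sum (digit_weight b r) ` F) \<in> sum (digit_weight b r) ` F"
      using F finite_subset[OF F(1)] by (intro Min_in) auto
    then obtain A where "A \<in> F" "sum (digit_weight b r) A = Min (sum (digit_weight b r) ` F)" by auto
    then have A: "minimiser (digit_weight b r) F A"
      using finite_subset[OF F(1)] by (auto simp: minimiser_def intro!: Min_le)
    then obtain B where B: "minimiser (digit_weight b r) F B" "B \<noteq> A" using r(2) by blast
    have "A \<subseteq> {..<n}" "B \<subseteq> {..<n}" using A B F(1) by (auto simp: minimiser_def)
    then obtain v where "v < n" "v \<in> A \<and> v \<notin> B \<or> v \<in> B \<and> v \<notin> A" using B(2) by blast
    then show ?thesis using A B(1) r(1) by blast
  qed
  have "card {r. r < 2 ^ (b * n) \<and> \<not> (\<exists>!A. minimiser (digit_weight b r) F A)} \<le> card (\<Union>v<n. ?bad v)"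
  proof (rule card_mono)
    show "{r. r < 2 ^ (b * n) \<and> \<not> (\<exists>!A. minimiser (digit_weight b r) F A)} \<subseteq> (\<Union>v<n. ?bad v)"
      by (rule subsetI, drule CollectD, elim conjE, rule cover)
  qed auto
  also have "\<dots> \<le> (\<Sum>v<n. card (?bad v))" by (rule card_UN_le) simp
  also have "\<dots> \<le> (\<Sum>v<n. 2 ^ (b * (n - 1)))"
    using F(1) by (intro sum_mono ambiguous_digit_card) auto
  finally have "2 * card {r. r < 2 ^ (b * n) \<and> \<not> (\<exists>!A. minimiser (digit_weight b r) F A)} \<le> (2 * n) * 2 ^ (b * (n - 1))"
    by simp
  also have "\<dots> \<le> 2 ^ b * 2 ^ (b * (n - 1))" using b by (intro mult_le_mono1)
  also have "\<dots> = 2 ^ (b * n)" using False by (cases n) (simp_all add: power_add)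
  finally show ?thesis .
qed

section \<open>The program\<close>

abbreviation "c1 \<equiv> Const 1"
abbreviation "c2 \<equiv> Const 2"
abbreviation "c3 \<equiv> Const 3"
abbreviation "c4 \<equiv> Const 4"
abbreviation "cK \<equiv> Cell (Const 2)"
abbreviation "base_bits \<equiv> Add (Mul c2 cN) c1"
abbreviation "height e \<equiv> Sub (cV 4) (cL e)"
abbreviation set_var :: "nat \<Rightarrow> expr \<Rightarrow> com" where
  "set_var j e \<equiv> Assign (vaddr j) e"

text \<open>Variables: 0, 1 the number of bits of a weight and its power of two; 2 the random number whose
  digits are the weights; 4 the maximal level; 5 the exponent \<open>M\<close> that marks a solution vertex; 6, 7
  the bound and the value of the enumeration counter; 12 the colour of the current vertex; 13 its
  contribution; 16 the generating function; 19 the answer. The others are loop counters and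
  temporaries. All but the results of a command are reset to 0 after use, so that the effect of
  a command is a function update and needs no frame condition.\<close>

definition com_range :: com where
  "com_range = Seq (set_var 1 c1) (For 10 cN
     (Cond (Sub (Mul c2 cN) (cV 1)) (Seq (set_var 1 (Mul c2 (cV 1))) (set_var 0 (Add (cV 0) c1))) Skip))"

text \<open>Coins are shifted in from the right, so the first coin becomes the most significant bit;
  \<open>uniform_prepend_bit\<close> matches this order.\<close>

definition com_random :: com where
  "com_random = For 10 (Mul (cV 0) cN)
     (Seq (Flip (vaddr 3)) (Seq (set_var 2 (Add (Mul c2 (cV 2)) (cV 3))) (set_var 3 (Const 0))))"

text \<open>Relaxation in the style of Bellman and Ford: the vertex numbers need not follow the
  forest order, but each round over all arcs settles at least one more level.\<close>

definition com_levels :: com where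
  "com_levels = For 10 cN (For 9 cN (For 15 cN
     (Cond (cT (cV 9) (cV 15)) (Assign (laddr (cV 15)) (Add (cL (cV 9)) c1)) Skip)))"

definition com_depth :: com where
  "com_depth = For 9 cN (Cond (Sub (cL (cV 9)) (cV 4)) (set_var 4 (cL (cV 9))) Skip)"

text \<open>With truncated subtraction, the tested product is nonzero for the colours 1 and 2
  only.\<close>

definition com_weight :: com where
  "com_weight = Cond (Mul (cV 12) (Sub c3 (cV 12)))
     (Seq (Two_pow 14 (Mul (cV 0) (cV 9)))
     (Seq (Two_pow 13 (Mul base_bits (Add (cV 5) (Rem (Quot (cV 2) (cV 14)) (cV 1)))))
        (set_var 14 (Const 0)))) Skip"

text \<open>The sum of the two truncated differences is the distance of the colours, so the inner
  product is nonzero exactly when both colours are nonzero and distinct. The outer test selects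
  neighbours of smaller level.\<close>

definition com_conflict :: com where
  "com_conflict = For 10 cN (Cond (Mul (cG (cV 10) (cV 9)) (Sub (cL (cV 9)) (cL (cV 10))))
     (Seq (Two_pow 14 (Mul c2 (height (cV 10))))
     (Seq (set_var 15 (Rem (Quot (cV 7) (cV 14)) c4))
     (Seq (Cond (Mul (Mul (cV 15) (cV 12)) (Add (Sub (cV 15) (cV 12)) (Sub (cV 12) (cV 15))))
        (set_var 13 (Const 0)) Skip)
     (Seq (set_var 15 (Const 0)) (set_var 14 (Const 0)))))) Skip)"

definition com_children :: com where
  "com_children = For 10 cN (Cond (cT (cV 9) (cV 10)) (set_var 13 (Mul (cV 13) (cF (cV 10)))) Skip)"

definition com_term :: com where
  "com_term = Seq (set_var 12 (Rem (Quot (cV 7) (cV 11)) c4))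
     (Seq (set_var 13 c1)
     (Seq com_weight
     (Seq com_conflict
     (Seq com_children
     (Seq (Assign (faddr (cV 9)) (Add (cF (cV 9)) (cV 13)))
     (Seq (set_var 13 (Const 0)) (set_var 12 (Const 0))))))))"

text \<open>With \<open>h\<close> the height of the vertex, \<open>t\<close> divisible by
  \<open>4 ^ (h + 1)\<close> marks new colours of the ancestors, and the accumulator restarts.
  \<open>Suc t\<close> divisible by \<open>4 ^ h\<close> means that all lower digits are 3, so the
  children hold complete sums and the term for the current colour is due.\<close>

definition com_process :: com where
  "com_process = Seq (Two_pow 11 (Mul c2 (cV 8)))
     (Seq (Cond (Rem (cV 7) (Mul c4 (cV 11))) Skip (Assign (faddr (cV 9)) (Const 0)))
     (Seq (Cond (Rem (Add (cV 7) c1) (cV 11)) Skip com_term)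
       (set_var 11 (Const 0))))"

text \<open>Within a round the vertices are processed by increasing height, so children are updated
  before their parent multiplies their accumulators. The test computes 1 minus the distance of two
  numbers, which is nonzero only for equality.\<close>

definition com_sweep :: com where
  "com_sweep = For 7 (cV 6) (For 8 (Add (cV 4) c1) (For 9 cN
     (Cond (Sub c1 (Add (Sub (height (cV 9)) (cV 8)) (Sub (cV 8) (height (cV 9))))) com_process Skip)))"

definition com_roots :: com where
  "com_roots = Seq (set_var 16 c1) (For 9 cN (Cond (cL (cV 9)) Skip (set_var 16 (Mul (cV 16) (cF (cV 9))))))"

text \<open>The minimum weight of a solution is unknown, so all weights below \<open>M\<close> are
  tried.\<close>

definition com_scan :: com where
  "com_scan = For 17 (cV 5) (Seq (Two_pow 18 (Mul base_bits (Add (Mul cK (cV 5)) (cV 17))))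
     (Seq (Cond (Rem (Quot (cV 16) (cV 18)) c4) (set_var 19 c1) Skip)
       (set_var 18 (Const 0))))"

definition com_count :: com where
  "com_count = Seq com_levels (Seq com_depth (Seq (set_var 5 (Add (Mul cN (cV 1)) c1))
     (Seq (Two_pow 6 (Mul c2 (Add (cV 4) c1))) (Seq com_sweep (Seq com_roots (Seq com_scan
       (Assign (Const 0) (cV 19))))))))"

text \<open>The sum encodes a disjunction: negative sign, size 0, or size above the number of
  vertices. None of these admits a solution, and the rest relies on their exclusion.\<close>

definition com_main :: com where
  "com_main = Cond (Add (Cell c1) (Add (Sub c1 cK) (Sub cK cN))) (Assign (Const 0) (Const 0))
     (Seq com_range (Seq com_random com_count))"

section \<open>Drawing the random weights\<close>

lemma uniform_prepend_bit:
  "bind_pmf (bernoulli_pmf (1 / 2)) (\<lambda>c. map_pmf (\<lambda>r. of_bool c * 2 ^ d + r) (pmf_of_set {..<(2::nat) ^ d}))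
     = pmf_of_set {..<2 ^ Suc d}"
proof -
  let ?f = "\<lambda>(c, r). of_bool c * 2 ^ d + r"
  have ne: "{..<(2::nat) ^ d} \<noteq> {}" by (simp add: lessThan_empty_iff)
  have inj: "inj_on ?f (UNIV \<times> {..<(2::nat) ^ d})"
    by (auto simp: inj_on_def split: if_splits elim!: bool.exhaust)
  have "?f ` (UNIV \<times> {..<(2::nat) ^ d}) = {..<2 ^ Suc d}"
  proof (intro equalityI subsetI)
    fix r :: nat assume "r \<in> {..<2 ^ Suc d}"
    then have "r = ?f (r \<ge> 2 ^ d, if r \<ge> 2 ^ d then r - 2 ^ d else r)"
      "(r \<ge> 2 ^ d, if r \<ge> 2 ^ d then r - 2 ^ d else r) \<in> UNIV \<times> {..<2 ^ d}" by auto
    then show "r \<in> ?f ` (UNIV \<times> {..<2 ^ d})" by (rule image_eqI)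
  qed (auto simp: of_bool_def)
  then have "pmf_of_set {..<(2::nat) ^ Suc d} = map_pmf ?f (pmf_of_set (UNIV \<times> {..<2 ^ d}))"
    using map_pmf_of_set_inj[OF inj] ne by simp
  also have "pmf_of_set (UNIV \<times> {..<(2::nat) ^ d}) = pair_pmf (bernoulli_pmf (1 / 2)) (pmf_of_set {..<2 ^ d})"
    using ne unfolding bernoulli_pmf_half_conv_pmf_of_set
    by (intro pmf_eqI) (auto simp: pmf_pair card_cartesian_product indicator_def pmf_of_set[OF ne finite_lessThan])
  finally show ?thesis
    by (simp add: pair_pmf_def map_bind_pmf map_pmf_def bind_assoc_pmf bind_return_pmf)
qed

context machine
begin

declare mem_0 [simp]

lemma mem_scalar: "j < 30 \<Longrightarrow> mem (s, l, f) (sbase + j) = s j"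
  by (simp add: mem_def)

lemma mem_scalar_2: "mem (s, l, f) (Suc (Suc sbase)) = s 2"
  using mem_scalar[of 2 s l f] by simp

lemma mem_1 [simp]: "mem S (Suc 0) = of_bool sg"
  using val_sg[of S] by simp

lemma mem_2 [simp]: "mem S 2 = k"
  using val_k[of S] by simp

text \<open>Doubling only below \<open>2 * n\<close> never reaches \<open>4 * n\<close>, and
  \<open>n\<close> rounds suffice because \<open>2 * n \<le> 2 ^ n\<close> for positive
  \<open>n\<close>.\<close>

lemma det_range:
  assumes s: "s 0 = 0" "s 1 = 0" "s 10 = 0" and K: "4 * n < 2 ^ K" "n < 2 ^ K"
  shows "\<exists>b. 2 * n \<le> 2 ^ b \<and> 2 ^ b < 4 * n \<and> b \<le> n \<and>
    det (n * 9 + 6) com_range (s, l, f) (s(0 := b, 1 := 2 ^ b), l, f)"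
proof -
  let ?e = "Sub (Mul c2 cN) (cV 1)" and ?u = "Seq (set_var 1 (Mul c2 (cV 1))) (set_var 0 (Add (cV 0) c1))"
  let ?c = "Cond ?e ?u Skip"
  define B where "B = rec_nat 0 (\<lambda>_ b. if 2 ^ b < 2 * n then Suc b else b)"
  have B: "B 0 = 0" "B (Suc j) = (if 2 ^ B j < 2 * n then Suc (B j) else B j)" for j
    by (simp_all add: B_def)
  have upper: "2 ^ B j < 4 * n \<and> B j \<le> j" for j
    using n_pos by (induction j) (auto simp: B)
  have "2 * n \<le> 2 ^ B j \<or> B j = j" for j
    by (induction j) (auto simp: B)
  moreover have "2 * m \<le> 2 ^ m" if "m > 0" for m :: nat
  proof (cases m)
    case (Suc m')
    have "m' < 2 ^ m'" by (rule less_exp)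
    then have "Suc m' \<le> 2 ^ m'" by (rule Suc_leI)
    then show ?thesis by (simp add: Suc del: mult_Suc_right)
  qed (use that in simp)
  ultimately have lower: "2 * n \<le> 2 ^ B n" using n_pos by metis
  have "det (n * (4 + 5) + 4) (For 10 cN ?c) (s(1 := 1), l, f) (s(0 := B n, 1 := 2 ^ B n), l, f)"
  proof (rule det_For[where m = n and S = "\<lambda>j. (s(0 := B j, 1 := 2 ^ B j), l, f)"])
    fix j assume j: "j < n"
    let ?s = "s(0 := B j, 1 := 2 ^ B j, 10 := j)"
    let ?s' = "s(0 := B (Suc j), 1 := 2 ^ B (Suc j), 10 := j)"
    have v: "val ?e (mem (?s, l, f)) = 2 * n - 2 ^ B j" by simp
    have "det (Suc (max (Suc 0 + Suc 0 + 1) 0)) ?c (?s, l, f) (?s', l, f)"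
    proof (rule det_Cond)
      assume "val ?e (mem (?s, l, f)) \<noteq> 0"
      then have less: "2 ^ B j < 2 * n" unfolding v by simp
      have "2 * 2 ^ B j < (2::nat) ^ K" "Suc (B j) < 2 ^ K"
        using less K upper[of j] j by linarith+
      then show "det (Suc 0 + Suc 0 + 1) ?u (?s, l, f) (?s', l, f)"
        using less by (intro det_Seq[where S' = "(?s(1 := 2 * 2 ^ B j), l, f)"] det_s) (auto simp: B fun_eq_iff)
    next
      assume "val ?e (mem (?s, l, f)) = 0"
      then have "\<not> 2 ^ B j < 2 * n" unfolding v by simp
      then show "det 0 Skip (?s, l, f) (?s', l, f)" by (intro det_Skip) (simp add: B)
    qed
    then show "det 4 ?c
      (upd 10 j (s(0 := B j, 1 := 2 ^ B j), l, f)) (upd 10 j (s(0 := B (Suc j), 1 := 2 ^ B (Suc j)), l, f))"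
      by (simp add: eval_nat_numeral)
  qed (use s K B in \<open>auto simp: fun_eq_iff\<close>)
  moreover have "det (Suc 0) (set_var 1 c1) (s, l, f) (s(1 := 1), l, f)"
    using one_less_power[of "2::nat" K] K_pos by (intro det_s) auto
  ultimately have "det (Suc 0 + (n * (4 + 5) + 4) + 1) com_range (s, l, f) (s(0 := B n, 1 := 2 ^ B n), l, f)"
    unfolding com_range_def by (rule det_Seq[rotated])
  then have "det (n * 9 + 6) com_range (s, l, f) (s(0 := B n, 1 := 2 ^ B n), l, f)"
    by (rule det_mono) simp
  then show ?thesis using lower upper[of n] by blast
qed

lemma exec_random:
  assumes s: "s 2 = 0" "s 3 = 0" "s 10 = 0" and m: "s 0 * n = m" "m < 2 ^ K" "m \<le> K"
    and ok: "ok (mem (s, l, f))" and L: "m \<le> L"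
  shows "exec ok (L * 10 + 4) com_random (mem (s, l, f))
    (map_pmf (\<lambda>r. mem (s(2 := r), l, f)) (pmf_of_set {..<2 ^ m}))"
proof -
  let ?flip = "Seq (Flip (vaddr 3)) (Seq (set_var 2 (Add (Mul c2 (cV 2)) (cV 3))) (set_var 3 (Const 0)))"
  let ?b = "Seq ?flip (set_var 10 (Add (cV 10) c1))"
  let ?loop = "Loop (Sub (Mul (cV 0) cN) (cV 10)) ?b"
  let ?S = "\<lambda>r j. (s(2 := r, 10 := j), l, f)"
  \<comment> \<open>After \<open>j\<close> coins variable 2 holds some \<open>r < 2 ^ j\<close>; the
    remaining coins append \<open>m - j\<close> uniform low bits.\<close>
  have loop: "exec ok ((m - j) * 10 + 2) ?loop (mem (?S r j))
      (map_pmf (\<lambda>r'. mem (?S (r * 2 ^ (m - j) + r') m)) (pmf_of_set {..<2 ^ (m - j)}))"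
    if "j \<le> m" "r < 2 ^ j" "ok (mem (?S r j))" for j r
    using that
  proof (induction "m - j" arbitrary: j r)
    case 0
    then have j: "j = m" by simp
    have "val (Sub (Mul (cV 0) cN) (cV 10)) (mem (?S r m)) = 0" using m by simp
    moreover have okm: "ok (mem (?S r m))" using 0(4) unfolding j .
    ultimately have "exec ok (0 + 2) ?loop (mem (?S r m)) (return_pmf (mem (?S r m)))"
      using exec_Skip[of ok, OF okm] by (intro exec_Loop[of ok, OF okm]) (simp only: if_False not_not refl simp_thms)
    then show ?case by (simp add: j lessThan_Suc map_return_pmf pmf_of_set_singleton del: fun_upd_apply)
  next
    case (Suc d)
    then have j: "j < m" "d = m - Suc j" by auto
    have K2: "2 ^ Suc j \<le> (2::nat) ^ K" using j(1) m(3) by (intro power_increasing) auto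
    have v: "val (Sub (Mul (cV 0) cN) (cV 10)) (mem (?S r j)) \<noteq> 0" using m j(1) by simp
    let ?R = "\<lambda>c. 2 * r + of_bool c"
    have bit: "?R c < 2 ^ Suc j" for c using Suc.prems(2) by auto
    have one: "(1::nat) < 2 ^ K" using one_less_power[of "2::nat" K] K_pos by simp
    have ok3: "ok (mem (s(2 := r, 10 := j, 3 := of_bool c), l, f))" for c
    proof -
      have "ok ((mem (?S r j))(sbase + 3 := of_bool c))"
        using one K_pos by (intro ok_upd[OF Suc.prems(3)]) (auto simp: mlen_def)
      then show ?thesis by (simp del: fun_upd_apply)
    qed
    have flip: "exec ok 1 (Flip (vaddr 3)) (mem (?S r j))
       (map_pmf (\<lambda>c. mem (s(2 := r, 10 := j, 3 := of_bool c), l, f)) (bernoulli_pmf (1 / 2)))"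
      using exec_Flip[of ok "mem (?S r j)" "vaddr 3", OF Suc.prems(3)] ok3
      by (simp del: fun_upd_apply)
    have d3: "det (Suc 0 + Suc 0 + 1) (Seq (set_var 2 (Add (Mul c2 (cV 2)) (cV 3))) (set_var 3 (Const 0)))
      (s(2 := r, 10 := j, 3 := of_bool c), l, f) (?S (?R c) j)" for c
      using bit[of c] K2 s
      by (intro det_Seq[where S' = "(s(2 := ?R c, 10 := j, 3 := of_bool c), l, f)"] det_s) (auto simp: fun_eq_iff)
    have jK: "Suc j < 2 ^ K" using j m(2) by linarith
    have inc: "det (Suc 0) (set_var 10 (Add (cV 10) c1)) (?S (?R c) j) (?S (?R c) (Suc j))" for c
      using jK by (intro det_s) (auto simp: fun_eq_iff)
    \<comment> \<open>Continuations in \<open>exec_Seq\<close> are functions of the memory, so the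
      coin is recovered from the cell of variable 3, and in later steps the number so far from that
      of variable 2.\<close>
    have flip2: "exec ok (1 + (Suc 0 + Suc 0 + 1) + 1) ?flip (mem (?S r j))
       (bind_pmf (map_pmf (\<lambda>c. mem (s(2 := r, 10 := j, 3 := of_bool c), l, f)) (bernoulli_pmf (1 / 2)))
         (\<lambda>m. return_pmf (mem (?S (?R (m (sbase + 3) = 1)) j))))"
    proof (rule exec_Seq[OF flip])
      fix m' assume "m' \<in> set_pmf (map_pmf (\<lambda>c. mem (s(2 := r, 10 := j, 3 := of_bool c), l, f)) (bernoulli_pmf (1 / 2)))"
      then obtain c where c: "m' = mem (s(2 := r, 10 := j, 3 := of_bool c), l, f)" by auto
      have "m' (sbase + 3) = of_bool c" by (simp add: c mem_def)
      then show "exec ok (Suc 0 + Suc 0 + 1) (Seq (set_var 2 (Add (Mul c2 (cV 2)) (cV 3))) (set_var 3 (Const 0))) m'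
        (return_pmf (mem (?S (?R (m' (sbase + 3) = 1)) j)))"
        using d3[of c] ok3[of c] by (cases c) (simp_all add: det_def c)
    qed
    have flip3: "exec ok 5 ?flip (mem (?S r j)) (map_pmf (\<lambda>c. mem (?S (?R c) j)) (bernoulli_pmf (1 / 2)))"
    proof -
      have "bind_pmf (map_pmf (\<lambda>c. mem (s(2 := r, 10 := j, 3 := of_bool c), l, f)) (bernoulli_pmf (1 / 2)))
         (\<lambda>m. return_pmf (mem (?S (?R (m (sbase + 3) = 1)) j)))
         = map_pmf (\<lambda>c. mem (?S (?R c) j)) (bernoulli_pmf (1 / 2))"
        by (simp add: bind_map_pmf map_pmf_def bind_assoc_pmf bind_return_pmf mem_scalar del: One_nat_def)
      moreover have "1 + (Suc 0 + Suc 0 + 1) + 1 = (5 :: nat)" by simp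
      ultimately show ?thesis using flip2 by (simp only:)
    qed
    have okR: "ok (mem (?S (?R c) j))" for c
      using exec_invariant[OF flip3] by simp
    have step: "exec ok (5 + 1 + 1) ?b (mem (?S r j))
       (bind_pmf (map_pmf (\<lambda>c. mem (?S (?R c) j)) (bernoulli_pmf (1 / 2)))
         (\<lambda>m. return_pmf (mem (?S (m (sbase + 2)) (Suc j)))))"
    proof (rule exec_Seq[OF flip3])
      fix m' assume "m' \<in> set_pmf (map_pmf (\<lambda>c. mem (?S (?R c) j)) (bernoulli_pmf (1 / 2)))"
      then obtain c where c: "m' = mem (?S (?R c) j)" by auto
      have "m' (sbase + 2) = ?R c" by (simp add: c mem_def)
      then show "exec ok 1 (set_var 10 (Add (cV 10) c1)) m' (return_pmf (mem (?S (m' (sbase + 2)) (Suc j))))"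
        using inc[of c] okR[of c] by (cases c) (simp_all add: det_def c)
    qed
    have step2: "exec ok 7 ?b (mem (?S r j)) (map_pmf (\<lambda>c. mem (?S (?R c) (Suc j))) (bernoulli_pmf (1 / 2)))"
    proof -
      have "bind_pmf (map_pmf (\<lambda>c. mem (?S (?R c) j)) (bernoulli_pmf (1 / 2)))
         (\<lambda>m. return_pmf (mem (?S (m (sbase + 2)) (Suc j))))
         = map_pmf (\<lambda>c. mem (?S (?R c) (Suc j))) (bernoulli_pmf (1 / 2))"
        by (simp add: bind_map_pmf map_pmf_def bind_assoc_pmf bind_return_pmf mem_scalar mem_scalar_2)
      moreover have "5 + 1 + 1 = (7 :: nat)" by simp
      ultimately show ?thesis using step by (simp only:)
    qed
    have okS: "ok (mem (?S (?R c) (Suc j)))" for c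
      using exec_invariant[OF step2] by simp
    let ?N = "(m - Suc j) * 10 + 2"
    let ?G = "\<lambda>q. map_pmf (\<lambda>r'. mem (?S (q * 2 ^ d + r') m)) (pmf_of_set {..<2 ^ d})"
    have A: "exec ok (7 + ?N + 1) (Seq ?b ?loop) (mem (?S r j))
       (bind_pmf (map_pmf (\<lambda>c. mem (?S (?R c) (Suc j))) (bernoulli_pmf (1 / 2))) (\<lambda>m. ?G (m (sbase + 2))))"
    proof (rule exec_Seq[OF step2])
      fix m' assume "m' \<in> set_pmf (map_pmf (\<lambda>c. mem (?S (?R c) (Suc j))) (bernoulli_pmf (1 / 2)))"
      then obtain c where c: "m' = mem (?S (?R c) (Suc j))" by auto
      have "m' (sbase + 2) = ?R c" by (simp add: c mem_def)
      then show "exec ok ?N ?loop m' (?G (m' (sbase + 2)))"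
        using Suc.hyps(1)[OF j(2) _ bit[of c] okS[of c]] j by (cases c) (simp_all add: c)
    qed
    have "bind_pmf (map_pmf (\<lambda>c. mem (?S (?R c) (Suc j))) (bernoulli_pmf (1 / 2))) (\<lambda>m. ?G (m (sbase + 2)))
      = bind_pmf (bernoulli_pmf (1 / 2)) (\<lambda>c. ?G (?R c))"
      by (simp add: bind_map_pmf mem_scalar mem_scalar_2)
    also have "\<dots> = map_pmf (\<lambda>r'. mem (?S (r * 2 ^ Suc d + r') m))
      (bind_pmf (bernoulli_pmf (1 / 2)) (\<lambda>c. map_pmf (\<lambda>r. of_bool c * 2 ^ d + r) (pmf_of_set {..<2 ^ d})))"
      by (simp add: map_bind_pmf pmf.map_comp o_def algebra_simps)
    also have "\<dots> = map_pmf (\<lambda>r'. mem (?S (r * 2 ^ Suc d + r') m)) (pmf_of_set {..<2 ^ Suc d})"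
      unfolding uniform_prepend_bit ..
    finally have B: "exec ok (7 + ?N + 1) (Seq ?b ?loop) (mem (?S r j))
       (map_pmf (\<lambda>r'. mem (?S (r * 2 ^ Suc d + r') m)) (pmf_of_set {..<2 ^ Suc d}))"
      using A by (simp only:)
    from B have "exec ok (7 + ?N + 1 + 2) ?loop (mem (?S r j))
       (map_pmf (\<lambda>r'. mem (?S (r * 2 ^ Suc d + r') m)) (pmf_of_set {..<2 ^ Suc d}))"
      using v by (intro exec_Loop Suc.prems(3)) (simp del: fun_upd_apply)
    moreover have "m - j = Suc d" using Suc.hyps(2) by simp
    moreover have "7 + ?N + 1 + 2 = (m - j) * 10 + 2" unfolding calculation(2) j(2)[symmetric] by simp
    ultimately show ?case by (simp del: fun_upd_apply)
  qed
  have "s(2 := 0, 10 := 0) = s" using s by (auto simp: fun_eq_iff)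
  with loop[of 0 0] ok have "exec ok (m * 10 + 2) ?loop (mem (s, l, f))
      (map_pmf (\<lambda>r. mem (?S r m)) (pmf_of_set {..<2 ^ m}))" by (simp del: fun_upd_apply)
  note loop0 = this
  have "exec ok (m * 10 + 2 + 1 + 1) com_random (mem (s, l, f))
    (bind_pmf (map_pmf (\<lambda>r. mem (?S r m)) (pmf_of_set {..<2 ^ m})) (\<lambda>m'. return_pmf (mem (s(2 := m' (sbase + 2)), l, f))))"
    unfolding com_random_def For_def
  proof (rule exec_Seq[OF loop0])
    fix m' assume m': "m' \<in> set_pmf (map_pmf (\<lambda>r. mem (?S r m)) (pmf_of_set {..<2 ^ m}))"
    then obtain r where r: "m' = mem (?S r m)" by auto
    have "ok m'" using exec_invariant[OF loop0] m' by blast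
    moreover have "det (Suc 0) (set_var 10 (Const 0)) (?S r m) (s(2 := r), l, f)"
      using s by (intro det_s) (auto simp: fun_eq_iff)
    moreover have "m' (sbase + 2) = r" by (simp add: r mem_def)
    ultimately show "exec ok 1 (set_var 10 (Const 0)) m' (return_pmf (mem (s(2 := m' (sbase + 2)), l, f)))"
      by (simp add: det_def r)
  qed
  moreover have "bind_pmf (map_pmf (\<lambda>r. mem (?S r m)) (pmf_of_set {..<2 ^ m})) (\<lambda>m'. return_pmf (mem (s(2 := m' (sbase + 2)), l, f)))
     = map_pmf (\<lambda>r. mem (s(2 := r), l, f)) (pmf_of_set {..<2 ^ m})"
    by (simp add: bind_map_pmf map_pmf_def bind_assoc_pmf bind_return_pmf mem_scalar mem_scalar_2)
  ultimately have "exec ok (m * 10 + 4) com_random (mem (s, l, f))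
     (map_pmf (\<lambda>r. mem (s(2 := r), l, f)) (pmf_of_set {..<2 ^ m}))" by (simp add: eval_nat_numeral)
  then show ?thesis by (rule exec_mono) (use L in simp)
qed

end

section \<open>Levels and the enumeration of colourings\<close>

lemma digits_above_Suc:
  assumes "Suc t mod 4 ^ Suc h \<noteq> 0"
  shows "Suc t div 4 ^ Suc h = t div 4 ^ Suc h"
  using assms by (simp add: div_Suc)

text \<open>No carry leaves digit \<open>h\<close>, so it grows precisely when a carry enters
  it.\<close>

lemma digit_Suc:
  assumes "Suc t mod 4 ^ Suc h \<noteq> 0"
  shows "Suc t div 4 ^ h mod 4 = t div 4 ^ h mod 4 + of_bool (Suc t mod 4 ^ h = 0)"
proof -
  let ?q = "Suc t div 4 ^ h" and ?p = "t div 4 ^ h :: nat"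
  have q: "?q = ?p + of_bool (Suc t mod 4 ^ h = 0)" by (simp add: div_Suc)
  have "Suc t div 4 ^ Suc h = ?q div 4" "t div 4 ^ Suc h = ?p div 4"
    by (simp_all add: div_mult2_eq[symmetric] mult.commute)
  then have "?q div 4 = ?p div 4" using digits_above_Suc[OF assms] by simp
  then show ?thesis using q by (metis add_diff_cancel_left' add_left_cancel div_mult_mod_eq add.assoc)
qed

lemma last_digits:
  assumes "Suc t mod 4 ^ Suc h = 0"
  shows "t div 4 ^ h mod 4 = 3" "Suc t mod 4 ^ h = 0"
proof -
  obtain q where q: "Suc t = 4 ^ Suc h * q" using assms by (auto simp: dvd_def mod_eq_0_iff_dvd)
  then obtain q' where q': "q = Suc q'" by (cases q) auto
  show z: "Suc t mod 4 ^ h = 0" unfolding q by simp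
  have "Suc t div 4 ^ h = 4 * q" unfolding q by simp
  then have "t div 4 ^ h = 4 * q' + 3" using z q' by (simp add: div_Suc)
  then show "t div 4 ^ h mod 4 = 3" by simp
qed

text \<open>In \<open>K_big\<close>, \<open>2 * n + 1\<close> is the digit length and
  \<open>4 * n * n + 1\<close> bounds the later \<open>M\<close>, so the product with
  \<open>n + 2\<close> bounds all exponents that occur. Two more bits per vertex allow for its four
  colours.\<close>

locale solver = machine n K k sg GG TT inp + elim n D GG TT lev
  for n K k sg GG TT inp D lev +
  assumes lev_outside: "v \<ge> n \<Longrightarrow> lev v = 0"
    and D_attained: "\<exists>v<n. lev v = D" and D_less: "D < n"
    and K_big: "(n + 1) * ((2 * n + 1) * ((n + 2) * (4 * n * n + 1)) + 2) < K"

text \<open>One outcome \<open>R\<close> of the coins is fixed, after which the program is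
  deterministic.\<close>

locale solver_run = solver +
  fixes b R :: nat
  assumes b: "2 * n \<le> 2 ^ b" "2 ^ b < 4 * n" "b \<le> n" and R_less: "R < 2 ^ (b * n)"
begin

definition M :: nat where "M = n * 2 ^ b + 1"

definition vw :: "nat \<Rightarrow> nat" where "vw v = 2 ^ ((2 * n + 1) * (M + digit_weight b R v))"

definition colour :: "nat \<Rightarrow> nat \<Rightarrow> nat" where "colour t v = t div 4 ^ (D - lev v) mod 4"

text \<open>The accumulator of \<open>v\<close> after \<open>t\<close> rounds covers the values of the digit of \<open>v\<close> that are completed
  within the current values of the higher digits.\<close>

definition acc_sum :: "nat \<Rightarrow> nat \<Rightarrow> nat" where
  "acc_sum t v = (case t of 0 \<Rightarrow> 0 | Suc t \<Rightarrow> if v < n then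
     \<Sum>s < colour t v + of_bool (Suc t mod 4 ^ (D - lev v) = 0). term_sum vw v ((colour t)(v := s)) else 0)"

text \<open>Dominates the exponents given to \<open>Two_pow\<close> and all loop bounds except that
  of the enumeration counter.\<close>

definition lam :: nat where "lam = (2 * n + 1) * ((n + 2) * (4 * n * n + 1))"

definition Y :: nat where "Y = 2 ^ (2 + lam)"

lemma digit_weight_less: "digit_weight b R v < 2 ^ b"
  by (simp add: digit_weight_def)

lemma M_le: "M \<le> 4 * n * n + 1"
  unfolding M_def using b(2) by simp

lemma M_ge: "2 ^ b \<le> M"
proof -
  have "1 * 2 ^ b \<le> n * 2 ^ b" using n_pos by (intro mult_le_mono1) simp
  then show ?thesis unfolding M_def by linarith
qed

lemma lam_ge: "(2 * n + 1) * ((n + 2) * M) \<le> lam"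
  unfolding lam_def by (intro mult_le_mono le_refl M_le)

lemma lam_less: "(n + 1) * (lam + 2) < K"
  using K_big by (simp add: lam_def)

lemma le_lam_less: "a \<le> lam \<Longrightarrow> a < K" "a \<le> lam \<Longrightarrow> a < 2 ^ K"
proof -
  assume "a \<le> lam"
  also have "lam \<le> (n + 1) * (lam + 2)" by simp
  finally show "a < K" using lam_less by simp
  then show "a < 2 ^ K" using less_exp[of K] by (rule less_trans)
qed

lemma K_facts: "0 < K" "(1::nat) < 2 ^ K"
  using le_lam_less[of 0] one_less_power[of "2::nat" K] by auto

lemma exponent_le: "(2 * n + 1) * (M + digit_weight b R v) \<le> lam"
proof -
  have "M + digit_weight b R v \<le> (n + 2) * M"
    using digit_weight_less[of v] M_ge by simp
  then show ?thesis using lam_ge by (meson le_trans mult_le_mono2)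
qed

lemma bounds:
  shows "n * n + 2 * n + 1 \<le> lam" "n \<le> lam" "M \<le> lam" "2 * (D + 1) \<le> lam" "D + 1 \<le> lam"
    "v < n \<Longrightarrow> b * v \<le> lam"
proof -
  have "(n + 1) * (n + 1) \<le> (2 * n + 1) * ((n + 2) * M)"
    unfolding M_def by (intro mult_le_mono) (auto intro: order_trans[of _ "(n+2)*1"])
  then show 1: "n * n + 2 * n + 1 \<le> lam" using lam_ge by simp
  show "n \<le> lam" using 1 by simp
  show "2 * (D + 1) \<le> lam" "D + 1 \<le> lam" using 1 D_less by simp_all
  have bn: "b * n \<le> n * n" using b(3) by (rule mult_le_mono1)
  show "b * v \<le> lam" if "v < n"
  proof -
    have "b * v \<le> b * n" using that by simp
    with bn 1 show ?thesis by linarith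
  qed
  have "1 * (1 * M) \<le> (2 * n + 1) * ((n + 2) * M)" by (intro mult_le_mono) auto
  then show "M \<le> lam" using lam_ge by simp
qed

lemma vw_le: "4 * vw v \<le> Y"
proof -
  have "vw v \<le> 2 ^ lam" unfolding vw_def by (intro power_increasing exponent_le) auto
  then show ?thesis by (simp add: Y_def power_add)
qed

lemma Y_ge: "4 \<le> Y"
proof -
  have "(2::nat) ^ 2 \<le> Y" unfolding Y_def by (intro power_increasing) auto
  then show ?thesis by simp
qed

lemma Y_pow_less: "i \<le> n \<Longrightarrow> Y ^ i < 2 ^ K"
proof -
  assume "i \<le> n"
  then have "(2 + lam) * i \<le> (2 + lam) * (n + 1)" by (intro mult_le_mono2) simp
  also have "\<dots> = (n + 1) * (lam + 2)" by (simp add: algebra_simps)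
  finally have "(2 + lam) * i \<le> (n + 1) * (lam + 2)" .
  then have "(2 + lam) * i < K" using lam_less by simp
  then show ?thesis unfolding Y_def power_mult[symmetric] by (intro power_strict_increasing) auto
qed

lemma Y_pow_mono: "i \<le> j \<Longrightarrow> Y ^ i \<le> Y ^ j"
  using Y_ge by (intro power_increasing) auto

lemmas vertex_sum_bound = vertex_sum_le[OF vw_le Y_ge]

lemma colour_less: "colour t v < 4"
  by (simp add: colour_def)

lemma acc_sum_0: "acc_sum 0 v = 0"
  by (simp add: acc_sum_def)

lemma acc_sum_outside: "v \<ge> n \<Longrightarrow> acc_sum t v = 0"
  by (simp add: acc_sum_def split: nat.splits)

lemma acc_sum_Suc: "v < n \<Longrightarrow> acc_sum (Suc t) v =
    (\<Sum>s < colour t v + of_bool (Suc t mod 4 ^ (D - lev v) = 0). term_sum vw v ((colour t)(v := s)))"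
  by (simp add: acc_sum_def)

lemma acc_sum_le: "acc_sum t v \<le> Y ^ subtree v"
proof (cases t)
  case (Suc t')
  show ?thesis
  proof (cases "v < n")
    case True
    have "acc_sum t v \<le> vertex_sum vw v (colour t')"
      unfolding Suc acc_sum_Suc[OF True] vertex_sum_def
      using colour_less[of t' v] by (intro sum_mono2) auto
    also have "\<dots> \<le> Y ^ subtree v" by (rule vertex_sum_bound)
    finally show ?thesis .
  qed (simp add: acc_sum_outside)
qed (simp add: acc_sum_0)

text \<open>The digit of \<open>v\<close> and all lower ones are 3, so the last of the four colours
  has just been completed. It is applied to the children when the term of their parent is
  due.\<close>

lemma acc_sum_full:
  assumes "v < n" "Suc t mod 4 ^ Suc (D - lev v) = 0"
  shows "acc_sum (Suc t) v = vertex_sum vw v (colour t)"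
proof -
  have "colour t v + of_bool (Suc t mod 4 ^ (D - lev v) = 0) = (4 :: nat)"
    using last_digits[OF assms(2)] by (simp add: colour_def)
  then show ?thesis unfolding acc_sum_Suc[OF assms(1)] by (simp add: vertex_sum_def)
qed

text \<open>The definition refers to the colours of the preceding round. Within a period only the
  digits up to that of \<open>v\<close> change, so the ancestors keep their colours and the sum may
  be read with the current ones.\<close>

lemma acc_sum_before:
  assumes v: "v < n" and "t mod 4 ^ Suc (D - lev v) \<noteq> 0"
  shows "acc_sum t v = (\<Sum>s < colour t v. term_sum vw v ((colour t)(v := s)))"
proof (cases t)
  case (Suc t')
  let ?h = "D - lev v"
  have t': "Suc t' mod 4 ^ Suc ?h \<noteq> 0" using assms(2) Suc by simp
  have c: "colour t v = colour t' v + of_bool (Suc t' mod 4 ^ ?h = 0)"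
    unfolding colour_def Suc by (rule digit_Suc[OF t'])
  have "colour t u = colour t' u" if u: "(u, v) \<in> TT\<^sup>+" for u
  proof -
    have "D - lev u > ?h" using lev_trancl[OF u] lev_D[OF v] by simp
    then obtain e where e: "D - lev u = Suc ?h + e" using less_imp_Suc_add by fastforce
    have "x div 4 ^ (D - lev u) = x div 4 ^ Suc ?h div 4 ^ e" for x :: nat
      unfolding e power_add by (rule div_mult2_eq)
    then show ?thesis unfolding colour_def Suc using digits_above_Suc[OF t'] by simp
  qed
  then have "term_sum vw v ((colour t')(v := s)) = term_sum vw v ((colour t)(v := s))" for s
    by (intro term_sum_cong) (auto simp: rtrancl_eq_or_trancl)
  then show ?thesis unfolding c unfolding Suc acc_sum_Suc[OF v] by simp
qed (use assms in simp)

text \<open>The recurrence carried out by \<open>com_process\<close>. On the right the children are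
  already in round \<open>Suc t\<close>, in accordance with the order of the sweep.\<close>

lemma acc_sum_step:
  assumes v: "v < n"
  shows "acc_sum (Suc t) v = (if t mod 4 ^ Suc (D - lev v) = 0 then 0 else acc_sum t v) +
    (if Suc t mod 4 ^ (D - lev v) = 0
     then vertex_weight vw v (colour t) * (\<Prod>c\<in>children v. acc_sum (Suc t) c) else 0)"
proof -
  let ?h = "D - lev v" and ?S = "\<lambda>q. \<Sum>s < q. term_sum vw v ((colour t)(v := s))"
  have "colour t v = 0" if "t mod 4 ^ Suc ?h = 0"
  proof -
    have "4 ^ Suc ?h dvd t" using that by auto
    then obtain q where "t = 4 ^ Suc ?h * q" by (auto simp: dvd_def)
    then have "t div 4 ^ ?h = 4 * q" by simp
    then show ?thesis by (simp add: colour_def)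
  qed
  then have before: "(if t mod 4 ^ Suc ?h = 0 then 0 else acc_sum t v) = ?S (colour t v)"
    using acc_sum_before[OF v, of t] by simp
  have "vertex_weight vw v (colour t) * (\<Prod>c\<in>children v. acc_sum (Suc t) c) = term_sum vw v (colour t)"
    if "Suc t mod 4 ^ ?h = 0"
  proof -
    have "acc_sum (Suc t) c = vertex_sum vw c (colour t)" if c: "c \<in> children v" for c
    proof (rule acc_sum_full)
      show "c < n" using c children_subset by auto
      have "Suc (D - lev c) = ?h"
        using c T_lev[of v c] lev_D[OF \<open>c < n\<close>] by (auto simp: children_def)
      then show "Suc t mod 4 ^ Suc (D - lev c) = 0" using \<open>Suc t mod 4 ^ ?h = 0\<close> by simp
    qed
    then show ?thesis by (simp add: term_sum_eq[of vw v])
  qed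
  moreover have "(colour t)(v := colour t v) = colour t" by simp
  ultimately show ?thesis unfolding before unfolding acc_sum_Suc[OF v] by simp
qed

text \<open>The product is built up child by child, so the products over subsets of the children
  have to fit into a cell as well.\<close>

lemma partial_term_less:
  assumes A: "A \<subseteq> children v" and v: "v < n" and f: "\<And>c. f c \<le> Y ^ subtree c"
  shows "vertex_weight vw v g * (\<Prod>c\<in>A. f c) < 2 ^ K"
proof -
  have "vertex_weight vw v g \<le> Y"
    using vw_le[of v] Y_ge by (auto simp: vertex_weight_def weight_def)
  moreover have "(\<Prod>c\<in>A. f c) \<le> (\<Prod>c\<in>A. Y ^ subtree c)" using f by (intro prod_mono) auto
  moreover have "(\<Prod>c\<in>A. Y ^ subtree c) \<le> Y ^ sum subtree (children v)"
    unfolding power_sum[symmetric] using A by (intro Y_pow_mono sum_mono2) auto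
  ultimately have "vertex_weight vw v g * (\<Prod>c\<in>A. f c) \<le> Y * Y ^ sum subtree (children v)"
    by (intro mult_mono) auto
  also have "\<dots> = Y ^ subtree v" by (simp add: subtree.simps[of v])
  also have "\<dots> < 2 ^ K" by (rule Y_pow_less[OF subtree_le[OF v]])
  finally show ?thesis .
qed

lemma acc_sum_less: "v < n \<Longrightarrow> acc_sum t v < 2 ^ K"
  using acc_sum_le[of t v] Y_pow_less[OF subtree_le, of v] by simp

section \<open>Computing levels and the maximal level\<close>

definition relax :: "nat \<Rightarrow> nat \<Rightarrow> (nat \<Rightarrow> nat) \<Rightarrow> nat \<Rightarrow> nat" where
  "relax v c l = (if (v, c) \<in> TT then l(c := l v + 1) else l)"

definition relax_round :: "nat \<Rightarrow> (nat \<Rightarrow> nat) \<Rightarrow> nat \<Rightarrow> nat" where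
  "relax_round j l = fold (\<lambda>v. fold (relax v) [0..<n]) [0..<j] l"

text \<open>Invariant within round \<open>r\<close>: entries never overshoot, levels up to
  \<open>r\<close> are final, and so are the children reached from level \<open>r\<close> by the
  arcs in \<open>S\<close>, those already visited in this round.\<close>

definition level_inv :: "nat \<Rightarrow> (nat \<times> nat) set \<Rightarrow> (nat \<Rightarrow> nat) \<Rightarrow> bool" where
  "level_inv r S l \<longleftrightarrow> (\<forall>v. l v \<le> lev v) \<and> (\<forall>v. lev v \<le> r \<longrightarrow> l v = lev v) \<and>
     (\<forall>v c. (v, c) \<in> S \<longrightarrow> (v, c) \<in> TT \<longrightarrow> lev v = r \<longrightarrow> l c = lev c)"

lemma level_inv_relax: "level_inv r S l \<Longrightarrow> level_inv r (insert (v, c) S) (relax v c l)"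
proof -
  assume inv: "level_inv r S l"
  show ?thesis
  proof (cases "(v, c) \<in> TT")
    case True
    have c: "lev c = Suc (lev v)" using T_lev[OF True] .
    have "l v \<le> lev v" "lev v \<le> r \<Longrightarrow> l v = lev v" using inv by (auto simp: level_inv_def)
    then show ?thesis using inv True c T_unique
      unfolding level_inv_def relax_def by auto
  qed (use inv in \<open>auto simp: level_inv_def relax_def\<close>)
qed

lemma level_inv_relax_fold:
  "level_inv r S l \<Longrightarrow> level_inv r (S \<union> {v} \<times> {..<j}) (fold (relax v) [0..<j] l)"
proof (induction j)
  case (Suc j)
  have "S \<union> {v} \<times> {..<Suc j} = insert (v, j) (S \<union> {v} \<times> {..<j})" by (auto simp: lessThan_Suc)
  then show ?case using level_inv_relax[OF Suc.IH[OF Suc.prems], of v j] by simp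
qed simp

lemma level_inv_round:
  "level_inv r {} l \<Longrightarrow> level_inv r ({..<j} \<times> {..<n}) (relax_round j l)"
proof (induction j)
  case (Suc j)
  have "{..<Suc j} \<times> {..<n} = {..<j} \<times> {..<n} \<union> {j} \<times> {..<n}" by (auto simp: lessThan_Suc)
  then show ?case using level_inv_relax_fold[OF Suc.IH[OF Suc.prems], of j n]
    by (simp add: relax_round_def)
qed (simp add: relax_round_def)

lemma level_inv_Suc: "level_inv r {} l \<Longrightarrow> level_inv (Suc r) {} (relax_round n l)"
proof -
  assume "level_inv r {} l"
  from level_inv_round[OF this, of n] have inv: "level_inv r ({..<n} \<times> {..<n}) (relax_round n l)" .
  have "relax_round n l c = lev c" if "lev c = Suc r" for c
  proof -
    have "c < n" using that lev_outside[of c] by (cases "c < n") auto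
    then obtain v where v: "(v, c) \<in> TT" using T_root[of c] \<open>lev c = Suc r\<close> by auto
    then show ?thesis using inv T_lev[OF v] T_dom[OF v] \<open>lev c = Suc r\<close> by (auto simp: level_inv_def)
  qed
  then show ?thesis using inv by (auto simp: level_inv_def le_Suc_eq)
qed

lemma level_inv_rounds: "level_inv j {} ((relax_round n ^^ j) (\<lambda>_. 0))"
proof (induction j)
  case 0
  show ?case by (auto simp: level_inv_def)
next
  case (Suc j)
  show ?case using level_inv_Suc[OF Suc] by simp
qed

lemma rounds_eq_lev: "(relax_round n ^^ n) (\<lambda>_. 0) = lev"
proof
  fix v
  have "lev v \<le> n" using lev_D[of v] D_less lev_outside[of v] by (cases "v < n") auto
  then show "(relax_round n ^^ n) (\<lambda>_. 0) v = lev v"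
    using level_inv_rounds[of n] by (simp add: level_inv_def)
qed

lemma lev_less: "Suc (lev v) \<le> n"
  using lev_D[of v] D_less lev_outside[of v] n_pos by (cases "v < n") auto

lemma det_levels:
  assumes s: "s 9 = 0" "s 10 = 0" "s 15 = 0"
  shows "det (n * (n * (n * 7 + 9) + 9) + 4) com_levels (s, (\<lambda>_. 0), f) (s, lev, f)"
proof -
  let ?l1 = "\<lambda>r. (relax_round n ^^ r) (\<lambda>_. 0)"
  let ?l2 = "\<lambda>r v. relax_round v (?l1 r)"
  let ?l3 = "\<lambda>r v c. fold (relax v) [0..<c] (?l2 r v)"
  have inv: "level_inv r ({..<v} \<times> {..<n} \<union> {v} \<times> {..<c}) (?l3 r v c)" for r v c
    using level_inv_relax_fold level_inv_round level_inv_rounds by blast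
  have nK: "n < 2 ^ K" using le_lam_less(2) bounds(2) .
  let ?B = "Cond (cT (cV 9) (cV 15)) (Assign (laddr (cV 15)) (Add (cL (cV 9)) c1)) Skip"
  have body: "det 2 ?B (s(10 := r, 9 := v, 15 := c), ?l3 r v c, f) (s(10 := r, 9 := v, 15 := c), ?l3 r v (Suc c), f)"
    if "v < n" "c < n" for r v c
  proof -
    have "?l3 r v c v \<le> lev v" using inv[of r v c] by (simp add: level_inv_def)
    then have less: "Suc (?l3 r v c v) < 2 ^ K" using lev_less[of v] nK by linarith
    have "det (Suc (max (Suc 0) 0)) ?B (s(10 := r, 9 := v, 15 := c), ?l3 r v c, f) (s(10 := r, 9 := v, 15 := c), ?l3 r v (Suc c), f)"
      using that less
      by (intro det_Cond det_l[where v = c and x = "Suc (?l3 r v c v)"] det_Skip) (auto simp: relax_def)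
    then show ?thesis by (simp add: numeral_2_eq_2)
  qed
  have 3: "det (n * (2 + 5) + 4) (For 15 cN ?B) (s(10 := r, 9 := v), ?l2 r v, f) (s(10 := r, 9 := v), ?l2 r (Suc v), f)"
    if "v < n" for r v
    by (rule det_For[where m = n and S = "\<lambda>c. (s(10 := r, 9 := v), ?l3 r v c, f)"])
      (use body[OF that] nK s in \<open>auto simp: fun_eq_iff relax_round_def\<close>)
  have 2: "det (n * ((n * (2 + 5) + 4) + 5) + 4) (For 9 cN (For 15 cN ?B)) (s(10 := r), ?l1 r, f) (s(10 := r), ?l1 (Suc r), f)"
    for r
    by (rule det_For[where m = n and S = "\<lambda>v. (s(10 := r), ?l2 r v, f)"])
      (use 3 nK s in \<open>auto simp: fun_eq_iff relax_round_def\<close>)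
  have "det (n * ((n * ((n * (2 + 5) + 4) + 5) + 4) + 5) + 4) com_levels (s, (\<lambda>_. 0), f) (s, lev, f)"
    unfolding com_levels_def
    by (rule det_For[where m = n and S = "\<lambda>r. (s, ?l1 r, f)"])
      (use 2 nK s rounds_eq_lev in \<open>auto simp: fun_eq_iff\<close>)
  then show ?thesis by (rule det_mono) simp
qed

lemma det_depth:
  assumes s: "s 4 = 0" "s 9 = 0"
  shows "det (n * 7 + 4) com_depth (s, lev, f) (s(4 := D), lev, f)"
proof -
  define d where "d = rec_nat 0 (\<lambda>v d. max d (lev v))"
  have d: "d 0 = 0" "d (Suc j) = max (d j) (lev j)" for j by (simp_all add: d_def)
  have le: "d j \<le> D" if "j \<le> n" for j
    using that by (induction j) (auto simp: d lev_D)
  have ge: "v < j \<Longrightarrow> lev v \<le> d j" for v j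
    by (induction j) (auto simp: d less_Suc_eq le_max_iff_disj)
  have dn: "d n = D" using le[of n] ge D_attained by (metis le_antisym order_refl)
  have nK: "n < 2 ^ K" using le_lam_less(2) bounds(2) .
  have "det (n * (2 + 5) + 4) com_depth (s, lev, f) (s(4 := D), lev, f)"
    unfolding com_depth_def
  proof (rule det_For[where m = n and S = "\<lambda>j. (s(4 := d j), lev, f)"])
    fix j assume j: "j < n"
    have "lev j < 2 ^ K" using lev_less[of j] nK by linarith
    then have "det (Suc (max (Suc 0) 0)) (Cond (Sub (cL (cV 9)) (cV 4)) (set_var 4 (cL (cV 9))) Skip)
       (s(4 := d j, 9 := j), lev, f) (s(4 := d (Suc j), 9 := j), lev, f)"
      by (intro det_Cond det_s det_Skip) (auto simp: d fun_eq_iff max_def)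
    then show "det 2 (Cond (Sub (cL (cV 9)) (cV 4)) (set_var 4 (cL (cV 9))) Skip)
      (upd 9 j (s(4 := d j), lev, f)) (upd 9 j (s(4 := d (Suc j)), lev, f))"
      by (simp add: numeral_2_eq_2)
  qed (use nK s dn in \<open>auto simp: fun_eq_iff d(1)\<close>)
  then show ?thesis by (rule det_mono) simp
qed

end

lemma (in machine) exec_det_Seq:
  assumes "det N1 c S S'" "ok (mem S)" "ok (mem S') \<Longrightarrow> exec ok N2 d (mem S') \<mu>"
  shows "exec ok (N1 + N2 + 1) (Seq c d) (mem S) \<mu>"
proof -
  have 1: "exec ok N1 c (mem S) (return_pmf (mem S'))" using assms(1,2) by (simp add: det_def)
  then have "ok (mem S')" using exec_invariant by fastforce
  with exec_Seq[OF 1, of N2 d "\<lambda>_. \<mu>"] assms(3) show ?thesis by (simp add: bind_return_pmf)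
qed

context solver_run
begin

section \<open>The commands of one enumeration round\<close>

lemma det_weight:
  assumes s: "s 0 = b" "s 1 = 2 ^ b" "s 2 = R" "s 5 = M" "s 9 = v" "s 12 < 4" "s 13 = 1" "s 14 = 0" "s 20 = 0"
    and v: "v < n"
  shows "det (lam * 12 + 16) com_weight (s, l, f) (s(13 := weight vw v (s 12)), l, f)"
proof -
  let ?t = "s(14 := 2 ^ (b * v))" and ?s' = "s(13 := weight vw v (s 12))"
  have c: "val (Mul (cV 12) (Sub c3 (cV 12))) (mem (s, l, f)) \<noteq> 0 \<longleftrightarrow> s 12 = 1 \<or> s 12 = 2"
    using s(6) by auto
  have "det (Suc (max ((lam * 6 + 6) + ((lam * 6 + 6) + Suc 0 + 1) + 1) 0)) com_weight (s, l, f) (?s', l, f)"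
    unfolding com_weight_def
  proof (rule det_Cond)
    assume "val (Mul (cV 12) (Sub c3 (cV 12))) (mem (s, l, f)) \<noteq> 0"
    then have w: "weight vw v (s 12) = 2 ^ ((2 * n + 1) * (M + digit_weight b R v))"
      unfolding c by (simp add: weight_def vw_def)
    show "det ((lam * 6 + 6) + ((lam * 6 + 6) + Suc 0 + 1) + 1) (Seq (Two_pow 14 (Mul (cV 0) (cV 9)))
     (Seq (Two_pow 13 (Mul base_bits (Add (cV 5) (Rem (Quot (cV 2) (cV 14)) (cV 1)))))
        (set_var 14 (Const 0)))) (s, l, f) (?s', l, f)"
    proof (rule det_Seq[OF _ det_Seq])
      show "det (lam * 6 + 6) (Two_pow 14 (Mul (cV 0) (cV 9))) (s, l, f) (?t, l, f)"
        using bounds(6)[OF v] le_lam_less(1) s by (intro det_Two_pow[where m = "b * v"]) auto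
      show "det (lam * 6 + 6) (Two_pow 13 (Mul base_bits (Add (cV 5) (Rem (Quot (cV 2) (cV 14)) (cV 1)))))
         (?t, l, f) (?t(13 := weight vw v (s 12)), l, f)"
        unfolding w using exponent_le[of v] le_lam_less(1)[OF exponent_le[of v]] s
        by (intro det_Two_pow[where m = "(2 * n + 1) * (M + digit_weight b R v)"]) (auto simp: digit_weight_def)
      show "det (Suc 0) (set_var 14 (Const 0)) (?t(13 := weight vw v (s 12)), l, f) (?s', l, f)"
        using s by (intro det_s) (auto simp: fun_eq_iff)
    qed
  next
    assume "val (Mul (cV 12) (Sub c3 (cV 12))) (mem (s, l, f)) = 0"
    then have "weight vw v (s 12) = 1" using c by (auto simp: weight_def)
    then show "det 0 Skip (s, l, f) (?s', l, f)" using s by (intro det_Skip) (auto simp: fun_eq_iff)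
  qed
  then show ?thesis by (rule det_mono) simp
qed

lemma det_conflict:
  assumes s: "s 4 = D" "s 7 = t" "s 9 = v" "s 10 = 0" "s 12 = colour t v" "s 14 = 0" "s 15 = 0" "s 20 = 0"
    and v: "v < n"
  shows "det (lam * (lam * 6 + 21) + 4) com_conflict (s, lev, f)
    (s(13 := if \<exists>u. (u, v) \<in> GG \<and> lev u < lev v \<and> conflict (colour t u) (colour t v) then 0 else s 13), lev, f)"
proof -
  define P where "P u \<longleftrightarrow> (u, v) \<in> GG \<and> lev u < lev v \<and> conflict (colour t u) (colour t v)" for u
  define a where "a j = (if \<exists>u<j. P u then 0 else s 13)" for j
  have a0: "a 0 = s 13" by (simp add: a_def)
  have an: "a n = (if \<exists>u. (u, v) \<in> GG \<and> lev u < lev v \<and> conflict (colour t u) (colour t v) then 0 else s 13)"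
    using G_dom unfolding a_def P_def by auto
  have aS: "a (Suc j) = (if P j then 0 else a j)" for j
    by (auto simp: a_def less_Suc_eq)
  let ?e = "Mul (cG (cV 10) (cV 9)) (Sub (cL (cV 9)) (cL (cV 10)))"
  let ?e2 = "Mul (Mul (cV 15) (cV 12)) (Add (Sub (cV 15) (cV 12)) (Sub (cV 12) (cV 15)))"
  let ?c = "Seq (Two_pow 14 (Mul c2 (height (cV 10))))
     (Seq (set_var 15 (Rem (Quot (cV 7) (cV 14)) c4))
     (Seq (Cond ?e2 (set_var 13 (Const 0)) Skip)
     (Seq (set_var 15 (Const 0)) (set_var 14 (Const 0)))))"
  have body: "det (lam * 6 + 16) (Cond ?e ?c Skip) (s(13 := a j, 10 := j), lev, f) (s(13 := a (Suc j), 10 := j), lev, f)"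
    if j: "j < n" for j
  proof -
    let ?s = "s(13 := a j, 10 := j)" and ?s' = "s(13 := a (Suc j), 10 := j)"
    let ?q = "2 ^ (2 * (D - lev j))"
    have e: "val ?e (mem (?s, lev, f)) \<noteq> 0 \<longleftrightarrow> (j, v) \<in> GG \<and> lev j < lev v" using j v s by auto
    have "det (Suc (max ((lam * 6 + 6) + (Suc 0 + (Suc (max (Suc 0) 0) + (Suc 0 + Suc 0 + 1) + 1) + 1) + 1) 0)) (Cond ?e ?c Skip) (?s, lev, f) (?s', lev, f)"
    proof (rule det_Cond)
      assume "val ?e (mem (?s, lev, f)) \<noteq> 0"
      then have jv: "(j, v) \<in> GG" "lev j < lev v" unfolding e by auto
      have Pj: "P j \<longleftrightarrow> conflict (colour t j) (colour t v)" using jv by (simp add: P_def)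
      have col: "t div ?q mod 4 = colour t j" by (simp add: colour_def power_mult)
      have four: "(4::nat) < 2 ^ K"
      proof -
        have "4 \<le> Y ^ 1" using Y_ge by simp
        then show ?thesis using Y_pow_less[of 1] n_pos by simp
      qed
      show "det ((lam * 6 + 6) + (Suc 0 + (Suc (max (Suc 0) 0) + (Suc 0 + Suc 0 + 1) + 1) + 1) + 1) ?c (?s, lev, f) (?s', lev, f)"
      proof (rule det_Seq[OF _ det_Seq[OF _ det_Seq[OF _ det_Seq]]])
        have "2 * (D - lev j) \<le> lam" using bounds(4) by simp
        then show "det (lam * 6 + 6) (Two_pow 14 (Mul c2 (height (cV 10)))) (?s, lev, f) (?s(14 := ?q), lev, f)"
          using le_lam_less(1) s by (intro det_Two_pow[where m = "2 * (D - lev j)"]) auto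
        show "det (Suc 0) (set_var 15 (Rem (Quot (cV 7) (cV 14)) c4)) (?s(14 := ?q), lev, f) (?s(14 := ?q, 15 := colour t j), lev, f)"
          using s col four colour_less[of t j] by (intro det_s) auto
        have c: "val ?e2 (mem (?s(14 := ?q, 15 := colour t j), lev, f)) \<noteq> 0 \<longleftrightarrow> conflict (colour t j) (colour t v)"
          using s by (auto simp: conflict_def)
        show "det (Suc (max (Suc 0) 0)) (Cond ?e2 (set_var 13 (Const 0)) Skip)
           (?s(14 := ?q, 15 := colour t j), lev, f) (?s'(14 := ?q, 15 := colour t j), lev, f)"
          using c by (intro det_Cond det_s det_Skip) (auto simp: aS Pj fun_eq_iff)
        show "det (Suc 0) (set_var 15 (Const 0)) (?s'(14 := ?q, 15 := colour t j), lev, f) (?s'(14 := ?q), lev, f)"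
          using s by (intro det_s) (auto simp: fun_eq_iff)
        show "det (Suc 0) (set_var 14 (Const 0)) (?s'(14 := ?q), lev, f) (?s', lev, f)"
          using s by (intro det_s) (auto simp: fun_eq_iff)
      qed
    next
      assume "val ?e (mem (?s, lev, f)) = 0"
      then have "\<not> P j" using e by (auto simp: P_def)
      then show "det 0 Skip (?s, lev, f) (?s', lev, f)" by (intro det_Skip) (simp add: aS)
    qed
    then show ?thesis by (rule det_mono) simp
  qed
  have "det (lam * ((lam * 6 + 16) + 5) + 4) com_conflict (s, lev, f) (s(13 := a n), lev, f)"
    unfolding com_conflict_def
    by (rule det_For[where m = n and S = "\<lambda>j. (s(13 := a j), lev, f)"])
      (use body s bounds(2) le_lam_less(2) in \<open>auto simp: fun_eq_iff a0\<close>)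
  then show ?thesis unfolding an by (rule det_mono) simp
qed

lemma det_children:
  assumes s: "s 9 = v" "s 10 = 0" and v: "v < n"
    and less: "\<And>A. A \<subseteq> children v \<Longrightarrow> s 13 * (\<Prod>c\<in>A. f c) < 2 ^ K"
  shows "det (lam * 7 + 4) com_children (s, l, f) (s(13 := s 13 * (\<Prod>c\<in>children v. f c)), l, f)"
proof -
  define a where "a j = s 13 * (\<Prod>c\<in>children v \<inter> {..<j}. f c)" for j
  have aS: "a (Suc j) = (if (v, j) \<in> TT then a j * f j else a j)" for j
    by (auto simp: a_def lessThan_Suc Int_insert_right children_def[of v] mult_ac)
  have an: "a n = s 13 * (\<Prod>c\<in>children v. f c)"
    using children_subset[of v] unfolding a_def by (simp add: Int_absorb2)
  have "det (lam * (2 + 5) + 4) com_children (s, l, f) (s(13 := a n), l, f)"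
    unfolding com_children_def
  proof (rule det_For[where m = n and S = "\<lambda>j. (s(13 := a j), l, f)"])
    fix j assume j: "j < n"
    have "a (Suc j) < 2 ^ K" unfolding a_def by (rule less) auto
    then have "det (Suc (max (Suc 0) 0)) (Cond (cT (cV 9) (cV 10)) (set_var 13 (Mul (cV 13) (cF (cV 10)))) Skip)
       (s(13 := a j, 10 := j), l, f) (s(13 := a (Suc j), 10 := j), l, f)"
      using s v j by (intro det_Cond det_s det_Skip) (auto simp: aS fun_eq_iff)
    then show "det 2 (Cond (cT (cV 9) (cV 10)) (set_var 13 (Mul (cV 13) (cF (cV 10)))) Skip)
      (upd 10 j (s(13 := a j), l, f)) (upd 10 j (s(13 := a (Suc j)), l, f))"
      by (simp add: numeral_2_eq_2)
  qed (use s bounds(2) le_lam_less(2) in \<open>auto simp: fun_eq_iff a_def\<close>)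
  then show ?thesis unfolding an by (rule det_mono) simp
qed

lemma small_less: "a \<le> 4 \<Longrightarrow> a < 2 ^ K" for a :: nat
proof -
  assume "a \<le> 4"
  also have "4 \<le> Y ^ 1" using Y_ge by simp
  also have "\<dots> < 2 ^ K" using n_pos by (intro Y_pow_less) simp
  finally show ?thesis .
qed

lemma det_term:
  assumes s: "s 0 = b" "s 1 = 2 ^ b" "s 2 = R" "s 4 = D" "s 5 = M" "s 7 = t" "s 9 = v" "s 10 = 0"
      "s 11 = 4 ^ (D - lev v)" "s 12 = 0" "s 13 = 0" "s 14 = 0" "s 15 = 0" "s 20 = 0"
    and v: "v < n" and f: "\<And>c. f c \<le> Y ^ subtree c"
    and y: "y = f v + vertex_weight vw v (colour t) * (\<Prod>c\<in>children v. f c)" "y < 2 ^ K"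
  shows "det (lam * (lam * 6 + 40) + 36) com_term (s, lev, f) (s, lev, f(v := y))"
proof -
  let ?s1 = "s(12 := colour t v)"
  let ?w = "weight vw v (colour t v)" and ?vw = "vertex_weight vw v (colour t)"
  let ?p = "?vw * (\<Prod>c\<in>children v. f c)"
  have vwt: "?vw = (if \<exists>u. (u, v) \<in> GG \<and> lev u < lev v \<and> conflict (colour t u) (colour t v) then 0 else ?w)"
    by (simp add: vertex_weight_def)
  have "det (Suc 0 + (Suc 0 + ((lam * 12 + 16) + ((lam * (lam * 6 + 21) + 4) + ((lam * 7 + 4) + (Suc 0 + (Suc 0 + Suc 0 + 1) + 1) + 1) + 1) + 1) + 1) + 1)
    com_term (s, lev, f) (s, lev, f(v := y))"
    unfolding com_term_def
  proof (rule det_Seq[OF _ det_Seq[OF _ det_Seq[OF _ det_Seq[OF _ det_Seq[OF _ det_Seq[OF _ det_Seq]]]]]])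
    show "det (Suc 0) (set_var 12 (Rem (Quot (cV 7) (cV 11)) c4)) (s, lev, f) (?s1, lev, f)"
      using s colour_less[of t v] small_less[of "colour t v"] by (intro det_s) (auto simp: colour_def)
    show "det (Suc 0) (set_var 13 c1) (?s1, lev, f) (?s1(13 := 1), lev, f)"
      using K_facts by (intro det_s) auto
    have "?s1(13 := 1, 13 := weight vw v ((?s1(13 := 1)) 12)) = ?s1(13 := ?w)" by simp
    then show "det (lam * 12 + 16) com_weight (?s1(13 := 1), lev, f) (?s1(13 := ?w), lev, f)"
      using det_weight[of "?s1(13 := 1)" v lev f] s v colour_less[of t v] by simp
    show "det (lam * (lam * 6 + 21) + 4) com_conflict (?s1(13 := ?w), lev, f) (?s1(13 := ?vw), lev, f)"
      unfolding vwt using det_conflict[of "?s1(13 := ?w)" t v f] s v by (simp cong: if_cong)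
    show "det (lam * 7 + 4) com_children (?s1(13 := ?vw), lev, f) (?s1(13 := ?p), lev, f)"
      using det_children[of "?s1(13 := ?vw)" v f lev] partial_term_less[OF _ v f] s v by simp
    show "det (Suc 0) (Assign (faddr (cV 9)) (Add (cF (cV 9)) (cV 13))) (?s1(13 := ?p), lev, f) (?s1(13 := ?p), lev, f(v := y))"
      using s v y by (intro det_f[where v = v]) auto
    show "det (Suc 0) (set_var 13 (Const 0)) (?s1(13 := ?p), lev, f(v := y)) (?s1, lev, f(v := y))"
      using s by (intro det_s) (auto simp: fun_eq_iff)
    show "det (Suc 0) (set_var 12 (Const 0)) (?s1, lev, f(v := y)) (s, lev, f(v := y))"
      using s by (intro det_s) (auto simp: fun_eq_iff)
  qed
  then show ?thesis by (rule det_mono) (simp add: algebra_simps)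
qed

text \<open>\<open>v\<close> still shows round \<open>t\<close> while its children show round
  \<open>Suc t\<close>. Resetting \<open>v\<close> does not disturb the product, as \<open>v\<close>
  is not its own child.\<close>

lemma det_process:
  assumes s: "s 0 = b" "s 1 = 2 ^ b" "s 2 = R" "s 4 = D" "s 5 = M" "s 7 = t" "s 8 = D - lev v" "s 9 = v" "s 10 = 0"
      "s 11 = 0" "s 12 = 0" "s 13 = 0" "s 14 = 0" "s 15 = 0" "s 20 = 0"
    and v: "v < n" and f: "\<And>c. f c \<le> Y ^ subtree c"
    and fv: "f v = acc_sum t v" and fc: "\<And>c. c \<in> children v \<Longrightarrow> f c = acc_sum (Suc t) c"
    and t: "t < 4 ^ (D + 1)"
  shows "det (lam * (lam * 6 + 46) + 50) com_process (s, lev, f) (s, lev, f(v := acc_sum (Suc t) v))"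
proof -
  let ?h = "D - lev v"
  let ?s1 = "s(11 := 4 ^ ?h)"
  define y where "y = (if t mod 4 ^ Suc ?h = 0 then 0 else f v)"
  have y_le: "y \<le> Y ^ subtree v" using f[of v] by (simp add: y_def)
  have v_children: "v \<notin> children v" using T_lev[of v v] by (auto simp: children_def)
  have prod: "(\<Prod>c\<in>children v. (f(v := y)) c) = (\<Prod>c\<in>children v. acc_sum (Suc t) c)"
    using v_children fc by (intro prod.cong) auto
  have step: "acc_sum (Suc t) v = y + (if Suc t mod 4 ^ ?h = 0
     then vertex_weight vw v (colour t) * (\<Prod>c\<in>children v. (f(v := y)) c) else 0)"
    unfolding prod unfolding y_def fv by (rule acc_sum_step[OF v])
  have "det ((lam * 6 + 6) + (Suc (max 0 (Suc 0)) + (Suc (max 0 (lam * (lam * 6 + 40) + 36)) + Suc 0 + 1) + 1) + 1)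
    com_process (s, lev, f) (s, lev, f(v := acc_sum (Suc t) v))"
    unfolding com_process_def
  proof (rule det_Seq[OF _ det_Seq[OF _ det_Seq]])
    have "2 * ?h \<le> lam" using bounds(4) by simp
    moreover have "2 ^ (2 * ?h) = (4::nat) ^ ?h" by (simp add: power_mult)
    ultimately show "det (lam * 6 + 6) (Two_pow 11 (Mul c2 (cV 8))) (s, lev, f) (?s1, lev, f)"
      using s le_lam_less(1)[of "2 * ?h"] by (intro det_Two_pow[where m = "2 * ?h"]) auto
    show "det (Suc (max 0 (Suc 0))) (Cond (Rem (cV 7) (Mul c4 (cV 11))) Skip (Assign (faddr (cV 9)) (Const 0)))
       (?s1, lev, f) (?s1, lev, f(v := y))"
      using s v by (intro det_Cond det_Skip det_f[where v = v]) (auto simp: y_def)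
    show "det (Suc (max 0 (lam * (lam * 6 + 40) + 36))) (Cond (Rem (Add (cV 7) c1) (cV 11)) Skip com_term)
       (?s1, lev, f(v := y)) (?s1, lev, f(v := acc_sum (Suc t) v))"
    proof (rule det_Cond)
      assume "val (Rem (Add (cV 7) c1) (cV 11)) (mem (?s1, lev, f(v := y))) \<noteq> 0"
      then have "Suc t mod 4 ^ ?h \<noteq> 0" using s by simp
      then have "acc_sum (Suc t) v = y" using step by simp
      then show "det 0 Skip (?s1, lev, f(v := y)) (?s1, lev, f(v := acc_sum (Suc t) v))"
        by (intro det_Skip) simp
    next
      assume "val (Rem (Add (cV 7) c1) (cV 11)) (mem (?s1, lev, f(v := y))) = 0"
      then have z: "Suc t mod 4 ^ ?h = 0" using s by simp
      have eq: "acc_sum (Suc t) v = (f(v := y)) v + vertex_weight vw v (colour t) * (\<Prod>c\<in>children v. (f(v := y)) c)"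
        using step z by simp
      have le: "(f(v := y)) c \<le> Y ^ subtree c" for c using f[of c] y_le by simp
      have "f(v := acc_sum (Suc t) v) = (f(v := y))(v := acc_sum (Suc t) v)" by simp
      then show "det (lam * (lam * 6 + 40) + 36) com_term (?s1, lev, f(v := y)) (?s1, lev, f(v := acc_sum (Suc t) v))"
        using s v le eq acc_sum_less[OF v, of "Suc t"]
        by (simp only:) (rule det_term[where t = t], simp_all)
    qed
    show "det (Suc 0) (set_var 11 (Const 0)) (?s1, lev, f(v := acc_sum (Suc t) v)) (s, lev, f(v := acc_sum (Suc t) v))"
      using s by (intro det_s) (auto simp: fun_eq_iff)
  qed
  then show ?thesis by (rule det_mono) (simp add: algebra_simps)
qed

text \<open>The accumulators in the middle of a round: heights below \<open>j\<close> are done, and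
  at height \<open>j\<close> the vertices below \<open>v\<close>.\<close>

definition mixed :: "nat \<Rightarrow> nat \<Rightarrow> nat \<Rightarrow> nat \<Rightarrow> nat" where
  "mixed t j v w = (if D - lev w < j \<or> D - lev w = j \<and> w < v then acc_sum (Suc t) w else acc_sum t w)"

lemma mixed_le: "mixed t j v w \<le> Y ^ subtree w"
  by (simp add: mixed_def acc_sum_le)

lemma mixed_n: "mixed t j n = mixed t (Suc j) 0"
proof
  fix w show "mixed t j n w = mixed t (Suc j) 0 w"
    by (cases "w < n") (auto simp: mixed_def acc_sum_outside)
qed

lemma mixed_0: "mixed t 0 0 = acc_sum t"
  by (simp add: mixed_def fun_eq_iff)

lemma mixed_D: "mixed t (D + 1) 0 = acc_sum (Suc t)"
  by (auto simp: mixed_def fun_eq_iff)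

lemma mixed_step: "D - lev v = j \<Longrightarrow> mixed t j (Suc v) = (mixed t j v)(v := acc_sum (Suc t) v)"
  "D - lev v \<noteq> j \<Longrightarrow> mixed t j (Suc v) = mixed t j v"
  by (auto simp: mixed_def fun_eq_iff less_Suc_eq)

lemma four_pow_less: "4 ^ (D + 1) < (2::nat) ^ K"
proof -
  have "(4::nat) ^ (D + 1) = 2 ^ (2 * (D + 1))" by (simp add: power_mult)
  also have "\<dots> < 2 ^ K" using le_lam_less(1)[OF bounds(4)] by (intro power_strict_increasing) auto
  finally show ?thesis .
qed

text \<open>Inner loops are estimated by \<open>lam\<close>, which leaves the counter as the only
  exponential factor.\<close>

lemma det_sweep:
  assumes s: "s 0 = b" "s 1 = 2 ^ b" "s 2 = R" "s 4 = D" "s 5 = M" "s 6 = 4 ^ (D + 1)" "s 7 = 0" "s 8 = 0" "s 9 = 0"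
      "s 10 = 0" "s 11 = 0" "s 12 = 0" "s 13 = 0" "s 14 = 0" "s 15 = 0" "s 20 = 0"
  shows "det (4 ^ (D + 1) * (lam * (lam * (lam * (lam * 6 + 46) + 56) + 9) + 9) + 4) com_sweep
    (s, lev, acc_sum 0) (s, lev, acc_sum (4 ^ (D + 1)))"
proof -
  let ?e = "Sub c1 (Add (Sub (height (cV 9)) (cV 8)) (Sub (cV 8) (height (cV 9))))"
  let ?B = "Cond ?e com_process Skip"
  have nK: "n < 2 ^ K" using le_lam_less(2) bounds(2) .
  have DK: "D + 1 < 2 ^ K" using le_lam_less(2) bounds(5) .
  have body: "det (lam * (lam * 6 + 46) + 51) ?B (s(7 := t, 8 := j, 9 := v), lev, mixed t j v)
      (s(7 := t, 8 := j, 9 := v), lev, mixed t j (Suc v))" if v: "v < n" and t: "t < 4 ^ (D + 1)" for t j v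
  proof -
    let ?s = "s(7 := t, 8 := j, 9 := v)"
    have e: "val ?e (mem (?s, lev, mixed t j v)) \<noteq> 0 \<longleftrightarrow> D - lev v = j" using s by auto
    have "det (Suc (max (lam * (lam * 6 + 46) + 50) 0)) ?B (?s, lev, mixed t j v) (?s, lev, mixed t j (Suc v))"
    proof (rule det_Cond)
      assume "val ?e (mem (?s, lev, mixed t j v)) \<noteq> 0"
      then have j: "D - lev v = j" unfolding e .
      have fv: "mixed t j v v = acc_sum t v" using j by (simp add: mixed_def)
      have fc: "mixed t j v c = acc_sum (Suc t) c" if "c \<in> children v" for c
        using child_descent[OF that] j by (simp add: mixed_def)
      show "det (lam * (lam * 6 + 46) + 50) com_process (?s, lev, mixed t j v) (?s, lev, mixed t j (Suc v))"
        unfolding mixed_step(1)[OF j]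
        by (rule det_process[where t = t]) (use s j v t mixed_le fv fc in simp_all)
    next
      assume "val ?e (mem (?s, lev, mixed t j v)) = 0"
      then have "D - lev v \<noteq> j" using e by blast
      then show "det 0 Skip (?s, lev, mixed t j v) (?s, lev, mixed t j (Suc v))"
        by (intro det_Skip) (simp add: mixed_step(2))
    qed
    then show ?thesis by (rule det_mono) simp
  qed
  have 3: "det (lam * ((lam * (lam * 6 + 46) + 51) + 5) + 4) (For 9 cN ?B)
     (s(7 := t, 8 := j), lev, mixed t j 0) (s(7 := t, 8 := j), lev, mixed t (Suc j) 0)" if "t < 4 ^ (D + 1)" for t j
    unfolding mixed_n[symmetric]
    by (rule det_For[where m = n and S = "\<lambda>v. (s(7 := t, 8 := j), lev, mixed t j v)"])
      (use body[OF _ that] nK s bounds(2) in \<open>auto simp: fun_eq_iff\<close>)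
  have 2: "det (lam * ((lam * ((lam * (lam * 6 + 46) + 51) + 5) + 4) + 5) + 4) (For 8 (Add (cV 4) c1) (For 9 cN ?B))
     (s(7 := t), lev, acc_sum t) (s(7 := t), lev, acc_sum (Suc t))" if "t < 4 ^ (D + 1)" for t
    unfolding mixed_D[symmetric] mixed_0[of t, symmetric]
    by (rule det_For[where m = "D + 1" and S = "\<lambda>j. (s(7 := t), lev, mixed t j 0)"])
      (use 3[OF that] DK s bounds(5) in \<open>auto simp: fun_eq_iff\<close>)
  have "det (4 ^ (D + 1) * ((lam * ((lam * ((lam * (lam * 6 + 46) + 51) + 5) + 4) + 5) + 4) + 5) + 4) com_sweep
    (s, lev, acc_sum 0) (s, lev, acc_sum (4 ^ (D + 1)))"
    unfolding com_sweep_def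
    by (rule det_For[where m = "4 ^ (D + 1)" and S = "\<lambda>t. (s, lev, acc_sum t)"])
      (use 2 s four_pow_less in \<open>auto simp: fun_eq_iff\<close>)
  then show ?thesis by (rule det_mono) simp
qed

section \<open>The value of the generating function and its digits\<close>

definition total :: nat where
  "total = (\<Prod>r | r < n \<and> lev r = 0. vertex_sum vw r (\<lambda>_. 0))"

lemma acc_sum_root:
  assumes "r < n" "lev r = 0"
  shows "acc_sum (4 ^ (D + 1)) r = vertex_sum vw r (\<lambda>_. 0)"
proof -
  obtain t where t: "4 ^ (D + 1) = Suc t" using gr0_implies_Suc[of "4 ^ (D + 1)"] by auto
  \<comment> \<open>Roots own the most significant digit, number \<open>D\<close>, so they complete
    exactly one period in the whole enumeration.\<close>
  have "Suc t mod 4 ^ Suc (D - lev r) = 0" using t[symmetric] assms(2) by simp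
  from acc_sum_full[OF assms(1) this] have "acc_sum (4 ^ (D + 1)) r = vertex_sum vw r (colour t)"
    by (simp only: t)
  also have "\<dots> = vertex_sum vw r (\<lambda>_. 0)"
    using assms(2) by (intro vertex_sum_cong) (auto dest: lev_trancl)
  finally show ?thesis .
qed

lemma det_roots:
  assumes s: "s 9 = 0"
  shows "det (lam * 7 + 6) com_roots (s, lev, acc_sum (4 ^ (D + 1))) (s(16 := total), lev, acc_sum (4 ^ (D + 1)))"
proof -
  let ?f = "acc_sum (4 ^ (D + 1))"
  define a where "a j = (\<Prod>r | r < j \<and> lev r = 0. ?f r)" for j
  have a0: "a 0 = 1" by (simp add: a_def)
  have an: "a n = total" unfolding a_def total_def using acc_sum_root by (intro prod.cong) auto
  have aS: "a (Suc j) = (if lev j = 0 then a j * ?f j else a j)" for j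
  proof -
    have "{r. r < Suc j \<and> lev r = 0} = (if lev j = 0 then insert j {r. r < j \<and> lev r = 0} else {r. r < j \<and> lev r = 0})"
      by (auto simp: less_Suc_eq)
    then show ?thesis by (simp add: a_def mult_ac)
  qed
  have less: "a j < 2 ^ K" if "j \<le> n" for j
  proof -
    have "a j \<le> (\<Prod>r | r < j \<and> lev r = 0. Y ^ subtree r)"
      unfolding a_def using acc_sum_le by (intro prod_mono) auto
    also have "\<dots> = Y ^ (\<Sum>r | r < j \<and> lev r = 0. subtree r)" by (simp add: power_sum)
    also have "\<dots> < 2 ^ K"
      using that by (intro Y_pow_less sum_subtree_le[where j = 0]) auto
    finally show ?thesis .
  qed
  have "det (Suc 0 + (lam * (2 + 5) + 4) + 1) com_roots (s, lev, ?f) (s(16 := a n), lev, ?f)"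
    unfolding com_roots_def
  proof (rule det_Seq)
    show "det (Suc 0) (set_var 16 c1) (s, lev, ?f) (s(16 := 1), lev, ?f)"
      using K_facts by (intro det_s) auto
    show "det (lam * (2 + 5) + 4) (For 9 cN (Cond (cL (cV 9)) Skip (set_var 16 (Mul (cV 16) (cF (cV 9))))))
      (s(16 := 1), lev, ?f) (s(16 := a n), lev, ?f)"
    proof (rule det_For[where m = n and S = "\<lambda>j. (s(16 := a j), lev, ?f)"])
      fix j assume j: "j < n"
      have "det (Suc (max 0 (Suc 0))) (Cond (cL (cV 9)) Skip (set_var 16 (Mul (cV 16) (cF (cV 9)))))
         (s(16 := a j, 9 := j), lev, ?f) (s(16 := a (Suc j), 9 := j), lev, ?f)"
        using less[of "Suc j"] j by (intro det_Cond det_s det_Skip) (auto simp: aS fun_eq_iff)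
      then show "det 2 (Cond (cL (cV 9)) Skip (set_var 16 (Mul (cV 16) (cF (cV 9)))))
         (upd 9 j (s(16 := a j), lev, ?f)) (upd 9 j (s(16 := a (Suc j)), lev, ?f))"
        by (simp add: numeral_2_eq_2)
    qed (use s bounds(2) le_lam_less(2) in \<open>auto simp: fun_eq_iff a0\<close>)
  qed
  then show ?thesis unfolding an by (rule det_mono) simp
qed

definition accepts :: bool where
  "accepts \<longleftrightarrow> (\<exists>w<M. total div 2 ^ ((2 * n + 1) * (k * M + w)) mod 4 \<noteq> 0)"

lemma det_scan:
  assumes s: "s 5 = M" "s 16 = total" "s 17 = 0" "s 18 = 0" "s 19 = 0" "s 20 = 0" and k: "k \<le> n"
  shows "det (lam * (lam * 6 + 17) + 4) com_scan (s, l, f) (s(19 := of_bool accepts), l, f)"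
proof -
  define P where "P w \<longleftrightarrow> total div 2 ^ ((2 * n + 1) * (k * M + w)) mod 4 \<noteq> 0" for w
  define a where "a j = (of_bool (\<exists>w<j. P w) :: nat)" for j
  have aS: "a (Suc j) = (if P j then 1 else a j)" for j by (auto simp: a_def less_Suc_eq)
  have an: "a M = of_bool accepts" by (simp add: a_def P_def accepts_def)
  let ?e = "Rem (Quot (cV 16) (cV 18)) c4"
  let ?c = "Seq (Two_pow 18 (Mul base_bits (Add (Mul cK (cV 5)) (cV 17)))) (Seq (Cond ?e (set_var 19 c1) Skip) (set_var 18 (Const 0)))"
  have "det (lam * ((lam * 6 + 12) + 5) + 4) com_scan (s, l, f) (s(19 := a M), l, f)"
    unfolding com_scan_def
  proof (rule det_For[where m = M and S = "\<lambda>j. (s(19 := a j), l, f)"])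
    fix j assume j: "j < M"
    let ?s = "s(19 := a j, 17 := j)" and ?s' = "s(19 := a (Suc j), 17 := j)"
    let ?m = "(2 * n + 1) * (k * M + j)"
    have "k * M + j \<le> n * M + M" using j k by (intro add_mono mult_le_mono1) auto
    also have "\<dots> \<le> (n + 2) * M" by simp
    finally have m: "?m \<le> lam" using lam_ge by (meson le_trans mult_le_mono2)
    have "det ((lam * 6 + 6) + (Suc (max (Suc 0) 0) + Suc 0 + 1) + 1)
      ?c (?s, l, f) (?s', l, f)"
    proof (rule det_Seq[OF _ det_Seq])
      show "det (lam * 6 + 6) (Two_pow 18 (Mul base_bits (Add (Mul cK (cV 5)) (cV 17)))) (?s, l, f) (?s(18 := 2 ^ ?m), l, f)"
        using m le_lam_less(1)[OF m] s by (intro det_Two_pow[where m = ?m]) auto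
      have c: "val ?e (mem (?s(18 := 2 ^ ?m), l, f)) = total div 2 ^ ?m mod 4" using s by simp
      show "det (Suc (max (Suc 0) 0)) (Cond ?e (set_var 19 c1) Skip) (?s(18 := 2 ^ ?m), l, f) (?s'(18 := 2 ^ ?m), l, f)"
      proof (rule det_Cond)
        assume "val ?e (mem (?s(18 := 2 ^ ?m), l, f)) \<noteq> 0"
        then have "P j" unfolding c P_def .
        then show "det (Suc 0) (set_var 19 c1) (?s(18 := 2 ^ ?m), l, f) (?s'(18 := 2 ^ ?m), l, f)"
          using K_facts by (intro det_s) (auto simp: aS fun_eq_iff)
      next
        assume "val ?e (mem (?s(18 := 2 ^ ?m), l, f)) = 0"
        then have "\<not> P j" unfolding c P_def by simp
        then show "det 0 Skip (?s(18 := 2 ^ ?m), l, f) (?s'(18 := 2 ^ ?m), l, f)"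
          by (intro det_Skip) (simp add: aS)
      qed
      show "det (Suc 0) (set_var 18 (Const 0)) (?s'(18 := 2 ^ ?m), l, f) (?s', l, f)"
        using s by (intro det_s) (auto simp: fun_eq_iff)
    qed
    then have "det (lam * 6 + 12) ?c (?s, l, f) (?s', l, f)" by (rule det_mono) simp
    then show "det (lam * 6 + 12) ?c
      (upd 17 j (s(19 := a j), l, f)) (upd 17 j (s(19 := a (Suc j)), l, f))" by simp
  qed (use s bounds(3) le_lam_less(2) in \<open>auto simp: fun_eq_iff a_def\<close>)
  then show ?thesis unfolding an by (rule det_mono) simp
qed

definition count_steps :: nat where
  "count_steps = 4 ^ (D + 1) * (lam * (lam * (lam * (lam * 6 + 60) + 117) + 70) + 70)"

text \<open>Writing the answer overwrites the number of vertices in cell 0, so the final memory need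
  not be of the form \<open>mem S\<close>; only that cell is specified.\<close>

lemma exec_count:
  assumes s: "s = (\<lambda>_. 0)(0 := b, 1 := 2 ^ b, 2 := R)" and ok: "ok (mem (s, (\<lambda>_. 0), (\<lambda>_. 0)))" and k: "k \<le> n"
  shows "\<exists>m'. m' 0 = of_bool accepts \<and> exec ok count_steps com_count (mem (s, (\<lambda>_. 0), (\<lambda>_. 0))) (return_pmf m')"
proof -
  let ?z = "\<lambda>_. 0 :: nat" and ?f = "acc_sum (4 ^ (D + 1))"
  let ?s1 = "s(4 := D)" and ?s2 = "s(4 := D, 5 := M)" and ?s3 = "s(4 := D, 5 := M, 6 := 4 ^ (D + 1))"
  let ?s5 = "?s3(16 := total, 19 := of_bool accepts)"
  have f0: "?z = acc_sum 0" by (simp add: fun_eq_iff acc_sum_0)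
  let ?m' = "(mem (?s5, lev, ?f))(0 := of_bool accepts)"
  have nl: "n \<le> lam" by (rule bounds(2))
  have K4: "x < 2 ^ K" if "x \<le> lam" for x using le_lam_less(2)[OF that] .
  have fin: "exec ok (Suc 0) (Assign (Const 0) (cV 19)) (mem (?s5, lev, ?f)) (return_pmf ?m')" if "ok (mem (?s5, lev, ?f))"
  proof -
    have "ok ?m'" using K_facts by (intro ok_upd[OF that]) (auto simp: mlen_def)
    then show ?thesis using exec_Assign[of ok, OF that, of "Const 0" "cV 19"] by simp
  qed
  have "exec ok ((n * (n * (n * 7 + 9) + 9) + 4) + ((n * 7 + 4) + (Suc 0 + ((lam * 6 + 6) +
      ((4 ^ (D + 1) * (lam * (lam * (lam * (lam * 6 + 46) + 56) + 9) + 9) + 4) +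
       ((lam * 7 + 6) + ((lam * (lam * 6 + 17) + 4) + Suc 0 + 1) + 1) + 1) + 1) + 1) + 1) + 1)
     com_count (mem (s, ?z, ?z)) (return_pmf ?m')"
    unfolding com_count_def
  proof (rule exec_det_Seq[OF _ ok exec_det_Seq[OF _ _ exec_det_Seq[OF _ _ exec_det_Seq[OF _ _ exec_det_Seq[OF _ _
      exec_det_Seq[OF _ _ exec_det_Seq[OF _ _ fin]]]]]]])
    show "det (n * (n * (n * 7 + 9) + 9) + 4) com_levels (s, ?z, ?z) (s, lev, ?z)"
      by (rule det_levels) (simp_all add: s)
    show "det (n * 7 + 4) com_depth (s, lev, ?z) (?s1, lev, ?z)"
      by (rule det_depth) (simp_all add: s)
    show "det (Suc 0) (set_var 5 (Add (Mul cN (cV 1)) c1)) (?s1, lev, ?z) (?s2, lev, ?z)"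
      using K4[OF bounds(3)] by (intro det_s) (auto simp: s M_def)
    have "2 ^ (2 * (D + 1)) = (4::nat) ^ (D + 1)" by (simp add: power_mult)
    then have e: "?s3 = ?s2(6 := 2 ^ (2 * (D + 1)))" by simp
    show "det (lam * 6 + 6) (Two_pow 6 (Mul c2 (Add (cV 4) c1))) (?s2, lev, ?z) (?s3, lev, acc_sum 0)"
      unfolding f0[symmetric] e using bounds(4) le_lam_less(1)[OF bounds(4)]
      by (intro det_Two_pow[where m = "2 * (D + 1)"]) (auto simp: s)
    show "det (4 ^ (D + 1) * (lam * (lam * (lam * (lam * 6 + 46) + 56) + 9) + 9) + 4) com_sweep (?s3, lev, acc_sum 0) (?s3, lev, ?f)"
      by (rule det_sweep) (simp_all add: s)
    show "det (lam * 7 + 6) com_roots (?s3, lev, ?f) (?s3(16 := total), lev, ?f)"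
      by (rule det_roots) (simp add: s)
    show "det (lam * (lam * 6 + 17) + 4) com_scan (?s3(16 := total), lev, ?f) (?s5, lev, ?f)"
      using k by (intro det_scan) (simp_all add: s)
  qed
  moreover have "(n * (n * (n * 7 + 9) + 9) + 4) + ((n * 7 + 4) + (Suc 0 + ((lam * 6 + 6) +
      ((4 ^ (D + 1) * (lam * (lam * (lam * (lam * 6 + 46) + 56) + 9) + 9) + 4) +
       ((lam * 7 + 6) + ((lam * (lam * 6 + 17) + 4) + Suc 0 + 1) + 1) + 1) + 1) + 1) + 1) + 1 \<le> count_steps"
  proof -
    \<comment> \<open>\<open>p\<close> is the cost of a round of the sweep; \<open>q\<close> absorbs
      everything outside the sweep and may be multiplied by the number of rounds.\<close>
    define p q where "p = lam * (lam * (lam * (lam * 6 + 46) + 56) + 9) + 9"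
      and "q = lam * (lam * (14 * lam + 61) + 61) + 61"
    have c: "count_steps = 4 ^ (D + 1) * p + 4 ^ (D + 1) * q"
      by (simp add: count_steps_def p_def q_def algebra_simps)
    have "n * (n * (n * 7 + 9) + 9) \<le> lam * (lam * (lam * 7 + 9) + 9)"
      using nl by (intro mult_le_mono add_mono le_refl)
    moreover have "1 * q \<le> 4 ^ (D + 1) * q" by (intro mult_le_mono1) simp
    moreover have "lam * (lam * (lam * 7 + 9) + 9) + lam * 7 + lam * 6 + lam * 7 + lam * (lam * 6 + 17) + 40 \<le> q"
      by (simp add: q_def algebra_simps)
    ultimately show ?thesis unfolding c p_def[symmetric] using nl by linarith
  qed
  ultimately have "exec ok count_steps com_count (mem (s, ?z, ?z)) (return_pmf ?m')" by (rule exec_mono)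
  then show ?thesis by (intro exI[of _ ?m']) simp
qed

end

section \<open>Connected dominating sets and elimination forests\<close>

text \<open>The vertices reachable from a given one form a nonempty closed subset; conversely, a
  closed subset contains everything reachable from its members. The library notion of connectedness
  excludes the empty graph.\<close>

lemma connected_induce_iff:
  assumes "sym (parcs G)"
  shows "Digraph_Component.connected (with_proj G \<restriction> X) \<longleftrightarrow> X \<noteq> {} \<and> closed_subsets (parcs G) X = {{}, X}"
proof -
  define E where "E = {(u, v) \<in> parcs G. u \<in> X \<and> v \<in> X}"
  have "parcs (mk_symmetric (with_proj G \<restriction> X)) = E"
    using symD[OF assms] by (auto simp: mk_symmetric_def induce_subgraph_def E_def)
  moreover have "pverts (mk_symmetric (with_proj G \<restriction> X)) = X"
    by (simp add: mk_symmetric_def induce_subgraph_def)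
  ultimately have conn: "Digraph_Component.connected (with_proj G \<restriction> X) \<longleftrightarrow>
      X \<noteq> {} \<and> (\<forall>u\<in>X. \<forall>v\<in>X. (u, v) \<in> rtrancl_on X E)"
    by (simp add: connected_def strongly_connected_def reachable_def)
  have only: "L = X" if all: "\<forall>u\<in>X. \<forall>v\<in>X. (u, v) \<in> rtrancl_on X E"
    and L: "L \<in> closed_subsets (parcs G) X" "L \<noteq> {}" for L
  proof -
    have LX: "L \<subseteq> X" using L(1) by (simp add: closed_subsets_def)
    obtain u where u: "u \<in> L" using L(2) by blast
    have "v \<in> L" if "v \<in> X" for v
    proof -
      have "(u, v) \<in> rtrancl_on X E" using all u LX that by blast
      then show ?thesis
        using L(1) u by (induction rule: rtrancl_on_induct) (auto simp: closed_subsets_def E_def)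
    qed
    with LX show ?thesis by blast
  qed
  have both: "{} \<in> closed_subsets (parcs G) X" "X \<in> closed_subsets (parcs G) X"
    by (auto simp: closed_subsets_def)
  have path: "(u, v) \<in> rtrancl_on X E"
    if "closed_subsets (parcs G) X = {{}, X}" "u \<in> X" "v \<in> X" for u v
  proof -
    define L where "L = {w \<in> X. (u, w) \<in> rtrancl_on X E}"
    have "L \<in> closed_subsets (parcs G) X"
      by (auto simp: L_def closed_subsets_def E_def intro: rtrancl_on_into_rtrancl_on)
    then have "L = {} \<or> L = X" unfolding that(1) by simp
    moreover have "u \<in> L" using that(2) by (simp add: L_def)
    ultimately have "v \<in> L" using that(3) by blast
    then show ?thesis by (simp add: L_def)
  qed
  show ?thesis
  proof
    assume "Digraph_Component.connected (with_proj G \<restriction> X)"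
    then have c: "X \<noteq> {}" "\<forall>u\<in>X. \<forall>v\<in>X. (u, v) \<in> rtrancl_on X E" unfolding conn by auto
    have "closed_subsets (parcs G) X \<subseteq> {{}, X}" using only[OF c(2)] by blast
    with both c(1) show "X \<noteq> {} \<and> closed_subsets (parcs G) X = {{}, X}" by auto
  next
    assume "X \<noteq> {} \<and> closed_subsets (parcs G) X = {{}, X}"
    then show "Digraph_Component.connected (with_proj G \<restriction> X)" unfolding conn using path by auto
  qed
qed

locale forest_instance =
  fixes n d :: nat and G T :: "nat pair_pre_digraph"
  assumes G: "pair_graph G" "pverts G = {..<n}" "Digraph_Component.connected (with_proj G)"
    and T: "elimination_forest (with_proj G) (with_proj T)" "forest_depth (with_proj T) = d"
begin

definition level :: "nat \<Rightarrow> nat" where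
  "level v = card {u. (u, v) \<in> (parcs T)\<^sup>+}"

definition max_level :: nat where
  "max_level = Max (level ` {..<n})"

lemma n_positive: "n > 0"
  using G(2,3) by (auto simp: connected_def strongly_connected_def mk_symmetric_def)

lemma fin_T: "fin_digraph (with_proj T)"
  using T(1) by (simp add: elimination_forest_def rooted_forest_def)

lemma verts_T: "pverts T = {..<n}"
  using T(1) G(2) by (simp add: elimination_forest_def)

lemma arc_T_less: "(u, v) \<in> parcs T \<Longrightarrow> u < n \<and> v < n"
proof -
  assume "(u, v) \<in> parcs T"
  moreover interpret fin_digraph "with_proj T" by (rule fin_T)
  have "fst e \<in> pverts T \<and> snd e \<in> pverts T" if "e \<in> parcs T" for e
    using wellformed[of e] that by simp
  ultimately show ?thesis using verts_T by fastforce
qed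

lemma parent_unique: "(u, w) \<in> parcs T \<Longrightarrow> (v, w) \<in> parcs T \<Longrightarrow> u = v"
proof -
  assume a: "(u, w) \<in> parcs T" "(v, w) \<in> parcs T"
  interpret fin_digraph "with_proj T" by (rule fin_T)
  have "finite (in_arcs (with_proj T) w)" using finite_arcs by (simp add: in_arcs_def)
  moreover have "card (in_arcs (with_proj T) w) \<le> 1"
    using T(1) arc_T_less[OF a(1)] verts_T
    by (auto simp: elimination_forest_def rooted_forest_def in_degree_def)
  moreover have "(u, w) \<in> in_arcs (with_proj T) w" "(v, w) \<in> in_arcs (with_proj T) w"
    using a by (auto simp: in_arcs_def)
  ultimately show ?thesis by (metis One_nat_def card_le_Suc0_iff_eq prod.inject)
qed

lemma acyclic_T: "(v, v) \<notin> (parcs T)\<^sup>+"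
proof
  assume v: "(v, v) \<in> (parcs T)\<^sup>+"
  interpret fin_digraph "with_proj T" by (rule fin_T)
  obtain p where "awalk v p v" "p \<noteq> []" using v reachable1_awalk[of v v] by auto
  then have "closed_w p" by (auto simp: closed_w_def)
  then have "\<exists>p. cycle p" by (rule closed_w_imp_cycle)
  then show False using T(1) by (simp add: elimination_forest_def rooted_forest_def forest_def)
qed

lemma ancestors_subset: "{u. (u, v) \<in> (parcs T)\<^sup>+} \<subseteq> {..<n} - {v}"
proof
  fix u assume "u \<in> {u. (u, v) \<in> (parcs T)\<^sup>+}"
  then have u: "(u, v) \<in> (parcs T)\<^sup>+" by simp
  then have "u < n" by (metis arc_T_less tranclD)
  with u acyclic_T show "u \<in> {..<n} - {v}" by auto
qed

lemma level_outside: "v \<ge> n \<Longrightarrow> level v = 0"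
proof -
  assume "v \<ge> n"
  then have "(u, v) \<notin> (parcs T)\<^sup>+" for u by (metis arc_T_less tranclD2 not_le)
  then show ?thesis by (simp add: level_def)
qed

text \<open>Since the parent is unique, the proper ancestors of a child are the parent and its
  proper ancestors; acyclicity makes the parent a new element.\<close>

lemma level_Suc: "(u, v) \<in> parcs T \<Longrightarrow> level v = Suc (level u)"
proof -
  assume uv: "(u, v) \<in> parcs T"
  have "w = u \<or> (w, u) \<in> (parcs T)\<^sup>+" if "(w, v) \<in> (parcs T)\<^sup>+" for w
  proof -
    have "\<exists>p. (w, p) \<in> (parcs T)\<^sup>* \<and> (p, v) \<in> parcs T" using that by (rule tranclD2)
    then show ?thesis using parent_unique[OF uv] by (auto simp: rtrancl_eq_or_trancl)
  qed
  then have "{w. (w, v) \<in> (parcs T)\<^sup>+} = insert u {w. (w, u) \<in> (parcs T)\<^sup>+}"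
    using uv by (auto intro: trancl_into_trancl)
  moreover have "finite {w. (w, u) \<in> (parcs T)\<^sup>+}"
    using ancestors_subset[of u] finite_subset by blast
  ultimately show ?thesis using acyclic_T[of u] by (simp add: level_def)
qed

lemma level_less: "v < n \<Longrightarrow> level v < n"
proof -
  assume v: "v < n"
  have "level v \<le> card ({..<n} - {v})"
    unfolding level_def by (intro card_mono ancestors_subset) simp
  then show ?thesis using v by simp
qed

lemma level_le: "v < n \<Longrightarrow> level v \<le> max_level"
  unfolding max_level_def by (intro Max_ge) auto

lemma max_level_attained: "\<exists>v<n. level v = max_level"
proof -
  have "Max (level ` {..<n}) \<in> level ` {..<n}" using n_positive by (intro Max_in) auto
  then show ?thesis by (auto simp: max_level_def)
qed

lemma level_parent: "level v \<noteq> 0 \<Longrightarrow> \<exists>u. (u, v) \<in> parcs T"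
proof -
  assume "level v \<noteq> 0"
  then have "{u. (u, v) \<in> (parcs T)\<^sup>+} \<noteq> {}" unfolding level_def by (metis card.empty)
  then obtain u where "(u, v) \<in> (parcs T)\<^sup>+" by blast
  then show ?thesis by (meson tranclD2)
qed

lemma sym_G: "sym (parcs G)"
proof -
  interpret pair_graph G by (rule G(1))
  show ?thesis using arcs_symmetric by (auto intro: symI)
qed

lemma arc_G_less: "(u, v) \<in> parcs G \<Longrightarrow> u < n \<and> v < n \<and> u \<noteq> v"
proof -
  assume uv: "(u, v) \<in> parcs G"
  interpret pair_graph G by (rule G(1))
  show ?thesis using in_arcsD1[OF uv] in_arcsD2[OF uv] no_loops'[OF uv] G(2) by auto
qed

lemma arc_G_ancestor: "(u, v) \<in> parcs G \<Longrightarrow> (u, v) \<in> (parcs T)\<^sup>+ \<or> (v, u) \<in> (parcs T)\<^sup>+"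
proof -
  assume uv: "(u, v) \<in> parcs G"
  then have "u \<rightarrow>\<^sup>*\<^bsub>with_proj T\<^esub> v \<or> v \<rightarrow>\<^sup>*\<^bsub>with_proj T\<^esub> u"
    using T(1) by (simp add: elimination_forest_def)
  then have "(u, v) \<in> (parcs T)\<^sup>* \<or> (v, u) \<in> (parcs T)\<^sup>*"
    by (auto simp: reachable_def dest: rtrancl_on_rtranclI)
  then show ?thesis using arc_G_less[OF uv] by (auto simp: rtrancl_eq_or_trancl)
qed

lemma elim: "elim n max_level (parcs G) (parcs T) level"
proof unfold_locales
  fix u v assume uv: "(u, v) \<in> parcs T"
  show "u < n \<and> v < n" using uv by (rule arc_T_less)
  show "level v = Suc (level u)" using uv by (rule level_Suc)
next
  fix u v w assume "(u, w) \<in> parcs T" "(v, w) \<in> parcs T"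
  then show "u = v" by (rule parent_unique)
next
  fix v assume "v < n"
  then show "level v \<le> max_level" by (rule level_le)
next
  fix v assume "level v \<noteq> 0"
  then show "\<exists>u. (u, v) \<in> parcs T" by (rule level_parent)
next
  fix u v assume uv: "(u, v) \<in> parcs G"
  show "u < n \<and> v < n" using arc_G_less[OF uv] by simp
  show "(v, u) \<in> parcs G" using sym_G uv by (rule symD)
  show "(u, v) \<in> (parcs T)\<^sup>+ \<or> (v, u) \<in> (parcs T)\<^sup>+" using uv by (rule arc_G_ancestor)
qed

text \<open>The last conjunct strengthens the induction: it shows that the vertex appended to the
  path of its parent is new.\<close>

lemma root_path:
  "v < n \<Longrightarrow> \<exists>p. vpath p (with_proj T) \<and> in_degree (with_proj T) (hd p) = 0 \<and> last p = v \<and>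
     length p = Suc (level v) \<and> (\<forall>u\<in>set p. level u \<le> level v)"
proof (induction "level v" arbitrary: v)
  case 0
  have "(u, v) \<notin> parcs T" for u using level_Suc[of u v] 0 by auto
  then have "in_arcs (with_proj T) v = {}" by (auto simp: in_arcs_def)
  moreover have "vpath [v] (with_proj T)" using 0 verts_T by (simp add: vpath_def vwalk_def)
  ultimately show ?case using 0 by (intro exI[of _ "[v]"]) (simp add: in_degree_def)
next
  case (Suc j)
  then obtain u where u: "(u, v) \<in> parcs T" using level_parent[of v] by auto
  have "level u = j" using level_Suc[OF u] Suc.hyps(2) by simp
  with Suc.hyps(1)[of u] arc_T_less[OF u] obtain p where p: "vpath p (with_proj T)"
    "in_degree (with_proj T) (hd p) = 0" "last p = u" "length p = Suc (level u)" "\<forall>w\<in>set p. level w \<le> level u"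
    by auto
  have ne: "p \<noteq> []" using p(4) by auto
  have "v \<notin> set p" using p(5) level_Suc[OF u] by auto
  moreover have "vwalk (p @ [v]) (with_proj T)"
    using p(1,3) u ne Suc.prems verts_T by (auto simp: vpath_def vwalk_def set_vwalk_arcs_snoc)
  ultimately have "vpath (p @ [v]) (with_proj T)" using p(1) by (simp add: vpath_def)
  then show ?case using p ne level_Suc[OF u] by (intro exI[of _ "p @ [v]"]) auto
qed

text \<open>A vertex of maximal level is a leaf, so its path from the root is among those measured
  by the depth. Paths have distinct vertices, which makes the set of lengths finite and its maximum
  meaningful.\<close>

lemma max_level_less_depth: "max_level + 1 \<le> d"
proof -
  let ?P = "{length p | p. vpath p (with_proj T) \<and> in_degree (with_proj T) (hd p) = 0 \<and> out_degree (with_proj T) (last p) = 0}"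
  obtain v where v: "v < n" "level v = max_level" using max_level_attained by blast
  obtain p where p: "vpath p (with_proj T)" "in_degree (with_proj T) (hd p) = 0" "last p = v" "length p = Suc (level v)"
    using root_path[OF v(1)] by blast
  have "(v, u) \<notin> parcs T" for u
    using level_Suc[of v u] level_le[of u] arc_T_less[of v u] v(2) by auto
  then have "out_arcs (with_proj T) v = {}" by (auto simp: out_arcs_def)
  then have "max_level + 1 \<in> ?P" using p v(2) by (intro CollectI exI[of _ p]) (simp add: out_degree_def)
  moreover have "?P \<subseteq> {..n}"
  proof
    fix x assume "x \<in> ?P"
    then obtain q where q: "x = length q" "vpath q (with_proj T)" by blast
    then have "set q \<subseteq> {..<n}" "distinct q" using verts_T by (auto simp: vpath_def vwalk_def)
    then have "length q \<le> card {..<n}" by (metis card_mono distinct_card finite_lessThan)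
    then show "x \<in> {..n}" by (simp add: q)
  qed
  then have "finite ?P" by (rule finite_subset) simp
  ultimately have "max_level + 1 \<le> Max ?P" by (intro Max_ge)
  then show ?thesis using T(2) by (simp add: forest_depth_def)
qed

interpretation E: elim n max_level "parcs G" "parcs T" level
  by (rule elim)

lemma cds_iff: "connected_dominating_set (with_proj G) k \<longleftrightarrow> (\<exists>X. E.cds X \<and> int (card X) = k)"
proof -
  have "X \<subseteq> verts (with_proj G) \<and> Digraph_Component.connected (with_proj G \<restriction> X) \<and> dominating_set (with_proj G) X
      \<longleftrightarrow> E.cds X" for X
  proof -
    have "dominating_set (with_proj G) X \<longleftrightarrow> X \<subseteq> {..<n} \<and> E.undominated X = {}"
      using G(2) by (auto simp: dominating_set_def closed_nbhd_def E.undominated_def)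
    \<comment> \<open>Settles the empty set, which only the notion of connectedness from the library
      rejects by itself.\<close>
    moreover have "E.undominated {} \<noteq> {}" using n_positive by (auto simp: E.undominated_def)
    ultimately show ?thesis
      unfolding connected_induce_iff[OF sym_G] E.cds_def using G(2) by auto
  qed
  then show ?thesis unfolding connected_dominating_set_def by blast
qed

end

section \<open>Correctness and resource bounds\<close>

definition loop_bound :: "nat \<Rightarrow> nat" where
  "loop_bound n = (2 * n + 1) * ((n + 2) * (4 * n * n + 1))"

text \<open>The last summand covers the initial test, the choice of \<open>b\<close> and the coins;
  the rest is \<open>count_steps\<close> without its exponential factor.\<close>

definition step_bound :: "nat \<Rightarrow> nat" where
  "step_bound n = loop_bound n * (loop_bound n * (loop_bound n * (loop_bound n * 6 + 60) + 117) + 70) + 70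
     + (10 * n * n + 9 * n + 20)"

text \<open>The final \<open>n + 1\<close> makes the result exceed the argument, so that input cells
  fit when the argument is the input size.\<close>

definition value_bits :: "nat \<Rightarrow> nat" where
  "value_bits n = (n + 1) * (loop_bound n + 2) + n + 1"

context solver_run
begin

lemma sum_weights_less: "sum (digit_weight b R) {..<n} < M"
proof -
  have "sum (digit_weight b R) {..<n} \<le> (\<Sum>v<n. 2 ^ b)"
    using digit_weight_less by (intro sum_mono) (simp add: less_imp_le)
  then show ?thesis by (simp add: M_def)
qed

lemma total_eq: "total = (\<Sum>g\<in>colourings. \<Prod>v\<in>solution g. 2 ^ ((2 * n + 1) * (M + digit_weight b R v)))"
  unfolding total_def roots_product by (simp add: vw_def)

lemma accepts_sound: "accepts \<Longrightarrow> k > 0 \<Longrightarrow> \<exists>X. cds X \<and> card X = k"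
  using digit_test_sound[OF sum_weights_less _ total_eq _ n_pos] unfolding accepts_def by blast

lemma accepts_complete:
  assumes "k > 0" "\<exists>!A. minimiser (digit_weight b R) {X. cds X \<and> card X = k} A"
  shows accepts
  unfolding accepts_def
  by (rule digit_test_complete[OF sum_weights_less assms(1) total_eq n_pos])
    (use assms(2) in \<open>simp add: minimiser_def\<close>)

end

context solver
begin

lemma exec_main_reject:
  assumes "ok (mem S)" "sg \<or> k = 0 \<or> k > n"
  shows "exec ok 2 com_main (mem S) (return_pmf ((mem S)(0 := 0)))"
proof -
  have "ok ((mem S)(0 := 0))" using assms(1) by (intro ok_upd) (auto simp: mlen_def)
  then have "exec ok (Suc 0) (Assign (Const 0) (Const 0)) (mem S) (return_pmf ((mem S)(0 := 0)))"
    using exec_Assign[of ok, OF assms(1), of "Const 0" "Const 0"] by simp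
  then have "exec ok (Suc (Suc 0)) com_main (mem S) (return_pmf ((mem S)(0 := 0)))"
    unfolding com_main_def using assms by (intro exec_Cond) auto
  then show ?thesis by (simp add: numeral_2_eq_2)
qed

text \<open>\<open>fin r\<close> is the final memory for the random number \<open>r\<close>. The
  output is thus the image of a uniform distribution, and probabilities become counts of
  numbers.\<close>

lemma exec_main:
  assumes ok: "ok (mem ((\<lambda>_. 0), (\<lambda>_. 0), (\<lambda>_. 0)))" and k: "\<not> sg" "0 < k" "k \<le> n"
  obtains b fin where "2 * n \<le> 2 ^ b"
    "exec ok (4 ^ (D + 1) * step_bound n) com_main (mem ((\<lambda>_. 0), (\<lambda>_. 0), (\<lambda>_. 0)))
      (map_pmf fin (pmf_of_set {..<2 ^ (b * n)}))"
    "\<And>r. r < 2 ^ (b * n) \<Longrightarrow> fin r 0 = 1 \<Longrightarrow> \<exists>X. cds X \<and> card X = k"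
    "\<And>r. r < 2 ^ (b * n) \<Longrightarrow> \<exists>!A. minimiser (digit_weight b r) {X. cds X \<and> card X = k} A \<Longrightarrow> fin r 0 = 1"
proof -
  let ?z = "\<lambda>_. 0 :: nat"
  have lam: "(n + 1) * (loop_bound n + 2) < K" using K_big by (simp add: loop_bound_def)
  have "(n + 1) * (n + 1) \<le> (2 * n + 1) * ((n + 2) * (4 * n * n + 1))"
    by (intro mult_le_mono) (auto intro: order_trans[of _ "(n + 2) * 1"])
  then have nn: "n * n + 2 * n + 1 \<le> loop_bound n" by (simp add: loop_bound_def)
  have "loop_bound n \<le> (n + 1) * (loop_bound n + 2)" by simp
  with nn lam have nnK: "n * n + 2 * n + 1 < K" by linarith
  have "2 * loop_bound n + 4 \<le> (n + 1) * (loop_bound n + 2)"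
  proof -
    have "2 * (loop_bound n + 2) \<le> (n + 1) * (loop_bound n + 2)" using n_pos by (intro mult_le_mono1) simp
    then show ?thesis by simp
  qed
  with nn lam have "4 * n < K" by linarith
  then have K4: "4 * n < 2 ^ K" "n < 2 ^ K" using less_exp[of K] by linarith+
  from det_range[of ?z ?z ?z, OF _ _ _ K4] obtain b where b: "2 * n \<le> 2 ^ b" "2 ^ b < 4 * n" "b \<le> n"
    and range: "det (n * 9 + 6) com_range (?z, ?z, ?z) (?z(0 := b, 1 := 2 ^ b), ?z, ?z)" by auto
  let ?s = "?z(0 := b, 1 := 2 ^ b)"
  have okb: "ok (mem (?s, ?z, ?z))"
    using range ok exec_invariant unfolding det_def by fastforce
  have bn: "b * n \<le> n * n" using b(3) by (rule mult_le_mono1)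
  then have bnK: "b * n < K" using nnK by linarith
  have rnd: "exec ok (n * n * 10 + 4) com_random (mem (?s, ?z, ?z))
      (map_pmf (\<lambda>r. mem (?s(2 := r), ?z, ?z)) (pmf_of_set {..<2 ^ (b * n)}))"
    using bnK less_trans[OF bnK less_exp] by (intro exec_random[OF _ _ _ _ _ _ okb bn]) auto
  have ne: "{..<(2::nat) ^ (b * n)} \<noteq> {}" by (simp add: lessThan_empty_iff)
  let ?N = "4 ^ (D + 1) * (loop_bound n * (loop_bound n * (loop_bound n * (loop_bound n * 6 + 60) + 117) + 70) + 70)"
  let ?Q = "\<lambda>r m'. exec ok ?N com_count (mem (?s(2 := r), ?z, ?z)) (return_pmf m') \<and>
      (m' 0 = 1 \<longrightarrow> (\<exists>X. cds X \<and> card X = k)) \<and>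
      ((\<exists>!A. minimiser (digit_weight b r) {X. cds X \<and> card X = k} A) \<longrightarrow> m' 0 = 1)"
  have each: "\<exists>m'. ?Q r m'" if r: "r < 2 ^ (b * n)" for r
  proof -
    interpret r: solver_run n K k sg GG TT inp D lev b r
      by unfold_locales (use b r in auto)
    have "mem (?s(2 := r), ?z, ?z) \<in> set_pmf (map_pmf (\<lambda>r. mem (?s(2 := r), ?z, ?z)) (pmf_of_set {..<2 ^ (b * n)}))"
      using r ne by simp
    then have okr: "ok (mem (?s(2 := r), ?z, ?z))" using exec_invariant[OF rnd] by blast
    obtain m' where m': "m' 0 = of_bool r.accepts"
      "exec ok r.count_steps com_count (mem (?s(2 := r), ?z, ?z)) (return_pmf m')"
      using r.exec_count[OF refl okr k(3)] by blast
    have steps: "r.count_steps = ?N" by (simp only: r.count_steps_def r.lam_def loop_bound_def)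
    show ?thesis
    proof (rule exI[of _ m'], intro conjI impI)
      show "exec ok ?N com_count (mem (?s(2 := r), ?z, ?z)) (return_pmf m')" using m'(2) unfolding steps .
      show "\<exists>X. cds X \<and> card X = k" if "m' 0 = 1"
        using r.accepts_sound[OF _ k(2)] that m'(1) by (cases r.accepts) auto
      show "m' 0 = 1" if "\<exists>!A. minimiser (digit_weight b r) {X. cds X \<and> card X = k} A"
        using r.accepts_complete[OF k(2) that] m'(1) by simp
    qed
  qed
  \<comment> \<open>Each \<open>r\<close> has its own instance of \<open>solver_run\<close>; the
    choice principle gathers the final memories in one function.\<close>
  have "\<forall>r. \<exists>m'. r < 2 ^ (b * n) \<longrightarrow> ?Q r m'"
  proof (intro allI)
    fix r
    show "\<exists>m'. r < 2 ^ (b * n) \<longrightarrow> ?Q r m'"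
      by (cases "r < 2 ^ (b * n)") (use each[of r] in \<open>simp_all only: simp_thms\<close>)
  qed
  from choice[OF this] obtain fin where choice: "\<forall>r. r < 2 ^ (b * n) \<longrightarrow>
      ?Q r (fin r)"
    by (elim exE)
  have fin: "exec ok ?N com_count (mem (?s(2 := r), ?z, ?z)) (return_pmf (fin r))"
      "fin r 0 = 1 \<Longrightarrow> \<exists>X. cds X \<and> card X = k"
      "\<exists>!A. minimiser (digit_weight b r) {X. cds X \<and> card X = k} A \<Longrightarrow> fin r 0 = 1" if "r < 2 ^ (b * n)" for r
    using choice[rule_format, OF that] by (simp_all only: simp_thms)
  have "exec ok (n * n * 10 + 4 + ?N + 1) (Seq com_random com_count) (mem (?s, ?z, ?z))
    (bind_pmf (map_pmf (\<lambda>r. mem (?s(2 := r), ?z, ?z)) (pmf_of_set {..<2 ^ (b * n)})) (\<lambda>m. return_pmf (fin (m (sbase + 2)))))"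
  proof (rule exec_Seq[OF rnd])
    fix m' assume "m' \<in> set_pmf (map_pmf (\<lambda>r. mem (?s(2 := r), ?z, ?z)) (pmf_of_set {..<2 ^ (b * n)}))"
    then obtain r where r: "r < 2 ^ (b * n)" "m' = mem (?s(2 := r), ?z, ?z)" using ne by auto
    have "m' (sbase + 2) = r" unfolding r(2) by (subst mem_scalar) auto
    with fin(1)[OF r(1)] show "exec ok ?N com_count m' (return_pmf (fin (m' (sbase + 2))))" by (simp only: r(2))
  qed
  moreover have "bind_pmf (map_pmf (\<lambda>r. mem (?s(2 := r), ?z, ?z)) (pmf_of_set {..<2 ^ (b * n)})) (\<lambda>m. return_pmf (fin (m (sbase + 2))))
     = map_pmf fin (pmf_of_set {..<2 ^ (b * n)})"
    by (simp add: bind_map_pmf map_pmf_def bind_assoc_pmf bind_return_pmf mem_scalar mem_scalar_2)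
  ultimately have count: "exec ok (n * n * 10 + 4 + ?N + 1) (Seq com_random com_count) (mem (?s, ?z, ?z))
     (map_pmf fin (pmf_of_set {..<2 ^ (b * n)}))" by (simp only:)
  have seq: "exec ok (n * 9 + 6 + (n * n * 10 + 4 + ?N + 1) + 1) (Seq com_range (Seq com_random com_count))
      (mem (?z, ?z, ?z)) (map_pmf fin (pmf_of_set {..<2 ^ (b * n)}))"
    by (rule exec_det_Seq[OF range ok]) (rule count)
  have "exec ok (Suc (n * 9 + 6 + (n * n * 10 + 4 + ?N + 1) + 1)) com_main (mem (?z, ?z, ?z))
      (map_pmf fin (pmf_of_set {..<2 ^ (b * n)}))"
    unfolding com_main_def
  proof (rule exec_Cond[of ok, OF ok])
    have "val (Add (Cell c1) (Add (Sub c1 cK) (Sub cK cN))) (mem (?z, ?z, ?z)) = 0" using k by simp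
    with seq show "exec ok (n * 9 + 6 + (n * n * 10 + 4 + ?N + 1) + 1)
      (if val (Add (Cell c1) (Add (Sub c1 cK) (Sub cK cN))) (mem (?z, ?z, ?z)) \<noteq> 0 then Assign (Const 0) (Const 0)
       else Seq com_range (Seq com_random com_count)) (mem (?z, ?z, ?z)) (map_pmf fin (pmf_of_set {..<2 ^ (b * n)}))"
      by (simp only: if_False not_True_eq_False refl)
  qed
  moreover have "Suc (n * 9 + 6 + (n * n * 10 + 4 + ?N + 1) + 1) \<le> 4 ^ (D + 1) * step_bound n"
  proof -
    have arith: "Suc (n * 9 + 6 + (n * n * 10 + 4 + X + 1) + 1) \<le> X + Z" if "10 * n * n + 9 * n + 20 \<le> Z" for X Z
      using that by simp
    have "1 * (10 * n * n + 9 * n + 20) \<le> 4 ^ (D + 1) * (10 * n * n + 9 * n + 20)" by (intro mult_le_mono1) simp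
    then have *: "10 * n * n + 9 * n + 20 \<le> 4 ^ (D + 1) * (10 * n * n + 9 * n + 20)" by (simp only: mult_1)
    show ?thesis unfolding step_bound_def distrib_left[of "4 ^ (D + 1)" _ "10 * n * n + 9 * n + 20"] by (rule arith[OF *])
  qed
  ultimately have "exec ok (4 ^ (D + 1) * step_bound n) com_main (mem (?z, ?z, ?z))
      (map_pmf fin (pmf_of_set {..<2 ^ (b * n)}))" by (rule exec_mono)
  with b(1) show ?thesis using fin(2,3) by (rule that)
qed

end

section \<open>The input encoding and polynomial bounds\<close>

lemma nth_concat_upt:
  assumes "\<And>i. i < m \<Longrightarrow> length (f i) = n" "u < m" "v < n"
  shows "concat (map f [0..<m]) ! (u * n + v) = f u ! v"
proof -
  have len: "length (concat (map f [0..<j])) = j * n" if "j \<le> m" for j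
    using that assms(1) by (induction j) auto
  have "concat (map f [0..<j]) ! (u * n + v) = f u ! v" if "u < j" "j \<le> m" for j
    using that
  proof (induction j)
    case (Suc j)
    show ?case
    proof (cases "u = j")
      case True
      then show ?thesis using len[of j] Suc.prems by (simp add: nth_append)
    next
      case False
      then have "u < j" using Suc.prems by simp
      then have "Suc u * n \<le> j * n" by (intro mult_le_mono1) simp
      then have "u * n + v < j * n" using assms(3) by simp
      then show ?thesis using Suc.IH[OF \<open>u < j\<close>] Suc.prems len[of j] by (simp add: nth_append)
    qed
  qed simp
  then show "concat (map f [0..<m]) ! (u * n + v) = f u ! v" using assms(2) by simp
qed

lemma length_adjacency_matrix: "length (adjacency_matrix n G) = n * n"
  by (cases n) (simp_all add: adjacency_matrix_def length_concat o_def sum_list_triv)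

lemma nth_adjacency_matrix:
  "u < n \<Longrightarrow> v < n \<Longrightarrow> adjacency_matrix n G ! (u * n + v) = of_bool ((u, v) \<in> parcs G)"
  unfolding adjacency_matrix_def by (subst nth_concat_upt) auto

lemma length_encode: "length (encode n G k T) = 3 + 2 * (n * n)"
  by (simp add: encode_def length_adjacency_matrix)

lemma length_le_input_size: "length xs \<le> input_size xs"
  unfolding input_size_def by (induction xs) auto

lemma bits_le_input_size: "x \<in> set xs \<Longrightarrow> bits x \<le> input_size xs"
  unfolding input_size_def by (induction xs) auto

lemma n_le_input_size: "n \<le> input_size (encode n G k T)"
proof -
  have "n \<le> n * n" by (cases n) auto
  then have "n \<le> length (encode n G k T)" unfolding length_encode by linarith
  then show ?thesis using length_le_input_size[of "encode n G k T"] by linarith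
qed

definition is_poly :: "(nat \<Rightarrow> nat) \<Rightarrow> bool" where
  "is_poly f \<longleftrightarrow> (\<exists>p. \<forall>x. poly p x = f x)"

lemma is_poly_const: "is_poly (\<lambda>_. c)"
  unfolding is_poly_def by (intro exI[of _ "[:c:]"]) simp

lemma is_poly_id: "is_poly (\<lambda>x. x)"
  unfolding is_poly_def by (intro exI[of _ "[:0, 1:]"]) simp

lemma is_poly_add: "is_poly f \<Longrightarrow> is_poly g \<Longrightarrow> is_poly (\<lambda>x. f x + g x)"
  unfolding is_poly_def by (metis poly_add)

lemma is_poly_mult: "is_poly f \<Longrightarrow> is_poly g \<Longrightarrow> is_poly (\<lambda>x. f x * g x)"
  unfolding is_poly_def by (metis poly_mult)

lemmas is_poly_intros = is_poly_const is_poly_id is_poly_add is_poly_mult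

lemma is_poly_loop_bound: "is_poly loop_bound"
  unfolding loop_bound_def[abs_def] by (intro is_poly_intros)

lemma is_poly_step_bound: "is_poly step_bound"
  unfolding step_bound_def[abs_def] by (intro is_poly_intros is_poly_loop_bound)

lemma is_poly_value_bits: "is_poly value_bits"
  unfolding value_bits_def[abs_def] by (intro is_poly_intros is_poly_loop_bound)

lemma loop_bound_mono: "n \<le> m \<Longrightarrow> loop_bound n \<le> loop_bound m"
  unfolding loop_bound_def by (intro mult_le_mono add_mono le_refl)

lemma step_bound_mono: "n \<le> m \<Longrightarrow> step_bound n \<le> step_bound m"
  unfolding step_bound_def by (intro mult_le_mono add_mono le_refl loop_bound_mono)

lemma value_bits_greater:
  assumes "n \<le> m"
  shows "(n + 1) * ((2 * n + 1) * ((n + 2) * (4 * n * n + 1)) + 2) < value_bits m" "m < value_bits m"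
proof -
  have "(n + 1) * (loop_bound n + 2) \<le> (m + 1) * (loop_bound m + 2)"
    using assms by (intro mult_le_mono add_mono le_refl loop_bound_mono)
  then show "(n + 1) * ((2 * n + 1) * ((n + 2) * (4 * n * n + 1)) + 2) < value_bits m"
    unfolding value_bits_def loop_bound_def by linarith
  show "m < value_bits m" by (simp add: value_bits_def)
qed

text \<open>A constant of the fixed program, independent of the input; the sum stands in for the
  maximum.\<close>

definition expr_cost :: nat where
  "expr_cost = (\<Sum>e\<in>exprs com_main. cost_weight e)"

definition time_bound :: "nat \<Rightarrow> nat" where
  "time_bound x = step_bound x * (2 * (value_bits x * expr_cost) + 1)"

text \<open>The polynomial \<open>33 + 2 * x * x + 2 * x\<close> bounds the number of cells: 3
  header cells, two matrices, 30 scalars and two arrays.\<close>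

definition space_bound :: "nat \<Rightarrow> nat" where
  "space_bound x = (33 + 2 * x * x + 2 * x) * (33 + 2 * x * x + 2 * x + value_bits x)
     + (2 * (value_bits x * expr_cost) + 1)"

lemma is_poly_time_bound: "is_poly time_bound"
  unfolding time_bound_def[abs_def] by (intro is_poly_intros is_poly_step_bound is_poly_value_bits)

lemma is_poly_space_bound: "is_poly space_bound"
  unfolding space_bound_def[abs_def] by (intro is_poly_intros is_poly_value_bits)

section \<open>From the program to the randomised algorithm\<close>

context forest_instance
begin

lemma main_correct:
  fixes k :: int
  defines "x \<equiv> encode n G k T"
  shows "\<exists>N. let D = run N (initial com_main x) in
         (\<forall>c \<in> set_pmf D. halted c \<and>
            elapsed c \<le> time_bound (input_size x) * 4 ^ d \<and>
            peak c \<le> space_bound (input_size x)) \<and>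
         (\<not> connected_dominating_set (with_proj G) k \<longrightarrow> (\<forall>c \<in> set_pmf D. \<not> answers_yes c)) \<and>
         (connected_dominating_set (with_proj G) k \<longrightarrow>
            measure_pmf.prob D {c. answers_yes c} \<ge> 1 / 2)"
proof -
  define L where "L = input_size x"
  \<comment> \<open>Taken at the input size instead of \<open>n\<close>, because the number
    \<open>k\<close> may be arbitrarily long compared with \<open>n\<close>.\<close>
  define K where "K = value_bits L"
  define inp where "inp = (\<lambda>i. if i < length x then x ! i else 0)"
  let ?k = "nat \<bar>k\<bar>"
  have nL: "n \<le> L" unfolding L_def x_def by (rule n_le_input_size)
  have K: "(n + 1) * ((2 * n + 1) * ((n + 2) * (4 * n * n + 1)) + 2) < K" "L < K"
    unfolding K_def by (rule value_bits_greater[OF nL])+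
  have cells: "inp (3 + (u * n + v)) = of_bool ((u, v) \<in> parcs G) \<and>
     inp (3 + (n * n + (u * n + v))) = of_bool ((u, v) \<in> parcs T)" if "u < n" "v < n" for u v
  proof -
    have "Suc u * n \<le> n * n" using that by (intro mult_le_mono1) simp
    then have "u * n + v < n * n" using that by simp
    then show ?thesis using that nth_adjacency_matrix[OF that]
      by (simp add: inp_def x_def length_encode)
        (simp add: encode_def nth_append length_adjacency_matrix)
  qed
  have "solver n K ?k (k < 0) (parcs G) (parcs T) inp max_level level"
  proof (rule solver.intro)
    show "machine n K ?k (k < 0) (parcs G) (parcs T) inp"
    proof
      show "n > 0" by (rule n_positive)
      show "inp 0 = n" "inp 1 = of_bool (k < 0)" "inp 2 = ?k"
        by (simp_all add: inp_def x_def length_encode) (simp_all add: encode_def)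
      show "inp (3 + (u * n + v)) = of_bool ((u, v) \<in> parcs G)" if "u < n" "v < n" for u v
        using cells[OF that] by (rule conjunct1)
      show "inp (3 + (n * n + (u * n + v))) = of_bool ((u, v) \<in> parcs T)" if "u < n" "v < n" for u v
        using cells[OF that] by (rule conjunct2)
      show "K > 0" using K(2) by linarith
    qed
    show "elim n max_level (parcs G) (parcs T) level" by (rule elim)
    show "solver_axioms n K max_level level"
    proof
      show "level v = 0" if "v \<ge> n" for v using that by (rule level_outside)
      show "\<exists>v<n. level v = max_level" by (rule max_level_attained)
      then show "max_level < n"
      proof (elim exE conjE)
        fix v assume "v < n" "level v = max_level"
        then show "max_level < n" using level_less[of v] by simp
      qed
      show "(n + 1) * ((2 * n + 1) * ((n + 2) * (4 * n * n + 1)) + 2) < K" by (rule K(1))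
    qed
  qed
  then interpret S: solver n K ?k "k < 0" "parcs G" "parcs T" inp max_level level .
  let ?z = "\<lambda>_. 0 :: nat"
  have sbase: "S.sbase = length x" unfolding S.sbase_def by (simp add: x_def length_encode)
  have mem: "S.mem (?z, ?z, ?z) = inp"
  proof
    fix a
    show "S.mem (?z, ?z, ?z) a = inp a"
    proof (cases "a < length x")
      case False
      then have "S.mem (?z, ?z, ?z) a = 0" unfolding S.mem_def by (simp add: sbase)
      with False show ?thesis by (simp add: inp_def)
    qed (simp add: S.mem_inp sbase)
  qed
  have init: "initial com_main x = \<lparr>control = com_main, memory = S.mem (?z, ?z, ?z), elapsed = 0,
      peak = memory_bits (S.mem (?z, ?z, ?z))\<rparr>"
    unfolding mem by (simp add: initial_def inp_def Let_def)
  have ok: "S.ok (S.mem (?z, ?z, ?z))"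
  proof -
    have "inp a < 2 ^ K" for a
    proof (cases "a < length x")
      case True
      then have "x ! a \<in> set x" by simp
      then have "bits (x ! a) \<le> K" using bits_le_input_size[of "x ! a" x] K(2) by (simp add: L_def)
      then have "(2::nat) ^ bits (x ! a) \<le> 2 ^ K" by (intro power_increasing) auto
      from less_le_trans[OF less_two_power_bits this] show ?thesis using True by (simp add: inp_def)
    qed (simp add: inp_def)
    moreover have "inp a = 0" if "a \<ge> S.mlen" for a
      using that by (simp add: inp_def S.mlen_def sbase)
    ultimately show ?thesis unfolding bounded_memory_def mem by blast
  qed
  define C where "C = K * expr_cost"
  have C: "cost e m \<le> C" if "e \<in> exprs com_main" "S.ok m" for e m
  proof -
    have "cost_weight e \<le> expr_cost"
      unfolding expr_cost_def using that(1) finite_exprs by (intro member_le_sum) auto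
    then have "K * cost_weight e \<le> C" unfolding C_def by (rule mult_le_mono2)
    moreover have "cost e m \<le> K * cost_weight e"
      using that(2) K(2) by (intro cost_le) (auto simp: bounded_memory_def)
    ultimately show ?thesis by linarith
  qed
  define A where "A = S.mlen * (S.mlen + K)"
  have A: "memory_bits m \<le> A" if "S.ok m" for m
    unfolding A_def using that by (rule memory_bits_le)
  have mlen: "S.mlen \<le> 33 + 2 * L * L + 2 * L"
  proof -
    have "n * n \<le> L * L" using nL by (intro mult_le_mono)
    then show ?thesis using nL by (simp add: S.mlen_def S.sbase_def)
  qed
  have space: "A + (2 * C + 1) \<le> space_bound L"
  proof -
    have "A \<le> (33 + 2 * L * L + 2 * L) * (33 + 2 * L * L + 2 * L + K)"
      unfolding A_def using mlen by (intro mult_le_mono add_mono le_refl)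
    then show ?thesis unfolding space_bound_def C_def K_def by linarith
  qed
  have run: "let D = run N (initial com_main x) in map_pmf memory D = \<mu> \<and>
      (\<forall>c\<in>set_pmf D. halted c \<and> elapsed c \<le> time_bound L * 4 ^ d \<and> peak c \<le> space_bound L)"
    if ex: "exec S.ok N com_main (S.mem (?z, ?z, ?z)) \<mu>" and N: "N \<le> 4 ^ (max_level + 1) * step_bound n" for N \<mu>
  proof -
    from exec_run[OF ex subset_refl C A init] have r: "map_pmf memory (run N (initial com_main x)) = \<mu>"
      "\<forall>y\<in>set_pmf (run N (initial com_main x)). halted y \<and> elapsed y \<le> 0 + N * (2 * C + 1) \<and>
        peak y \<le> max (memory_bits (S.mem (?z, ?z, ?z))) (A + (2 * C + 1))" by auto
    \<comment> \<open>Levels start at 0 while the depth counts vertices, so the enumeration over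
      \<open>max_level + 1\<close> digits costs at most \<open>4 ^ d\<close>.\<close>
    have "N \<le> 4 ^ d * step_bound L"
      using N max_level_less_depth step_bound_mono[OF nL]
      by (meson le_trans mult_le_mono power_increasing one_le_numeral)
    then have "N * (2 * C + 1) \<le> 4 ^ d * step_bound L * (2 * C + 1)" by (rule mult_le_mono1)
    also have "\<dots> = time_bound L * 4 ^ d" by (simp only: time_bound_def C_def K_def mult_ac)
    finally have t: "N * (2 * C + 1) \<le> time_bound L * 4 ^ d" .
    have "max (memory_bits (S.mem (?z, ?z, ?z))) (A + (2 * C + 1)) \<le> space_bound L"
      using A[OF ok] space by simp
    then have "halted y \<and> elapsed y \<le> time_bound L * 4 ^ d \<and> peak y \<le> space_bound L"
      if "y \<in> set_pmf (run N (initial com_main x))" for y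
      using bspec[OF r(2) that] t by linarith
    then show ?thesis unfolding Let_def using r(1) by (intro conjI ballI) simp_all
  qed
  have yes: "answers_yes c \<longleftrightarrow> memory c 0 = 1" if "halted c" for c
    using that by (simp add: answers_yes_def)
  have card_le: "card X \<le> n" if "S.cds X" for X
    using that card_mono[of "{..<n}" X] by (simp add: S.cds_def)
  have card_pos: "card X > 0" if "S.cds X" for X
  proof -
    have "X \<noteq> {}" using that n_positive by (auto simp: S.cds_def S.undominated_def)
    moreover have "finite X" using that finite_subset by (auto simp: S.cds_def)
    ultimately show ?thesis by (simp add: card_gt_0_iff)
  qed
  show ?thesis
  proof (cases "k < 0 \<or> ?k = 0 \<or> ?k > n")
    case True
    let ?\<mu> = "return_pmf ((S.mem (?z, ?z, ?z))(0 := 0))"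
    have "(1::nat) * 20 \<le> 4 ^ (max_level + 1) * step_bound n" by (intro mult_le_mono) (auto simp: step_bound_def)
    then have "2 \<le> 4 ^ (max_level + 1) * step_bound n" by linarith
    from run[OF S.exec_main_reject[OF ok True] this]
    have D: "map_pmf memory (run 2 (initial com_main x)) = ?\<mu>"
      "\<forall>c\<in>set_pmf (run 2 (initial com_main x)). halted c \<and> elapsed c \<le> time_bound L * 4 ^ d \<and> peak c \<le> space_bound L"
      by (simp_all add: Let_def)
    have "memory c \<in> set_pmf ?\<mu>" if "c \<in> set_pmf (run 2 (initial com_main x))" for c
      using that unfolding D(1)[symmetric] by simp
    then have no: "\<forall>c\<in>set_pmf (run 2 (initial com_main x)). \<not> answers_yes c"
      by (auto simp: answers_yes_def)
    have "\<not> connected_dominating_set (with_proj G) k"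
    proof
      assume "connected_dominating_set (with_proj G) k"
      then obtain X where X: "S.cds X" "int (card X) = k" unfolding cds_iff by blast
      then show False using True card_le[OF X(1)] card_pos[OF X(1)] by auto
    qed
    show ?thesis
      unfolding Let_def L_def[symmetric]
      by (rule exI[of _ 2], intro conjI, rule D(2))
        (use no \<open>\<not> connected_dominating_set (with_proj G) k\<close> in simp_all)
  next
    case False
    then have k: "\<not> k < 0" "0 < ?k" "?k \<le> n" by auto
    have cds: "connected_dominating_set (with_proj G) k \<longleftrightarrow> (\<exists>X. S.cds X \<and> card X = ?k)"
    proof -
      have "int c = k \<longleftrightarrow> c = ?k" for c using k(1) by auto
      then show ?thesis unfolding cds_iff by simp
    qed
    obtain b fin where b: "2 * n \<le> 2 ^ b"
      and ex: "exec S.ok (4 ^ (max_level + 1) * step_bound n) com_main (S.mem (?z, ?z, ?z))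
        (map_pmf fin (pmf_of_set {..<2 ^ (b * n)}))"
      and sound: "\<And>r. r < 2 ^ (b * n) \<Longrightarrow> fin r 0 = 1 \<Longrightarrow> \<exists>X. S.cds X \<and> card X = ?k"
      and complete: "\<And>r. r < 2 ^ (b * n) \<Longrightarrow> \<exists>!A. minimiser (digit_weight b r) {X. S.cds X \<and> card X = ?k} A \<Longrightarrow> fin r 0 = 1"
      using S.exec_main[OF ok k] by blast
    define N where "N = 4 ^ (max_level + 1) * step_bound n"
    let ?D = "run N (initial com_main x)" and ?U = "{..<(2::nat) ^ (b * n)}"
    from run[OF ex le_refl] have D: "map_pmf memory ?D = map_pmf fin (pmf_of_set ?U)"
      "\<forall>c\<in>set_pmf ?D. halted c \<and> elapsed c \<le> time_bound L * 4 ^ d \<and> peak c \<le> space_bound L"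
      by (simp_all add: Let_def N_def)
    have U: "?U \<noteq> {}" "finite ?U" by (simp_all add: lessThan_empty_iff)
    have no: "\<not> answers_yes c" if "c \<in> set_pmf ?D" "\<not> connected_dominating_set (with_proj G) k" for c
    proof
      assume "answers_yes c"
      then have "memory c 0 = 1" by (simp add: answers_yes_def)
      moreover have "memory c \<in> set_pmf (map_pmf fin (pmf_of_set ?U))"
        unfolding D(1)[symmetric] using that(1) by simp
      then obtain r where "r < 2 ^ (b * n)" "memory c = fin r" using U by auto
      ultimately show False using sound[of r] that(2) cds by simp
    qed
    have prob: "measure_pmf.prob ?D {c. answers_yes c} \<ge> 1 / 2" if "connected_dominating_set (with_proj G) k"
    proof -
      let ?F = "{X. S.cds X \<and> card X = ?k}"
      let ?bad = "{r. r < 2 ^ (b * n) \<and> \<not> (\<exists>!A. minimiser (digit_weight b r) ?F A)}"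
      let ?good = "?U \<inter> {r. fin r 0 = 1}"
      have "?F \<subseteq> Pow {..<n}" by (auto simp: S.cds_def)
      moreover have "?F \<noteq> {}" using that cds by auto
      ultimately have bad: "2 * card ?bad \<le> 2 ^ (b * n)" using b by (rule isolation)
      \<comment> \<open>A number is rejected only if it fails to isolate a solution, so at least
        half of the numbers are accepted.\<close>
      have "card ?U \<le> card (?good \<union> ?bad)" using complete by (intro card_mono) auto
      also have "\<dots> \<le> card ?good + card ?bad" by (rule card_Un_le)
      finally have "2 ^ (b * n) \<le> 2 * card ?good" using bad by simp
      then have "real (2 ^ (b * n)) \<le> real (2 * card ?good)" by (rule of_nat_mono)
      then have half: "1 / 2 \<le> real (card ?good) / real (card ?U)" by (simp add: field_simps)
      \<comment> \<open>All configurations reached have halted, so the answer is decided by cell 0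
        alone.\<close>
      have "measure_pmf.prob ?D {c. answers_yes c} = measure_pmf.prob ?D (memory -` {m. m 0 = 1})"
      proof (rule measure_pmf.finite_measure_eq_AE)
        show "AE c in measure_pmf ?D. c \<in> {c. answers_yes c} \<longleftrightarrow> c \<in> memory -` {m. m 0 = 1}"
          using D(2) yes by (auto simp: AE_measure_pmf_iff)
      qed auto
      also have "\<dots> = measure_pmf.prob (map_pmf fin (pmf_of_set ?U)) {m. m 0 = 1}"
        unfolding D(1)[symmetric] by simp
      also have "\<dots> = measure_pmf.prob (pmf_of_set ?U) {r. fin r 0 = 1}"
        by (simp add: vimage_def)
      also have "\<dots> = real (card ?good) / real (card ?U)"
        using U by (simp add: measure_pmf_of_set)
      finally show ?thesis using half by simp
    qed
    show ?thesis
      unfolding Let_def L_def[symmetric]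
      by (rule exI[of _ N], intro conjI, rule D(2)) (use no prob in simp_all)
  qed
qed

end

theorem theorem3p15:
  shows "\<exists>(P :: com) (p :: nat poly) (q :: nat poly).
    \<forall>(n :: nat) (G :: nat pair_pre_digraph) (k :: int) (T :: nat pair_pre_digraph) (d :: nat).
      pair_graph G \<and> pverts G = {..<n} \<and> Digraph_Component.connected (with_proj G) \<and>
      elimination_forest (with_proj G) (with_proj T) \<and> forest_depth (with_proj T) = d \<longrightarrow>
      (let x = encode n G k T in
       \<exists>N. let D = run N (initial P x) in
         (\<forall>c \<in> set_pmf D. halted c \<and>
            elapsed c \<le> poly p (input_size x) * 4 ^ d \<and>
            peak c \<le> poly q (input_size x)) \<and>
         (\<not> connected_dominating_set (with_proj G) k \<longrightarrow> (\<forall>c \<in> set_pmf D. \<not> answers_yes c)) \<and>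
         (connected_dominating_set (with_proj G) k \<longrightarrow>
            measure_pmf.prob D {c. answers_yes c} \<ge> 1 / 2))"
proof -
  obtain p q where p: "\<And>x. poly p x = time_bound x" and q: "\<And>x. poly q x = space_bound x"
    using is_poly_time_bound is_poly_space_bound unfolding is_poly_def by blast
  show ?thesis
  proof (rule exI[of _ com_main], rule exI[of _ p], rule exI[of _ q], intro allI impI, elim conjE, goal_cases)
    case (1 n G k T d)
    then interpret forest_instance n d G T by (intro forest_instance.intro)
    show ?case unfolding p q Let_def[of "encode n G k T"] by (rule main_correct)
  qed
qed

end
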